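(* Consider the reallocation problem restricted to instances in which the product size is uniform (${\it size}(p)$ the same for all $p$) and $d^-(w)=+\infty$ for all $w\in W$ (or, alternatively, $d^+(w)=+\infty$ for all $w$), with arbitrary transit times, warehouse capacities and the other carry capacity. There is an ${\mathrm O}(mn\log m)$-time algorithm that outputs a feasible schedule whose completion time is at most twice the minimum completion time of a feasible schedule, where $m=|P|$, $n=|W|$.
   Context: Reallocation problem. An instance consists of a finite set $W$ of warehouses ($n=|W|$) and a finite set $P$ of products ($m=|P|$). Each product $p$ has a size ${\it size}(p)\ge0$, source $s(p)\in W$, sink $t(p)\in W$ with $s(p)\ne t(p)$, transit time $\tau(p)\in\mathbb{Z}_{>0}$. Each warehouse $w$ has warehouse capacity $c(w)$, carry-out capacity $d^+(w)$, carry-in capacity $d^-(w)$, each a nonnegative real or $+\infty$ (constraint vacuous). $P^+(w)=\{p:s(p)=w\}$, $P^-(w)=\{p:t(p)=w\}$. Standing assumptions: ${\it size}(p)\le d^+(w)$ for $p\in P^+(w)$, ${\it size}(p)\le d^-(w)$ for $p\in P^-(w)$, $\sum_{P^+(w)}{\it size}\le c(w)$, $\sum_{P^-(w)}{\it size}\le c(w)$. A schedule $\varphi:P\to\mathbb{Z}_{\ge0}$ is feasible if for all $\theta\in\mathbb{Z}_{\ge0}$, $w\in W$: (i) $\sum_{p\in P^+(w):\varphi(p)=\theta}{\it size}(p)\le d^+(w)$; (ii) $\sum_{p\in P^-(w):\varphi(p)=\theta-\tau(p)}{\it size}(p)\le d^-(w)$; (iii) $\sum_{p\in P^+(w):\varphi(p)\ge\theta}{\it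 size}(p)+\sum_{p\in P^-(w):\varphi(p)\le\theta-\tau(p)}{\it size}(p)\le c(w)$. Completion time: $\max_p(\varphi(p)+\tau(p))$. *)

theory Defs
  imports Complex_Main "HOL-Library.Extended_Real"
begin

section \<open>The reallocation problem\<close>

record ('w, 'p) reallocation =
  warehouses :: "'w set"
  products :: "'p set"
  psize :: "'p \<Rightarrow> real"
  source :: "'p \<Rightarrow> 'w"
  sink :: "'p \<Rightarrow> 'w"
  transit :: "'p \<Rightarrow> nat"
  capacity :: "'w \<Rightarrow> ereal"
  carry_out :: "'w \<Rightarrow> ereal"
  carry_in :: "'w \<Rightarrow> ereal"

definition out_products :: "('w, 'p) reallocation \<Rightarrow> 'w \<Rightarrow> 'p set" where
  "out_products I w = {p \<in> products I. source I p = w}"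

definition in_products :: "('w, 'p) reallocation \<Rightarrow> 'w \<Rightarrow> 'p set" where
  "in_products I w = {p \<in> products I. sink I p = w}"

definition reallocation_instance :: "('w, 'p) reallocation \<Rightarrow> bool" where
  "reallocation_instance I \<longleftrightarrow>
     finite (warehouses I) \<and> finite (products I) \<and>
     (\<forall>p \<in> products I.
        0 \<le> psize I p \<and> source I p \<in> warehouses I \<and> sink I p \<in> warehouses I \<and>
        source I p \<noteq> sink I p \<and> 0 < transit I p) \<and>
     (\<forall>w \<in> warehouses I.
        0 \<le> capacity I w \<and> 0 \<le> carry_out I w \<and> 0 \<le> carry_in I w \<and>
        (\<forall>p \<in> out_products I w. ereal (psize I p) \<le> carry_out I w) \<and>
        (\<forall>p \<in> in_products I w. ereal (psize I p) \<le> carry_in I w) \<and>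
        ereal (\<Sum>p \<in> out_products I w. psize I p) \<le> capacity I w \<and>
        ereal (\<Sum>p \<in> in_products I w. psize I p) \<le> capacity I w)"

definition uniform_size :: "('w, 'p) reallocation \<Rightarrow> bool" where
  "uniform_size I \<longleftrightarrow> (\<forall>p \<in> products I. \<forall>q \<in> products I. psize I p = psize I q)"

text \<open>Schedules are total functions, but only their values on the products matter.
  The conditions \<open>\<phi> p = \<theta> - \<tau> p\<close> and \<open>\<phi> p \<le> \<theta> - \<tau> p\<close>, meant with integer
  subtraction, are written additively because subtraction on \<open>nat\<close> truncates.\<close>

definition feasible :: "('w, 'p) reallocation \<Rightarrow> ('p \<Rightarrow> nat) \<Rightarrow> bool" where
  "feasible I \<phi> \<longleftrightarrow>
     (\<forall>\<theta>. \<forall>w \<in> warehouses I.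
        ereal (\<Sum>p \<in> {p \<in> out_products I w. \<phi> p = \<theta>}. psize I p) \<le> carry_out I w \<and>
        ereal (\<Sum>p \<in> {p \<in> in_products I w. \<phi> p + transit I p = \<theta>}. psize I p)
          \<le> carry_in I w \<and>
        ereal ((\<Sum>p \<in> {p \<in> out_products I w. \<phi> p \<ge> \<theta>}. psize I p) +
               (\<Sum>p \<in> {p \<in> in_products I w. \<phi> p + transit I p \<le> \<theta>}. psize I p))
          \<le> capacity I w)"

text \<open>The inserted \<open>0\<close> has an effect only if there are no products.\<close>

definition completion_time :: "('w, 'p) reallocation \<Rightarrow> ('p \<Rightarrow> nat) \<Rightarrow> nat" where
  "completion_time I \<phi> = Max (insert 0 ((\<lambda>p. \<phi> p + transit I p) ` products I))"

definition min_completion_time :: "('w, 'p) reallocation \<Rightarrow> nat" where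
  "min_completion_time I = (LEAST T. \<exists>\<psi>. feasible I \<psi> \<and> completion_time I \<psi> = T)"


section \<open>The machine model\<close>

text \<open>
  Running times refer to a unit-cost random access machine, programmed in a structured
  while-language, with two separate memories of named arrays: one of integers
  (counters, indices, times) and one of reals (sizes, capacities). Scalar variables are the
  cells with index \<open>0\<close>. Memory is addressed by integers only; reals can influence integers
  only through comparisons (there is no rounding operation).

  There is deliberately no multiplication: addition, subtraction and halving lengthen
  integers by at most a constant number of bits per step, so unit cost does not permit
  computing with exponentially long numbers. A program may contain integer constants only.
\<close>

type_synonym name = string

record state =
  ints :: "name \<Rightarrow> int \<Rightarrow> int"
  reals :: "name \<Rightarrow> int \<Rightarrow> real"

datatype iexp =
    IConst int
  | ICell name iexp
  | IAdd iexp iexp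
  | ISub iexp iexp
  | IHalf iexp

datatype rexp =
    RConst int
  | RCell name iexp
  | RAdd rexp rexp
  | RSub rexp rexp

datatype bexp =
    ILess iexp iexp
  | RLess rexp rexp
  | Not bexp
  | And bexp bexp

datatype com =
    Skip
  | SetInt name iexp iexp   \<comment> \<open>array, index, new value\<close>
  | SetReal name iexp rexp
  | Seq com com
  | If bexp com com
  | While bexp com

primrec ival :: "iexp \<Rightarrow> state \<Rightarrow> int" where
  "ival (IConst k) s = k"
| "ival (ICell a e) s = ints s a (ival e s)"
| "ival (IAdd e f) s = ival e s + ival f s"
| "ival (ISub e f) s = ival e s - ival f s"
| "ival (IHalf e) s = ival e s div 2"

primrec rval :: "rexp \<Rightarrow> state \<Rightarrow> real" where
  "rval (RConst k) s = of_int k"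
| "rval (RCell a e) s = reals s a (ival e s)"
| "rval (RAdd e f) s = rval e s + rval f s"
| "rval (RSub e f) s = rval e s - rval f s"

primrec bval :: "bexp \<Rightarrow> state \<Rightarrow> bool" where
  "bval (ILess e f) s \<longleftrightarrow> ival e s < ival f s"
| "bval (RLess e f) s \<longleftrightarrow> rval e s < rval f s"
| "bval (Not b) s \<longleftrightarrow> \<not> bval b s"
| "bval (And b c) s \<longleftrightarrow> bval b s \<and> bval c s"

text \<open>\<open>exec c s t s'\<close>: started in \<open>s\<close>, the program \<open>c\<close> terminates in \<open>s'\<close> after \<open>t\<close> steps.
  Every assignment and every test is one step. As the expressions in a fixed program have
  bounded size, charging for each operation would change \<open>t\<close> by a constant factor only.\<close>

inductive exec :: "com \<Rightarrow> state \<Rightarrow> nat \<Rightarrow> state \<Rightarrow> bool" where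
  Skip: "exec Skip s 1 s"
| SetInt: "exec (SetInt a i e) s 1
     (s\<lparr>ints := (ints s)(a := (ints s a)(ival i s := ival e s))\<rparr>)"
| SetReal: "exec (SetReal a i e) s 1
     (s\<lparr>reals := (reals s)(a := (reals s a)(ival i s := rval e s))\<rparr>)"
| Seq: "exec c s t s' \<Longrightarrow> exec d s' u s'' \<Longrightarrow> exec (Seq c d) s (t + u) s''"
| IfTrue: "bval b s \<Longrightarrow> exec c s t s' \<Longrightarrow> exec (If b c d) s (1 + t) s'"
| IfFalse: "\<not> bval b s \<Longrightarrow> exec d s t s' \<Longrightarrow> exec (If b c d) s (1 + t) s'"
| WhileFalse: "\<not> bval b s \<Longrightarrow> exec (While b c) s 1 s"
| WhileTrue: "bval b s \<Longrightarrow> exec c s t s' \<Longrightarrow> exec (While b c) s' u s'' \<Longrightarrow>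
     exec (While b c) s (1 + t + u) s''"


section \<open>Input and output of programs\<close>

text \<open>Programs work on instances whose warehouses and products are numbered from \<open>0\<close>,
  which is no loss of generality for finite sets.\<close>

definition numbered :: "(nat, nat) reallocation \<Rightarrow> bool" where
  "numbered I \<longleftrightarrow>
     warehouses I = {..<card (warehouses I)} \<and> products I = {..<card (products I)}"

definition table :: "nat set \<Rightarrow> (nat \<Rightarrow> 'a::zero) \<Rightarrow> int \<Rightarrow> 'a" where
  "table A f i = (if 0 \<le> i \<and> nat i \<in> A then f (nat i) else 0)"

text \<open>Capacities are nonnegative, so \<open>-1\<close> can stand for \<open>\<infinity>\<close>.\<close>

definition cap_code :: "ereal \<Rightarrow> real" where
  "cap_code x = (if x = \<infinity> then -1 else real_of_ereal x)"

text \<open>All cells not used by the input are \<open>0\<close>.\<close>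

definition initial_state :: "(nat, nat) reallocation \<Rightarrow> state" where
  "initial_state I =
     \<lparr>ints = (\<lambda>_ _. 0)(
        ''warehouses'' := table {0} (\<lambda>_. int (card (warehouses I))),
        ''products'' := table {0} (\<lambda>_. int (card (products I))),
        ''source'' := table (products I) (\<lambda>p. int (source I p)),
        ''sink'' := table (products I) (\<lambda>p. int (sink I p)),
        ''transit'' := table (products I) (\<lambda>p. int (transit I p))),
      reals = (\<lambda>_ _. 0)(
        ''size'' := table (products I) (psize I),
        ''capacity'' := table (warehouses I) (\<lambda>w. cap_code (capacity I w)),
        ''carry_out'' := table (warehouses I) (\<lambda>w. cap_code (carry_out I w)),
        ''carry_in'' := table (warehouses I) (\<lambda>w. cap_code (carry_in I w)))\<rparr>"

definition outputs_schedule ::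
    "com \<Rightarrow> (nat, nat) reallocation \<Rightarrow> nat \<Rightarrow> (nat \<Rightarrow> nat) \<Rightarrow> bool" where
  "outputs_schedule prog I t \<phi> \<longleftrightarrow>
     (\<exists>s. exec prog (initial_state I) t s \<and>
          (\<forall>p \<in> products I. ints s ''schedule'' (int p) = int (\<phi> p)))"

end

theory Submission
  imports Defs
begin

text \<open>
  Counted in units of the common product size, all capacities are integers. Let \<open>T\<close> be the minimum
  completion time and let \<open>D w\<close> be the number of products that \<open>w\<close> can send per time step; then
  \<open>w\<close> has at most \<open>D w * T\<close> outgoing products, and no transit time exceeds \<open>T\<close>.

  The products are first distributed among \<open>R = 2 ^ k\<close> rounds, where \<open>R\<close> is the least power of two
  such that \<open>w\<close> has at most \<open>D w * R\<close> outgoing products for every \<open>w\<close>, so that \<open>R \<le> 2 * T\<close>. This is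
  done by repeated halving. In each class, the two ends of every product are paired with ends of other
  products: sources at the same warehouse with each other, sinks likewise, a remaining source with
  a remaining sink there, and all other ends arbitrarily. Walking along the resulting cycles and putting
  the products traversed forwards into one half and those traversed backwards into the other, one
  splits the out-degree and the in-degree of each warehouse evenly and with the same rounding. Hence no
  warehouse sends more than \<open>D w\<close> products in a round, and in each round it receives at most as many
  as it sends (or at least as many, if it has more incoming than outgoing products altogether).
  If a product of round \<open>\<phi>\<close> arrives after time \<open>\<phi>\<close> and every warehouse sends its products no
  later than the rounds do, then the warehouse capacities are respected.

  The rounds alone would only give completion time \<open>3 * T\<close>. Therefore the products are placed anew, in
  the order of decreasing rounds: a product of round \<open>\<phi>\<close> and transit time \<open>\<tau>\<close> gets the first slot
  from \<open>\<phi> + 1 - \<tau>\<close> on in which its source has sent fewer than \<open>D w\<close> products. If it arrived after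
  \<open>2 * T\<close>, then all slots from its release to \<open>2 * T - \<tau>\<close> would be filled with products of round
  at least \<open>\<phi>\<close>, which are too few. A segment tree finds the slots in logarithmic time.

  If the carry-out capacities are infinite, the algorithm is applied to the reversed instance.
\<close>

section \<open>Program logic\<close>

text \<open>The capacities of the warehouses are the obstacle: the standing assumptions only
  guarantee room for the larger of the total outgoing and the total incoming amount. So where more
  products leave than arrive, arrivals must never outnumber departures; elsewhere pending departures
  must never outnumber pending arrivals. As transit times are arbitrary, the rounds serve as a
  common clock for the two ends of a product: a sink only asks for an arrival after the round, which
  gives a lower bound for the slot, and a source only asks for sending without delay, which a greedy
  placement achieves.

  Rounding \<open>R\<close> to a power of two may cost a factor of 2, and a transit time may add
  \<open>T\<close>, but not both at once: a product with a positive release starts earlier by its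
  transit time, and one with release \<open>0\<close> competes with at most \<open>D w * T\<close>
  products.

  \<open>T\<close> is unknown to the program and occurs in the analysis only. The time is even of
  order \<open>(m + n) * log m\<close>: memory is initially zero, and no table indexed by warehouses
  and classes is ever cleared.\<close>

primrec mods :: "com \<Rightarrow> name set" where
  "mods Skip = {}"
| "mods (SetInt a i e) = {a}"
| "mods (SetReal a i e) = {a}"
| "mods (Seq c d) = mods c \<union> mods d"
| "mods (If b c d) = mods c \<union> mods d"
| "mods (While b c) = mods c"

definition frame :: "name set \<Rightarrow> state \<Rightarrow> state \<Rightarrow> bool" where
  "frame M s s' \<longleftrightarrow> (\<forall>a. a \<notin> M \<longrightarrow> ints s' a = ints s a \<and> reals s' a = reals s a)"

lemma frame_refl: "frame M s s"
  by (simp add: frame_def)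

lemma frame_trans: "frame M s s' \<Longrightarrow> frame N s' s'' \<Longrightarrow> frame (M \<union> N) s s''"
  by (simp add: frame_def)

lemma frame_ints: "frame M s s' \<Longrightarrow> a \<notin> M \<Longrightarrow> ints s' a = ints s a"
  by (simp add: frame_def)

lemma frame_reals: "frame M s s' \<Longrightarrow> a \<notin> M \<Longrightarrow> reals s' a = reals s a"
  by (simp add: frame_def)

lemma exec_frame: "exec c s t s' \<Longrightarrow> frame (mods c) s s'"
  by (induction rule: exec.induct) (auto simp: frame_def)

text \<open>The number argument of an assertion is the remaining time credit: every step consumes one
  unit, so no variant is needed to prove the termination of loops.\<close>

definition wp :: "com \<Rightarrow> (state \<Rightarrow> nat \<Rightarrow> bool) \<Rightarrow> state \<Rightarrow> nat \<Rightarrow> bool" where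
  "wp c Q s n \<longleftrightarrow> (\<exists>t s'. exec c s t s' \<and> t \<le> n \<and> Q s' (n - t))"

lemma wpE:
  assumes "wp c Q s n"
  obtains t s' where "exec c s t s'" "t \<le> n" "Q s' (n - t)" "frame (mods c) s s'"
  using assms exec_frame unfolding wp_def by blast

lemma wp_mono:
  assumes "wp c Q s n" "\<And>s' n'. Q s' n' \<Longrightarrow> frame (mods c) s s' \<Longrightarrow> Q' s' n'"
  shows "wp c Q' s n"
  using assms exec_frame unfolding wp_def by blast

inductive_cases Skip_exec: "exec Skip s t s'"
inductive_cases SetInt_exec: "exec (SetInt a i e) s t s'"
inductive_cases SetReal_exec: "exec (SetReal a i e) s t s'"
inductive_cases Seq_exec: "exec (Seq c d) s t s'"
inductive_cases If_exec: "exec (If b c d) s t s'"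

lemma wp_Skip: "wp Skip Q s n \<longleftrightarrow> 1 \<le> n \<and> Q s (n - 1)"
  unfolding wp_def by (auto elim: Skip_exec intro: exec.Skip[simplified])

lemma wp_SetInt: "wp (SetInt a i e) Q s n \<longleftrightarrow> 1 \<le> n \<and>
    Q (s\<lparr>ints := (ints s)(a := (ints s a)(ival i s := ival e s))\<rparr>) (n - 1)"
  unfolding wp_def by (auto elim: SetInt_exec intro: exec.SetInt[simplified])

lemma wp_SetReal: "wp (SetReal a i e) Q s n \<longleftrightarrow> 1 \<le> n \<and>
    Q (s\<lparr>reals := (reals s)(a := (reals s a)(ival i s := rval e s))\<rparr>) (n - 1)"
  unfolding wp_def by (auto elim: SetReal_exec intro: exec.SetReal[simplified])

lemma wp_Seq: "wp (Seq c d) Q s n \<longleftrightarrow> wp c (wp d Q) s n"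
proof
  assume "wp (Seq c d) Q s n"
  then obtain t u s' s'' where "exec c s t s'" "exec d s' u s''" "t + u \<le> n" "Q s'' (n - (t + u))"
    unfolding wp_def by (auto elim: Seq_exec)
  then show "wp c (wp d Q) s n"
    unfolding wp_def by (intro exI[of _ t] exI[of _ s'] conjI exI[of _ u] exI[of _ s'']) auto
next
  assume "wp c (wp d Q) s n"
  then obtain t u s' s'' where "exec c s t s'" "t \<le> n" "exec d s' u s''" "u \<le> n - t"
      "Q s'' (n - t - u)"
    unfolding wp_def by blast
  then show "wp (Seq c d) Q s n"
    unfolding wp_def
    by (intro exI[of _ "t + u"] exI[of _ s'']) (auto intro: exec.Seq)
qed

lemma wp_If: "wp (If b c d) Q s n \<longleftrightarrow>
    1 \<le> n \<and> (if bval b s then wp c Q s (n - 1) else wp d Q s (n - 1))"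
proof -
  have A: "\<exists>t s'. exec (If b c d) s t s' \<and> t \<le> n \<and> Q s' (n - t)"
    if "1 \<le> n" "exec (if bval b s then c else d) s t s'" "t \<le> n - 1" "Q s' (n - 1 - t)" for t s'
    using that by (intro exI[of _ "1 + t"] exI[of _ s'])
      (auto intro: exec.IfTrue[simplified] exec.IfFalse[simplified] split: if_splits)
  have H: "t \<le> n - Suc 0" if "Suc t \<le> n" for t
    using that by simp
  show ?thesis
    unfolding wp_def
    apply (rule iffI)
     apply (clarsimp elim!: If_exec)
     apply (elim If_exec; fastforce intro: H)
    using A by (auto split: if_splits)
qed

lemmas wp_simps = wp_Skip wp_SetInt wp_SetReal wp_Seq wp_If

lemma wp_While:
  assumes "I s n"
    and step: "\<And>s' n'. I s' n' \<Longrightarrow> frame (mods c) s s' \<Longrightarrow> bval b s' \<Longrightarrow>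
      1 \<le> n' \<and> wp c I s' (n' - 1)"
    and exit: "\<And>s' n'. I s' n' \<Longrightarrow> frame (mods c) s s' \<Longrightarrow> \<not> bval b s' \<Longrightarrow>
      1 \<le> n' \<and> Q s' (n' - 1)"
  shows "wp (While b c) Q s n"
proof -
  have "wp (While b c) Q s' n'" if "I s' n'" "frame (mods c) s s'" for s' n'
    using that
  proof (induction n' arbitrary: s' rule: less_induct)
    case (less n')
    show ?case
    proof (cases "bval b s'")
      case True
      from step[OF less.prems this] obtain t s'' where
        1: "1 \<le> n'" "exec c s' t s''" "t \<le> n' - 1" "I s'' (n' - 1 - t)" "frame (mods c) s' s''"
        by (auto elim: wpE)
      have "frame (mods c) s s''"
        using frame_trans[OF less.prems(2) 1(5)] by simp
      with less.IH[of "n' - 1 - t" s''] 1 have "wp (While b c) Q s'' (n' - 1 - t)"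
        by auto
      then obtain u s3 where 2: "exec (While b c) s'' u s3" "u \<le> n' - 1 - t" "Q s3 (n' - 1 - t - u)"
        by (auto elim: wpE)
      show ?thesis
        unfolding wp_def using 1 2 exec.WhileTrue[OF True 1(2) 2(1)]
        by (intro exI[of _ "1 + t + u"] exI[of _ s3]) auto
    next
      case False
      with exit[OF less.prems this] show ?thesis
        unfolding wp_def by (intro exI[of _ 1] exI[of _ s']) (auto intro: exec.WhileFalse[simplified])
    qed
  qed
  with assms(1) frame_refl show ?thesis by blast
qed

section \<open>Time-bounded executions and counting loops\<close>

definition runs :: "com \<Rightarrow> nat \<Rightarrow> (state \<Rightarrow> bool) \<Rightarrow> state \<Rightarrow> bool" where
  "runs c T Q s \<longleftrightarrow> (\<exists>t s'. exec c s t s' \<and> t \<le> T \<and> Q s')"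

lemma runsE:
  assumes "runs c T Q s"
  obtains t s' where "exec c s t s'" "t \<le> T" "Q s'" "frame (mods c) s s'"
  using assms exec_frame unfolding runs_def by blast

lemma runsI: "wp c (\<lambda>s' _. Q s') s T \<Longrightarrow> runs c T Q s"
  unfolding wp_def runs_def by blast

lemma runs_mono: "runs c T Q s \<Longrightarrow> T \<le> T' \<Longrightarrow> (\<And>s'. Q s' \<Longrightarrow> frame (mods c) s s' \<Longrightarrow> Q' s') \<Longrightarrow> runs c T' Q' s"
  unfolding runs_def using exec_frame le_trans by blast

lemma runs_Seq: "runs c T (runs d U Q) s \<Longrightarrow> runs (Seq c d) (T + U) Q s"
  unfolding runs_def by (meson add_le_mono exec.Seq)

lemma runs_SeqI:
  assumes "runs c T P s" "\<And>s'. P s' \<Longrightarrow> frame (mods c) s s' \<Longrightarrow> runs d U Q s'" "T + U \<le> V"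
  shows "runs (Seq c d) V Q s"
  using assms by (blast intro: runs_mono runs_Seq order.refl)

lemma wp_runs:
  assumes "runs c T Q s" "T \<le> n"
    and "\<And>s' n'. Q s' \<Longrightarrow> frame (mods c) s s' \<Longrightarrow> n - T \<le> n' \<Longrightarrow> Q' s' n'"
  shows "wp c Q' s n"
proof -
  from assms(1) obtain t s' where *: "exec c s t s'" "t \<le> T" "Q s'" "frame (mods c) s s'"
    by (rule runsE)
  with assms(2) assms(3)[of s' "n - t"] show ?thesis
    unfolding wp_def by (intro exI[of _ t] exI[of _ s']) auto
qed

abbreviation IVar :: "name \<Rightarrow> iexp" where
  "IVar x \<equiv> ICell x (IConst 0)"

abbreviation assign :: "name \<Rightarrow> iexp \<Rightarrow> com" (infix "::=" 61) where
  "x ::= e \<equiv> SetInt x (IConst 0) e"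

notation Seq (infixr ";;" 60)

abbreviation set_var :: "name \<Rightarrow> int \<Rightarrow> state \<Rightarrow> state" where
  "set_var x v s \<equiv> s\<lparr>ints := (ints s)(x := (ints s x)(0 := v))\<rparr>"

lemma frame_mono: "frame M s s' \<Longrightarrow> M \<subseteq> N \<Longrightarrow> frame N s s'"
  unfolding frame_def by blast

definition range_loop :: "name \<Rightarrow> iexp \<Rightarrow> iexp \<Rightarrow> com \<Rightarrow> com" where
  "range_loop x l u c = x ::= l;; While (ILess (IVar x) u) (c;; x ::= IAdd (IVar x) (IConst 1))"

lemma mods_range_loop [simp]: "mods (range_loop x l u c) = insert x (mods c)"
  by (auto simp: range_loop_def)

text \<open>The number \<open>v\<close> carried by the invariant is a potential: an iteration may
  spend \<open>T\<close> steps of its own plus whatever it takes from \<open>v\<close>, and passes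
  the rest on. The walk relies on this, as a single iteration may traverse a whole cycle there. The
  two extra steps per iteration are the test and the increment, the final two the initialization and
  the last test.\<close>

lemma runs_range_loop_amortized:
  assumes lo: "ival l s = lo" "lo \<le> hi"
    and u: "\<And>s'. frame (insert x (mods c)) s s' \<Longrightarrow> ival u s' = hi"
    and x: "x \<notin> mods c"
    and start: "Inv lo v (set_var x lo s)"
    and step: "\<And>i v s'. lo \<le> i \<Longrightarrow> i < hi \<Longrightarrow> ints s' x 0 = i \<Longrightarrow> Inv i v s' \<Longrightarrow>
      frame (insert x (mods c)) s s' \<Longrightarrow>
      wp c (\<lambda>s'' n. \<exists>w\<le>n. Inv (i + 1) w (set_var x (i + 1) s'')) s' (T + v)"
  shows "runs (range_loop x l u c) ((T + 2) * nat (hi - lo) + v + 2) (\<lambda>s'. \<exists>w. Inv hi w s') s"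
proof (rule runsI)
  define I where "I s' n \<longleftrightarrow> (\<exists>i v. lo \<le> i \<and> i \<le> hi \<and> ints s' x 0 = i \<and> Inv i v s' \<and>
    (T + 2) * nat (hi - i) + v + 1 \<le> n)" for s' n
  let ?s0 = "set_var x lo s"
  have f0: "frame (insert x (mods c)) s s'" if "frame (insert x (mods c)) ?s0 s'" for s'
    using that unfolding frame_def by auto
  have "wp (While (ILess (IVar x) u) (c;; x ::= IAdd (IVar x) (IConst 1))) (\<lambda>s' _. \<exists>w. Inv hi w s') ?s0
     ((T + 2) * nat (hi - lo) + v + 1)"
  proof (rule wp_While[where I = I])
    show "I ?s0 ((T + 2) * nat (hi - lo) + v + 1)"
      unfolding I_def using lo start by auto
  next
    fix s' n
    assume I: "I s' n" and fr: "frame (mods (c;; x ::= IAdd (IVar x) (IConst 1))) ?s0 s'"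
      and b: "bval (ILess (IVar x) u) s'"
    from fr have fr: "frame (insert x (mods c)) s s'" using f0 by simp
    from I obtain i v where i: "lo \<le> i" "i \<le> hi" "ints s' x 0 = i" "Inv i v s'"
        "(T + 2) * nat (hi - i) + v + 1 \<le> n"
      unfolding I_def by blast
    have "i < hi" using b i u[OF fr] by simp
    then have "nat (hi - i) = Suc (nat (hi - (i + 1)))" by simp
    then have n: "(T + 2) * nat (hi - (i + 1)) + T + v + 3 \<le> n" using i(5) by simp
    have "wp c (\<lambda>s'' n. \<exists>w\<le>n. Inv (i + 1) w (set_var x (i + 1) s'')) s' (T + v)"
      using step[OF i(1) \<open>i < hi\<close> i(3,4) fr] .
    then obtain t s'' w where c: "exec c s' t s''" "t \<le> T + v" "frame (mods c) s' s''"
      "w \<le> T + v - t" "Inv (i + 1) w (set_var x (i + 1) s'')"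
      by (auto elim: wpE)
    have "ints s'' x 0 = i" using frame_ints[OF c(3)] x i(3) by metis
    moreover have "Suc ((T + 2) * nat (hi - (i + 1)) + w) \<le> n - 1 - t - Suc 0"
      using n c(2,4) by simp
    ultimately have "wp (x ::= IAdd (IVar x) (IConst 1)) I s'' (n - 1 - t)"
      using n c i(1) \<open>i < hi\<close> by (auto simp: wp_simps I_def)
    with c n have "wp c (wp (x ::= IAdd (IVar x) (IConst 1)) I) s' (n - 1)"
      unfolding wp_def[of c] by (intro exI[of _ t] exI[of _ s'']) auto
    then show "1 \<le> n \<and> wp (c;; x ::= IAdd (IVar x) (IConst 1)) I s' (n - 1)"
      using n by (simp add: wp_Seq)
  next
    fix s' n
    assume I: "I s' n" and fr: "frame (mods (c;; x ::= IAdd (IVar x) (IConst 1))) ?s0 s'"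
      and b: "\<not> bval (ILess (IVar x) u) s'"
    from fr have fr: "frame (insert x (mods c)) s s'" using f0 by simp
    from I b u[OF fr] show "1 \<le> n \<and> (\<exists>w. Inv hi w s')"
      unfolding I_def by auto
  qed
  then show "wp (range_loop x l u c) (\<lambda>s' _. \<exists>w. Inv hi w s') s ((T + 2) * nat (hi - lo) + v + 2)"
    unfolding range_loop_def wp_simps using lo by simp
qed

lemma runs_range_loop:
  assumes "ival l s = lo" "lo \<le> hi"
    and "\<And>s'. frame (insert x (mods c)) s s' \<Longrightarrow> ival u s' = hi"
    and "x \<notin> mods c"
    and "Inv lo (set_var x lo s)"
    and step: "\<And>i s'. lo \<le> i \<Longrightarrow> i < hi \<Longrightarrow> ints s' x 0 = i \<Longrightarrow> Inv i s' \<Longrightarrow>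
      frame (insert x (mods c)) s s' \<Longrightarrow>
      runs c T (\<lambda>s''. Inv (i + 1) (set_var x (i + 1) s'')) s'"
  shows "runs (range_loop x l u c) ((T + 2) * nat (hi - lo) + 2) (Inv hi) s"
proof -
  have "runs (range_loop x l u c) ((T + 2) * nat (hi - lo) + 0 + 2) (\<lambda>s'. \<exists>w::nat. Inv hi s') s"
    by (rule runs_range_loop_amortized[where Inv = "\<lambda>i _. Inv i" and v = 0, OF assms(1-5)])
      (use step in \<open>fastforce elim: wp_runs\<close>)+
  then show ?thesis by simp
qed

section \<open>Splitting a class into halves\<close>

text \<open>The value \<open>0\<close> stands for an end without a partner.\<close>

definition pairing :: "int \<Rightarrow> (int \<Rightarrow> int) \<Rightarrow> bool" where
  "pairing N \<mu> \<longleftrightarrow> (\<forall>e\<in>{2..<N}. \<mu> e \<noteq> 0 \<longrightarrow> \<mu> e \<in> {2..<N} \<and> \<mu> e \<noteq> e \<and> \<mu> (\<mu> e) = e)"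

definition extends_pairing :: "int \<Rightarrow> (int \<Rightarrow> int) \<Rightarrow> (int \<Rightarrow> int) \<Rightarrow> (int \<Rightarrow> int) \<Rightarrow> bool" where
  "extends_pairing N \<kappa> \<mu>0 \<mu> \<longleftrightarrow> pairing N \<mu> \<and>
     (\<forall>x\<in>{2..<N}. \<mu>0 x \<noteq> 0 \<longrightarrow> \<mu> x = \<mu>0 x) \<and>
     (\<forall>x\<in>{2..<N}. \<mu>0 x = 0 \<longrightarrow> \<mu> x \<noteq> 0 \<longrightarrow> \<kappa> (\<mu> x) = \<kappa> x \<and> \<mu>0 (\<mu> x) = 0)"

text \<open>\<open>pend\<close> is a waiting room with one seat per key: it holds the only visited
  end with this key that is still without a partner. The next end with the same key is matched with
  it, so at most one end per key stays alone. The last conjunct records that the cells of foreign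
  keys keep their content, which lets later levels find zeros without any clearing.\<close>

definition pass_inv where
  "pass_inv N \<kappa> \<mu>0 pend0 e \<mu> pend \<longleftrightarrow> 2 \<le> e \<and> extends_pairing N \<kappa> \<mu>0 \<mu> \<and>
     (\<forall>x\<in>{e..<N}. \<mu>0 x = 0 \<longrightarrow> \<mu> x = 0) \<and>
     (\<forall>x\<in>{2..<e}. \<mu> x = 0 \<longrightarrow> pend (\<kappa> x) = x) \<and>
     (\<forall>k\<in>\<kappa> ` {2..<N}. pend k \<noteq> 0 \<longrightarrow> pend k \<in> {2..<e} \<and> \<kappa> (pend k) = k \<and> \<mu> (pend k) = 0) \<and>
     (\<forall>k. k \<notin> \<kappa> ` {2..<N} \<longrightarrow> pend k = (pend0 :: int \<Rightarrow> int) k)"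

lemma pass_inv_start:
  assumes "pairing N \<mu>" "\<forall>e\<in>{2..<N}. pend (\<kappa> e) = 0"
  shows "pass_inv N \<kappa> \<mu> pend 2 \<mu> pend"
  using assms unfolding pass_inv_def extends_pairing_def by auto

lemma pass_inv_skip:
  assumes "pass_inv N \<kappa> \<mu>0 pend0 e \<mu> pend" "\<mu> e \<noteq> 0" "e < N"
  shows "pass_inv N \<kappa> \<mu>0 pend0 (e + 1) \<mu> pend"
  using assms unfolding pass_inv_def by (auto simp: zless_add1_eq)

lemma pass_inv_wait:
  assumes I: "pass_inv N \<kappa> \<mu>0 pend0 e \<mu> pend" and "\<mu> e = 0" "e < N" "pend (\<kappa> e) = 0"
  shows "pass_inv N \<kappa> \<mu>0 pend0 (e + 1) \<mu> (pend(\<kappa> e := e))"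
proof -
  have "e \<in> {2..<N}" using assms unfolding pass_inv_def by auto
  then show ?thesis
    using assms unfolding pass_inv_def by (auto simp: zless_add1_eq)
qed

lemma pass_inv_match:
  assumes I: "pass_inv N \<kappa> \<mu>0 pend0 e \<mu> pend" and e: "\<mu> e = 0" "e < N" and "pend (\<kappa> e) \<noteq> 0"
  shows "pass_inv N \<kappa> \<mu>0 pend0 (e + 1) (\<mu>(e := pend (\<kappa> e), pend (\<kappa> e) := e)) (pend(\<kappa> e := 0))"
proof -
  define x where "x = pend (\<kappa> e)"
  have eN: "e \<in> {2..<N}" using assms unfolding pass_inv_def by auto
  then have x: "x \<in> {2..<e}" "\<kappa> x = \<kappa> e" "\<mu> x = 0" "x \<noteq> 0"
    using I assms(4) unfolding pass_inv_def x_def by auto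
  have xe: "\<mu>0 x = 0" "\<mu>0 e = 0"
    using I eN x e unfolding pass_inv_def extends_pairing_def by force+
  have P: "pairing N \<mu>" using I unfolding pass_inv_def extends_pairing_def by auto
  \<comment> \<open>If \<open>\<mu> y\<close> were \<open>x\<close> or \<open>e\<close>, the
    involution would give \<open>y = 0\<close>, as both are still unmatched; but ends start at
    \<open>2\<close>.\<close>
  have ne: "\<mu> y \<noteq> x" "\<mu> y \<noteq> e" if "y \<in> {2..<N}" for y
    using P that x e eN unfolding pairing_def by (metis x(4) atLeastLessThan_iff not_numeral_le_zero)+
  have P': "pairing N (\<mu>(e := x, x := e))"
    using P x eN ne unfolding pairing_def by auto
  have u: "y = x" if "y \<in> {2..<e}" "\<mu> y = 0" "\<kappa> y = \<kappa> e" for y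
    using I that unfolding pass_inv_def x_def by metis
  have E: "extends_pairing N \<kappa> \<mu>0 (\<mu>(e := x, x := e))"
    using I P' x xe ne e unfolding pass_inv_def extends_pairing_def by auto
  show ?thesis
    unfolding pass_inv_def x_def[symmetric]
  proof (intro conjI ballI impI allI)
    show "2 \<le> e + 1" using eN by auto
    show "extends_pairing N \<kappa> \<mu>0 (\<mu>(e := x, x := e))" by (fact E)
  next
    fix y assume "y \<in> {e + 1..<N}" "\<mu>0 y = 0"
    then show "(\<mu>(e := x, x := e)) y = 0"
      using I x unfolding pass_inv_def by auto
  next
    fix y assume y: "y \<in> {2..<e + 1}" "(\<mu>(e := x, x := e)) y = 0"
    then have "y \<noteq> x" "y \<noteq> e" using x eN by (auto split: if_splits)
    with y have "y \<in> {2..<e}" "\<mu> y = 0" by auto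
    with u \<open>y \<noteq> x\<close> have "\<kappa> y \<noteq> \<kappa> e" by blast
    then show "(pend(\<kappa> e := 0)) (\<kappa> y) = y"
      using I \<open>y \<in> {2..<e}\<close> \<open>\<mu> y = 0\<close> unfolding pass_inv_def by auto
  next
    fix k assume k: "k \<in> \<kappa> ` {2..<N}" "(pend(\<kappa> e := 0)) k \<noteq> 0"
    then have k2: "k \<noteq> \<kappa> e" "pend k \<in> {2..<e}" "\<kappa> (pend k) = k" "\<mu> (pend k) = 0"
      using I unfolding pass_inv_def by (auto split: if_splits)
    then show "(pend(\<kappa> e := 0)) k \<in> {2..<e + 1}" "\<kappa> ((pend(\<kappa> e := 0)) k) = k"
      "(\<mu>(e := x, x := e)) ((pend(\<kappa> e := 0)) k) = 0"
      using x by auto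
  next
    fix k assume "k \<notin> \<kappa> ` {2..<N}"
    then show "(pend(\<kappa> e := 0)) k = pend0 k"
      using I eN unfolding pass_inv_def by auto
  qed
qed

definition pass_post where
  "pass_post N \<kappa> \<mu>0 pend0 \<mu> pend \<longleftrightarrow> extends_pairing N \<kappa> \<mu>0 \<mu> \<and>
     (\<forall>x\<in>{2..<N}. \<forall>y\<in>{2..<N}. \<mu> x = 0 \<longrightarrow> \<mu> y = 0 \<longrightarrow> \<kappa> x = \<kappa> y \<longrightarrow> x = y) \<and>
     (\<forall>k. k \<notin> \<kappa> ` {2..<N} \<longrightarrow> pend k = (pend0 :: int \<Rightarrow> int) k)"

lemma pass_inv_end:
  assumes "pass_inv N \<kappa> \<mu>0 pend0 e \<mu> pend" "N \<le> e"
  shows "pass_post N \<kappa> \<mu>0 pend0 \<mu> pend"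
  using assms unfolding pass_inv_def pass_post_def
  by (auto, smt (verit) atLeastLessThan_iff)

abbreviation pair_end :: "name \<Rightarrow> iexp \<Rightarrow> com" where
  "pair_end a key \<equiv>
     If (ILess (ICell ''mate'' (IVar ''e'')) (IConst 1))
       (''k'' ::= key;;
        ''x'' ::= ICell a (IVar ''k'');;
        If (ILess (IConst 0) (IVar ''x''))
         (SetInt ''mate'' (IVar ''e'') (IVar ''x'');;
          SetInt ''mate'' (IVar ''x'') (IVar ''e'');;
          SetInt a (IVar ''k'') (IConst 0))
         (SetInt a (IVar ''k'') (IVar ''e'')))
       Skip"

definition pair_pass :: "name \<Rightarrow> iexp \<Rightarrow> com" where
  "pair_pass a key = range_loop ''e'' (IConst 2) (IVar ''end'')
     (pair_end a key)"

lemma mods_pair_pass: "mods (pair_pass a key) = {''e'', ''k'', ''x'', ''mate'', a}"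
  by (auto simp: pair_pass_def)

text \<open>The key has to be a function of the end alone, even after changes to the arrays that the
  pass writes, so that ends with equal keys meet in the same cell of \<open>a\<close>. Of the 9
  steps per end, 2 belong to the loop.\<close>

lemma pair_pass:
  assumes N: "ints s ''end'' 0 = N" "2 \<le> N"
    and a: "a \<notin> {''e'', ''k'', ''x'', ''mate'', ''end''}"
    and key: "\<And>s'. frame {''e'', ''k'', ''x'', ''mate'', a} s s' \<Longrightarrow>
       ints s' ''e'' 0 \<in> {2..<N} \<Longrightarrow> ival key s' = \<kappa> (ints s' ''e'' 0)"
    and pairing: "pairing N (ints s ''mate'')"
    and zero: "\<forall>e\<in>{2..<N}. ints s a (\<kappa> e) = 0"
  shows "runs (pair_pass a key) (9 * nat (N - 2) + 2)
    (\<lambda>s'. pass_post N \<kappa> (ints s ''mate'') (ints s a) (ints s' ''mate'') (ints s' a)) s"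
proof -
  define Inv where "Inv e s' \<longleftrightarrow>
    pass_inv N \<kappa> (ints s ''mate'') (ints s a) e (ints s' ''mate'') (ints s' a)" for e and s' :: state
  have a': "a \<noteq> ''e''" "a \<noteq> ''k''" "a \<noteq> ''x''" "a \<noteq> ''mate''" "a \<noteq> ''end''"
      "''e'' \<noteq> a" "''k'' \<noteq> a" "''x'' \<noteq> a" "''mate'' \<noteq> a" "''end'' \<noteq> a"
      using a by auto
  have "runs (pair_pass a key) ((7 + 2) * nat (N - 2) + 2) (Inv N) s"
    unfolding pair_pass_def
  proof (rule runs_range_loop)
    show "Inv 2 (set_var ''e'' 2 s)"
      unfolding Inv_def using pass_inv_start[OF pairing, of "ints s a" \<kappa>] zero a' by simp
  next
    fix e s'
    assume e: "2 \<le> e" "e < N" "ints s' ''e'' 0 = e" and I: "Inv e s'"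
      and "frame (insert ''e'' (mods (pair_end a key))) s s'"
    then have fr: "frame {''e'', ''k'', ''x'', ''mate'', a} s s'"
      by (auto elim: frame_mono)
    note P = I[unfolded Inv_def]
    \<comment> \<open>Programs can only compare by \<open><\<close>. Nonzero entries are ends and
      hence at least \<open>2\<close>, so comparing with \<open>1\<close> is a test for
      zero.\<close>
    have mate: "ints s' ''mate'' e < 1 \<longleftrightarrow> ints s' ''mate'' e = 0"
      using P e unfolding pass_inv_def extends_pairing_def pairing_def by force
    have key': "ival key s' = \<kappa> e" using key[OF fr] e by auto
    have pend: "0 < ints s' a (\<kappa> e) \<longleftrightarrow> ints s' a (\<kappa> e) \<noteq> 0"
      using P e unfolding pass_inv_def by force
    show "runs (pair_end a key) 7
      (\<lambda>s''. Inv (e + 1) (set_var ''e'' (e + 1) s'')) s'"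
      using e(2) pass_inv_skip[OF P] pass_inv_wait[OF P] pass_inv_match[OF P]
      by (intro runsI) (simp add: wp_simps e(3) mate key' pend a' Inv_def)
  qed (use N a' in \<open>auto simp: frame_def\<close>)
  then show ?thesis
    using pass_inv_end unfolding Inv_def by (auto elim: runs_mono)
qed

section \<open>Orientation of the products along cycles\<close>

text \<open>Product \<open>p\<close> has the source end \<open>2 * p\<close> and the sink end \<open>2 * p + 1\<close>. For the set \<open>X\<close> of the
  products traversed from source to sink, \<open>entered X e\<close> says that the product of \<open>e\<close> is entered
  through its end \<open>e\<close>.\<close>

definition entered :: "int set \<Rightarrow> int \<Rightarrow> bool" where
  "entered X e \<longleftrightarrow> (even e \<longleftrightarrow> e div 2 \<in> X)"

definition oriented :: "int \<Rightarrow> (int \<Rightarrow> int) \<Rightarrow> int set \<Rightarrow> int set \<Rightarrow> int set \<Rightarrow> bool" where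
  "oriented N \<mu> C X S \<longleftrightarrow> (\<forall>f\<in>{2..<N}. f div 2 \<in> C \<longrightarrow> f \<notin> S \<longrightarrow>
     \<mu> f div 2 \<in> C \<and> \<mu> f \<notin> S \<and> entered X f \<noteq> entered X (\<mu> f))"

text \<open>The walk has started at the end \<open>a\<close> and is about to enter through the end \<open>e\<close>, unless it has
  returned to \<open>a\<close>; \<open>x\<close> is the end through which the last product has been left.\<close>

definition walk_inv :: "int \<Rightarrow> (int \<Rightarrow> int) \<Rightarrow> int \<Rightarrow> int \<Rightarrow> int set \<Rightarrow> int set \<Rightarrow> bool" where
  "walk_inv N \<mu> a e C X \<longleftrightarrow> e \<in> {2..<N} \<and> ((e = a \<and> oriented N \<mu> C X {}) \<or>
     (\<exists>x\<in>{2..<N}. \<mu> x = e \<and> x div 2 \<in> C \<and> a div 2 \<in> C \<and> x \<noteq> a \<and> \<not> entered X x \<and> entered X a \<and>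
       oriented N \<mu> C X {a, x}))"

definition total_pairing :: "int \<Rightarrow> (int \<Rightarrow> int) \<Rightarrow> bool" where
  "total_pairing N \<mu> \<longleftrightarrow> (\<forall>e\<in>{2..<N}. \<mu> e \<in> {2..<N} \<and> \<mu> e \<noteq> e \<and> \<mu> (\<mu> e) = e)"

lemma oriented_cong:
  assumes "oriented N \<mu> C X S" "q \<notin> C" "X' - {q} = X - {q}"
    and "f \<in> {2..<N}" "f div 2 \<in> C" "f \<notin> S"
  shows "\<mu> f div 2 \<in> C \<and> \<mu> f \<notin> S \<and> entered X' f \<noteq> entered X' (\<mu> f)"
proof -
  have *: "\<mu> f div 2 \<in> C" "\<mu> f \<notin> S" "entered X f \<noteq> entered X (\<mu> f)"
    using assms unfolding oriented_def by blast+
  have "entered X' g = entered X g" if "g div 2 \<in> C" for g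
    using that assms(2,3) unfolding entered_def by blast
  with * assms(5) show ?thesis by blast
qed

text \<open>The product is traversed from \<open>e\<close> to its other end \<open>x'\<close>, and
  the walk continues with the mate of \<open>x'\<close>. The exceptional ends \<open>a\<close>,
  \<open>x\<close> are replaced by \<open>a\<close>, \<open>x'\<close>: the pair of \<open>x\<close>
  and \<open>e\<close> is now settled, because \<open>x\<close> has been left and \<open>e\<close>
  entered. The directions of the other products are not touched, as the product of \<open>e\<close>
  is new.\<close>

lemma walk_inv_step:
  assumes \<mu>: "total_pairing N \<mu>" and I: "walk_inv N \<mu> a e C X"
    and e: "e div 2 \<notin> C"
    and x': "x' \<in> {2..<N}" "x' div 2 = e div 2" "x' \<noteq> e"
    and X': "X' = (if even e then insert (e div 2) X else X - {e div 2})"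
  shows "walk_inv N \<mu> a (\<mu> x') (insert (e div 2) C) X'"
proof -
  define q where "q = e div 2"
  have eN: "e \<in> {2..<N}" using I unfolding walk_inv_def by blast
  have ends: "f = e \<or> f = x'" if "f div 2 = q" for f
    using that x' unfolding q_def by presburger
  have par: "even x' \<longleftrightarrow> odd e" using x' by presburger
  have ent: "entered X' e" "\<not> entered X' x'"
    using X' par x' by (auto simp: entered_def)
  have XX: "X' - {q} = X - {q}" using X' unfolding q_def by auto
  have ent_same: "entered X' g = entered X g" if "g div 2 \<in> C" for g
  proof -
    have "g div 2 \<noteq> q" using that e unfolding q_def by metis
    moreover have "g div 2 \<in> X' - {q} \<longleftrightarrow> g div 2 \<in> X - {q}" by (simp only: XX)
    ultimately show ?thesis unfolding entered_def by simp
  qed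
  have \<mu>x': "\<mu> x' \<in> {2..<N}" using \<mu> x' unfolding total_pairing_def by blast
  from I consider (start) "e = a" "oriented N \<mu> C X {}"
    | (run) x where "x \<in> {2..<N}" "\<mu> x = e" "x div 2 \<in> C" "a div 2 \<in> C" "x \<noteq> a"
        "\<not> entered X x" "entered X a" "oriented N \<mu> C X {a, x}"
    unfolding walk_inv_def by blast
  then show ?thesis
  proof cases
    case start
    have "oriented N \<mu> (insert q C) X' {a, x'}"
      unfolding oriented_def
    proof (intro ballI impI)
      fix f assume f: "f \<in> {2..<N}" "f div 2 \<in> insert q C" "f \<notin> {a, x'}"
      then have "f div 2 \<in> C" using ends start by blast
      from oriented_cong[OF start(2) e[folded q_def] XX f(1) this]
      have *: "\<mu> f div 2 \<in> C" "entered X' f \<noteq> entered X' (\<mu> f)" by auto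
      then have "\<mu> f \<noteq> a" "\<mu> f \<noteq> x'" using e x' start by auto
      with * show "\<mu> f div 2 \<in> insert q C \<and> \<mu> f \<notin> {a, x'} \<and> entered X' f \<noteq> entered X' (\<mu> f)"
        by blast
    qed
    moreover have "a div 2 = q" "x' div 2 = q" "x' \<noteq> a" "entered X' a"
      using start x' ent unfolding q_def by auto
    ultimately show ?thesis
      using \<mu>x' x'(1) ent(2) unfolding walk_inv_def q_def[symmetric] by blast
  next
    case run
    have \<mu>e: "\<mu> e = x" using \<mu> run unfolding total_pairing_def by blast
    have "oriented N \<mu> (insert q C) X' {a, x'}"
      unfolding oriented_def
    proof (intro ballI impI)
      fix f assume f: "f \<in> {2..<N}" "f div 2 \<in> insert q C" "f \<notin> {a, x'}"
      consider "f = e" | "f = x" | "f div 2 \<in> C" "f \<noteq> x" using f ends by blast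
      then show "\<mu> f div 2 \<in> insert q C \<and> \<mu> f \<notin> {a, x'} \<and> entered X' f \<noteq> entered X' (\<mu> f)"
      proof cases
        case 1
        then show ?thesis using \<mu>e run ent ent_same x' e by auto
      next
        case 2
        then show ?thesis using run ent ent_same x' e unfolding q_def by auto
      next
        case 3
        with f oriented_cong[OF run(8) e[folded q_def] XX f(1)]
        have *: "\<mu> f div 2 \<in> C" "entered X' f \<noteq> entered X' (\<mu> f)" "\<mu> f \<noteq> a" by auto
        then have "\<mu> f \<noteq> x'" using e x' by auto
        with * show ?thesis by blast
      qed
    qed
    moreover have "x' div 2 = q" "x' \<noteq> a" "entered X' a"
      using run x' e ent_same unfolding q_def by auto
    ultimately show ?thesis
      using \<mu>x' x'(1) run(4) ent(2) unfolding walk_inv_def q_def[symmetric] by blast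
  qed
qed

text \<open>A walk can return to a visited product only through its starting end: every end of a
  visited product other than \<open>a\<close> and \<open>x\<close> has its mate among the settled
  ends, whereas the mate of \<open>e\<close> is \<open>x\<close>. So the cycle closes, and the last
  exceptional pair is oriented as well, since \<open>x\<close> has been left and \<open>a\<close>
  entered.\<close>

lemma walk_inv_end:
  assumes \<mu>: "total_pairing N \<mu>" and I: "walk_inv N \<mu> a e C X"
    and e: "e div 2 \<in> C"
  shows "oriented N \<mu> C X {} \<and> a div 2 \<in> C"
proof -
  have eN: "e \<in> {2..<N}" using I unfolding walk_inv_def by blast
  from I consider (start) "e = a" "oriented N \<mu> C X {}"
    | (run) x where "x \<in> {2..<N}" "\<mu> x = e" "x div 2 \<in> C" "a div 2 \<in> C" "x \<noteq> a"
        "\<not> entered X x" "entered X a" "oriented N \<mu> C X {a, x}"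
    unfolding walk_inv_def by blast
  then show ?thesis
  proof cases
    case start
    then show ?thesis using e by blast
  next
    case run
    have *: "\<mu> e = x" "e \<noteq> x" using \<mu> run unfolding total_pairing_def by blast+
    then have "e = a" using run(8) eN e unfolding oriented_def by blast
    then have a: "\<mu> a = x" "\<mu> x = a" using run * by auto
    have "\<mu> f div 2 \<in> C \<and> entered X f \<noteq> entered X (\<mu> f)"
      if "f \<in> {2..<N}" "f div 2 \<in> C" for f
    proof (cases "f \<in> {a, x}")
      case True
      then show ?thesis using a run(3,4,6,7) by auto
    next
      case False
      then show ?thesis using run(8) that unfolding oriented_def by blast
    qed
    then show ?thesis using run(4) unfolding oriented_def by simp
  qed
qed

abbreviation walk_step :: "com" where
  "walk_step \<equiv>
     (''q'' ::= IHalf (IVar ''e'');;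
        If (ILess (IAdd (IVar ''q'') (IVar ''q'')) (IVar ''e''))
         (SetInt ''cls'' (IVar ''q'') (IAdd (IAdd (ICell ''cls'' (IVar ''q'')) (ICell ''cls'' (IVar ''q''))) (IConst 1));;
          ''e'' ::= ICell ''mate'' (ISub (IVar ''e'') (IConst 1)))
         (SetInt ''cls'' (IVar ''q'') (IAdd (ICell ''cls'' (IVar ''q'')) (ICell ''cls'' (IVar ''q'')));;
          ''e'' ::= ICell ''mate'' (IAdd (IVar ''e'') (IConst 1))))"

text \<open>\<open>R\<close> has already been doubled at this point, and traversing a product
  doubles its class number. Hence \<open>cls < R\<close> recognizes the products not traversed yet,
  and the class number itself serves as the mark. The appended bit records the direction.\<close>

definition walk :: com where
  "walk = range_loop ''p'' (IConst 1) (IAdd (IVar ''products'') (IConst 1))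
     (''e'' ::= IAdd (IVar ''p'') (IVar ''p'');;
      While (ILess (ICell ''cls'' (IHalf (IVar ''e''))) (IVar ''R''))
       walk_step)"

lemma mods_walk: "mods walk = {''p'', ''e'', ''q'', ''cls''}"
  by (auto simp: walk_def)

lemma runs_walk:
  fixes s :: state
  assumes m: "ints s ''products'' 0 = m" "0 \<le> m"
    and \<mu>: "total_pairing (2 * m + 2) (ints s ''mate'')"
    and cls: "\<forall>p\<in>{1..m}. ints s ''cls'' p < ints s ''R'' 0 \<and> ints s ''R'' 0 \<le> 2 * ints s ''cls'' p"
    and R: "0 < ints s ''R'' 0"
  shows "runs walk (11 * nat m + 2) (\<lambda>s'. \<exists>X.
      (\<forall>p\<in>{1..m}. ints s' ''cls'' p = 2 * ints s ''cls'' p + (if p \<in> X then 0 else 1)) \<and>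
      (\<forall>e\<in>{2..<2 * m + 2}. entered X e \<noteq> entered X (ints s ''mate'' e))) s"
proof -
  let ?N = "2 * m + 2" and ?\<mu> = "ints s ''mate''"
  define coloured where "coloured C X s' \<longleftrightarrow> C \<subseteq> {1..m} \<and> (\<forall>p\<in>{1..m}. ints s' ''cls'' p =
     (if p \<in> C then 2 * ints s ''cls'' p + (if p \<in> X then 0 else 1) else ints s ''cls'' p))"
    for C X and s' :: state
  \<comment> \<open>The potential reserves 5 steps for every product not traversed yet: the loop
    test, the computation of \<open>q\<close>, the branch and two assignments.\<close>
  define Inv where "Inv i v s' \<longleftrightarrow> (\<exists>C X. coloured C X s' \<and> oriented ?N ?\<mu> C X {} \<and>
     {1..<i} \<subseteq> C \<and> v = 5 * card ({1..m} - C))" for i v and s' :: state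
  have "runs walk ((4 + 2) * nat (m + 1 - 1) + 5 * nat m + 2) (\<lambda>s'. \<exists>w. Inv (m + 1) w s') s"
    unfolding walk_def
  proof (rule runs_range_loop_amortized)
    show "Inv 1 (5 * nat m) (set_var ''p'' 1 s)"
      unfolding Inv_def by (rule exI[of _ "{}"]) (auto simp: coloured_def oriented_def)
  next
    fix i v s'
    let ?body = walk_step
    let ?test = "ILess (ICell ''cls'' (IHalf (IVar ''e''))) (IVar ''R'')"
    let ?Q = "\<lambda>s'' n. \<exists>w\<le>n. Inv (i + 1) w (set_var ''p'' (i + 1) s'')"
    assume i: "1 \<le> i" "i < m + 1" "ints s' ''p'' 0 = i" and I: "Inv i v s'"
      and fr: "frame (insert ''p'' (mods (''e'' ::= IAdd (IVar ''p'') (IVar ''p'');; While ?test ?body))) s s'"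
    from fr have fr: "frame {''p'', ''e'', ''q'', ''cls''} s s'"
      by (auto elim: frame_mono)
    define W where "W s'' n \<longleftrightarrow> (\<exists>C X. coloured C X s'' \<and> {1..<i} \<subseteq> C \<and>
      walk_inv ?N ?\<mu> (2 * i) (ints s'' ''e'' 0) C X \<and> 5 * card ({1..m} - C) + 1 \<le> n)"
      for n and s'' :: state
    from I obtain C0 X0 where I0: "coloured C0 X0 s'" "oriented ?N ?\<mu> C0 X0 {}" "{1..<i} \<subseteq> C0"
      "v = 5 * card ({1..m} - C0)"
      unfolding Inv_def by blast
    let ?s1 = "set_var ''e'' (2 * i) s'"
    have test: "bval ?test s'' \<longleftrightarrow> ints s'' ''e'' 0 div 2 \<notin> C"
      if "coloured C X s''" "ints s'' ''e'' 0 \<in> {2..<?N}" "frame {''p'', ''e'', ''q'', ''cls''} s s''"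
      for s'' :: state and C X
    proof -
      define q where "q = ints s'' ''e'' 0 div 2"
      have "q \<in> {1..m}" using that(2) unfolding q_def by auto
      then have "ints s'' ''cls'' q = (if q \<in> C then 2 * ints s ''cls'' q + (if q \<in> X then 0 else 1) else ints s ''cls'' q)"
        "ints s ''cls'' q < ints s ''R'' 0" "ints s ''R'' 0 \<le> 2 * ints s ''cls'' q"
        using that(1) cls unfolding coloured_def by blast+
      moreover have "ints s'' ''R'' = ints s ''R''" using frame_ints[OF that(3), of "''R''"] by simp
      ultimately show ?thesis
        unfolding q_def by (simp split: if_splits)
    qed
    have fr2: "frame {''p'', ''e'', ''q'', ''cls''} s s''" if "frame (mods ?body) ?s1 s''" for s''
      using that fr unfolding frame_def by auto
    have "wp (While ?test ?body) ?Q ?s1 (3 + v)"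
    proof (rule wp_While[where I = W])
      show "W ?s1 (3 + v)"
        unfolding W_def using I0 i
        by (intro exI[of _ C0] exI[of _ X0]) (auto simp: coloured_def walk_inv_def)
    next
      fix s'' n
      assume W: "W s'' n" and "frame (mods ?body) ?s1 s''" and b: "bval ?test s''"
      then have fr': "frame {''p'', ''e'', ''q'', ''cls''} s s''" using fr2 by blast
      define e where "e = ints s'' ''e'' 0"
      from W obtain C X where W': "coloured C X s''" "{1..<i} \<subseteq> C"
        "walk_inv ?N ?\<mu> (2 * i) e C X" "5 * card ({1..m} - C) + 1 \<le> n"
        unfolding W_def e_def by blast
      have eN: "e \<in> {2..<?N}" using W' unfolding walk_inv_def by blast
      then have qm: "e div 2 \<in> {1..m}" by auto
      have qC: "e div 2 \<notin> C" using b test W'(1) eN fr' unfolding e_def by blast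
      have mate: "ints s'' ''mate'' = ?\<mu>" using fr' by (auto simp: frame_def)
      define C' X' x' where "C' = insert (e div 2) C"
        and "X' = (if even e then insert (e div 2) X else X - {e div 2})"
        and "x' = (if even e then e + 1 else e - 1)"
      have x': "x' \<in> {2..<?N}" "x' div 2 = e div 2" "x' \<noteq> e"
        using eN unfolding x'_def by auto presburger+
      have wi: "walk_inv ?N ?\<mu> (2 * i) (?\<mu> x') C' X'"
        unfolding C'_def by (rule walk_inv_step[OF \<mu> W'(3) qC x' X'_def])
      have "{1..m} - C' = ({1..m} - C) - {e div 2}" unfolding C'_def by blast
      moreover have "e div 2 \<in> {1..m} - C" using qC qm by blast
      ultimately have card: "card ({1..m} - C) = Suc (card ({1..m} - C'))"
        by (metis card_Suc_Diff1 finite_Diff finite_atLeastAtMost_int)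
      have n: "5 * card ({1..m} - C') + 6 \<le> n" using W'(4) card by simp
      define k where "k = 2 * ints s'' ''cls'' (e div 2) + (if even e then 0 else 1)"
      have col: "coloured C' X' s3" if "ints s3 ''cls'' = (ints s'' ''cls'')(e div 2 := k)" for s3
        using W'(1) that qC qm unfolding coloured_def C'_def X'_def k_def by auto
      have W3: "W s3 n'" if "ints s3 ''cls'' = (ints s'' ''cls'')(e div 2 := k)"
        "ints s3 ''e'' 0 = ?\<mu> x'" "5 * card ({1..m} - C') + 1 \<le> n'" for s3 n'
        unfolding W_def using that col[OF that(1)] W'(2) wi unfolding C'_def by auto
      show "1 \<le> n \<and> wp ?body W s'' (n - 1)"
      proof (cases "even e")
        case True
        then have "\<not> e div 2 + e div 2 < e" by presburger
        with True n show ?thesis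
          unfolding wp_simps by (auto simp: e_def[symmetric] k_def x'_def mate intro!: W3)
      next
        case False
        then have "e div 2 + e div 2 < e" by presburger
        with False n show ?thesis
          unfolding wp_simps by (auto simp: e_def[symmetric] k_def x'_def mate intro!: W3)
      qed
    next
      fix s'' n
      assume W: "W s'' n" and "frame (mods ?body) ?s1 s''" and b: "\<not> bval ?test s''"
      then have fr': "frame {''p'', ''e'', ''q'', ''cls''} s s''" using fr2 by blast
      from W obtain C X where W': "coloured C X s''" "{1..<i} \<subseteq> C"
        "walk_inv ?N ?\<mu> (2 * i) (ints s'' ''e'' 0) C X" "5 * card ({1..m} - C) + 1 \<le> n"
        unfolding W_def by blast
      have "ints s'' ''e'' 0 \<in> {2..<?N}" using W' unfolding walk_inv_def by blast
      with b test W'(1) fr' have "ints s'' ''e'' 0 div 2 \<in> C" by blast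
      from walk_inv_end[OF \<mu> W'(3) this] have "oriented ?N ?\<mu> C X {}" "i \<in> C" by auto
      moreover have "{1..<i + 1} = insert i {1..<i}" using i(1) by auto
      moreover have "coloured C X (set_var ''p'' (i + 1) s'')"
        using W'(1) unfolding coloured_def by simp
      ultimately show "1 \<le> n \<and> ?Q s'' (n - 1)"
        using W'(2,4) unfolding Inv_def
        by (intro conjI exI[of _ "5 * card ({1..m} - C)"] exI[of _ C] exI[of _ X]) auto
    qed
    then show "wp (''e'' ::= IAdd (IVar ''p'') (IVar ''p'');; While ?test ?body) ?Q s' (4 + v)"
      unfolding wp_simps using i(3) by simp
  qed (use m in \<open>auto simp: frame_def\<close>)
  then show ?thesis
  proof (rule runs_mono)
    fix s' assume "\<exists>w. Inv (m + 1) w s'"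
    then obtain C X where CX: "coloured C X s'" "oriented ?N ?\<mu> C X {}" "{1..<m + 1} \<subseteq> C"
      unfolding Inv_def by blast
    have C: "C = {1..m}" using CX(1,3) unfolding coloured_def by auto
    show "\<exists>X. (\<forall>p\<in>{1..m}. ints s' ''cls'' p = 2 * ints s ''cls'' p + (if p \<in> X then 0 else 1)) \<and>
      (\<forall>e\<in>{2..<2 * m + 2}. entered X e \<noteq> entered X (ints s ''mate'' e))"
    proof (intro exI[of _ X] conjI ballI)
      fix p assume "p \<in> {1..m}"
      then show "ints s' ''cls'' p = 2 * ints s ''cls'' p + (if p \<in> X then 0 else 1)"
        using CX(1) C unfolding coloured_def by auto
    next
      fix e assume "e \<in> {2..<2 * m + 2}"
      moreover from this have "e div 2 \<in> {1..m}" by auto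
      ultimately show "entered X e \<noteq> entered X (ints s ''mate'' e)"
        using CX(2) C unfolding oriented_def by blast
    qed
  qed (use m in simp)
qed

section \<open>Balance of the two halves\<close>

lemma even_card_involution:
  fixes \<mu> :: "'a::linorder \<Rightarrow> 'a"
  assumes "finite F" "\<And>e. e \<in> F \<Longrightarrow> \<mu> e \<in> F \<and> \<mu> e \<noteq> e \<and> \<mu> (\<mu> e) = e"
  shows "even (card F)"
proof -
  let ?A = "{e \<in> F. e < \<mu> e}" and ?B = "{e \<in> F. \<mu> e < e}"
  have "bij_betw \<mu> ?A ?B"
    by (rule bij_betw_byWitness[where f' = \<mu>]) (use assms(2) in auto)
  then have "card ?A = card ?B" by (rule bij_betw_same_card)
  moreover have "F = ?A \<union> ?B" using assms(2) by force
  moreover have "card (?A \<union> ?B) = card ?A + card ?B"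
    by (rule card_Un_disjoint) (use assms(1) in auto)
  ultimately show ?thesis by simp
qed

lemma sum_involution_zero:
  fixes \<sigma> :: "'a \<Rightarrow> int"
  assumes "\<And>e. e \<in> F \<Longrightarrow> \<mu> e \<in> F \<and> \<mu> (\<mu> e) = e \<and> \<sigma> (\<mu> e) = - \<sigma> e"
  shows "sum \<sigma> F = 0"
proof -
  have "bij_betw \<mu> F F"
    by (rule bij_betw_byWitness[where f' = \<mu>]) (use assms in auto)
  then have "sum \<sigma> F = (\<Sum>e\<in>F. \<sigma> (\<mu> e))" by (metis sum.reindex_bij_betw)
  also have "\<dots> = - sum \<sigma> F" using assms by (simp add: sum_negf)
  finally show ?thesis by simp
qed

text \<open>\<open>L\<close> contains the ends left over by the first pass.\<close>

definition balanced_pairing where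
  "balanced_pairing N \<kappa>1 \<kappa>2 \<mu> L \<longleftrightarrow> total_pairing N \<mu> \<and> L \<subseteq> {2..<N} \<and>
     (\<forall>e\<in>{2..<N} - L. \<kappa>1 (\<mu> e) = \<kappa>1 e \<and> \<mu> e \<notin> L) \<and>
     (\<forall>e\<in>L. \<forall>f\<in>L. \<kappa>1 e = \<kappa>1 f \<longrightarrow> e = f) \<and>
     (\<forall>e\<in>L. \<forall>f\<in>L. \<kappa>2 e = \<kappa>2 f \<longrightarrow> e \<noteq> f \<longrightarrow> \<mu> e = f)"

text \<open>The third pass has a single key, so it leaves at most one end alone, and parity rules
  this out. After the first pass at most one source end and one sink end are alone for each
  warehouse and class. If both exist, they are the only candidates for their second key, so the
  second pass pairs them with each other.\<close>

lemma balanced_pairing_passes: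
  assumes 0: "\<And>e. e \<in> {2..<N} \<Longrightarrow> \<mu>0 e = 0"
    and 1: "pass_post N \<kappa>1 \<mu>0 pend1 \<mu>1 pend1'"
    and 2: "pass_post N \<kappa>2 \<mu>1 pend2 \<mu>2 pend2'"
    and 3: "pass_post N (\<lambda>_. c) \<mu>2 pend3 \<mu>3 pend3'"
    and N: "even N" "2 \<le> N"
    and \<kappa>: "\<And>e f. e \<in> {2..<N} \<Longrightarrow> f \<in> {2..<N} \<Longrightarrow>
      (\<kappa>1 e = \<kappa>1 f) = (\<kappa>2 e = \<kappa>2 f \<and> (even e \<longleftrightarrow> even f))"
  shows "balanced_pairing N \<kappa>1 \<kappa>2 \<mu>3 {e \<in> {2..<N}. \<mu>1 e = 0}"
proof -
  let ?E = "{2..<N}"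
  define L where "L = {e \<in> {2..<N}. \<mu>1 e = 0}"
  have L: "e \<in> L \<longleftrightarrow> e \<in> ?E \<and> \<mu>1 e = 0" for e unfolding L_def by blast
  note D = pass_post_def extends_pairing_def
  have p1: "pairing N \<mu>1" and p2: "pairing N \<mu>2" and p3: "pairing N \<mu>3"
    using 1 2 3 unfolding D by blast+
  have e2: "\<mu>2 e = \<mu>1 e" if "e \<in> ?E" "\<mu>1 e \<noteq> 0" for e using 2 that unfolding D by blast
  have e3: "\<mu>3 e = \<mu>2 e" if "e \<in> ?E" "\<mu>2 e \<noteq> 0" for e using 3 that unfolding D by blast
  have n2: "\<kappa>2 (\<mu>2 e) = \<kappa>2 e \<and> \<mu>2 e \<in> L \<and> \<mu>2 e \<noteq> e" if "e \<in> L" "\<mu>2 e \<noteq> 0" for e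
    using 2 that p2 L unfolding D pairing_def by metis
  \<comment> \<open>A single end left alone would leave an involution without fixed points on an odd
    number of ends.\<close>
  have all: "\<mu>3 e \<noteq> 0" if "e \<in> ?E" for e
  proof
    assume "\<mu>3 e = 0"
    with that 3 have U: "f = e" if "f \<in> ?E" "\<mu>3 f = 0" for f
      using that unfolding D by blast
    have ne: "\<mu>3 f \<noteq> e" if "f \<in> ?E" for f
    proof
      assume "\<mu>3 f = e"
      moreover have "e \<noteq> 0" "f \<noteq> 0" using \<open>e \<in> ?E\<close> that by auto
      ultimately show False
        using p3 that \<open>\<mu>3 e = 0\<close> unfolding pairing_def by metis
    qed
    have "even (card (?E - {e}))"
    proof (rule even_card_involution[where \<mu> = \<mu>3])
      fix f assume f: "f \<in> ?E - {e}"
      then have "\<mu>3 f \<noteq> 0" using U by blast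
      then show "\<mu>3 f \<in> ?E - {e} \<and> \<mu>3 f \<noteq> f \<and> \<mu>3 (\<mu>3 f) = f"
        using f ne[of f] p3 unfolding pairing_def by blast
    qed simp
    moreover have "card (?E - {e}) = nat (N - 3)"
      using that by (simp add: card_Diff_singleton)
    ultimately have "even (nat (N - 3))" by simp
    then show False using N that by (auto simp: even_nat_iff)
  qed
  have "total_pairing N \<mu>3"
    using all p3 unfolding total_pairing_def pairing_def by blast
  moreover have "\<kappa>1 (\<mu>3 e) = \<kappa>1 e \<and> \<mu>3 e \<notin> L" if "e \<in> ?E - L" for e
  proof -
    have n0: "\<mu>1 e \<noteq> 0" "e \<in> ?E" "e \<noteq> 0" using that L by auto
    then have "\<mu>3 e = \<mu>1 e" using e2 e3 by metis
    moreover have "\<kappa>1 (\<mu>1 e) = \<kappa>1 e" using 1 n0 0[OF n0(2)] unfolding D by blast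
    moreover have "\<mu>1 (\<mu>1 e) = e" using p1 n0 unfolding pairing_def by blast
    ultimately show ?thesis using n0 L by auto
  qed
  moreover have L1: "e = f" if "e \<in> L" "f \<in> L" "\<kappa>1 e = \<kappa>1 f" for e f
    using 1 that L unfolding D by blast
  moreover have "\<mu>3 e = f" if ef: "e \<in> L" "f \<in> L" "\<kappa>2 e = \<kappa>2 f" "e \<noteq> f" for e f
  proof -
    \<comment> \<open>The first pass leaves at most one end per parity for a second key, so
      \<open>e\<close> and \<open>f\<close> are the only ones.\<close>
    have two: "g = e \<or> g = f" if "g \<in> L" "\<kappa>2 g = \<kappa>2 e" for g
    proof -
      have E: "e \<in> ?E" "f \<in> ?E" "g \<in> ?E" using ef that L by blast+
      have "\<kappa>1 e \<noteq> \<kappa>1 f" using L1 ef by metis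
      then have "even g = even e \<or> even g = even f" using \<kappa>[OF E(1,2)] ef(3) by metis
      then have "\<kappa>1 g = \<kappa>1 e \<or> \<kappa>1 g = \<kappa>1 f"
        using \<kappa>[OF E(3,1)] \<kappa>[OF E(3,2)] ef(3) that(2) by metis
      then show ?thesis using L1 ef(1,2) that(1) by metis
    qed
    have "\<mu>2 e \<noteq> 0"
    proof
      assume e0: "\<mu>2 e = 0"
      then have f0: "\<mu>2 f \<noteq> 0" using 2 ef L unfolding D by metis
      from n2[OF ef(2) this] two ef have "\<mu>2 f = e" by metis
      moreover have "\<mu>2 (\<mu>2 f) = f" using p2 ef(2) L f0 unfolding pairing_def by blast
      moreover have "f \<noteq> 0" using ef(2) L by auto
      ultimately show False using e0 by auto
    qed
    then have "\<mu>2 e = f" using n2[OF ef(1)] two by metis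
    then show ?thesis using e3 \<open>\<mu>2 e \<noteq> 0\<close> ef(1) L by metis
  qed
  ultimately show ?thesis
    unfolding balanced_pairing_def L_def[symmetric] using L by blast
qed

text \<open>\<open>\<sigma>\<close> is \<open>1\<close> or \<open>-1\<close> according to the direction of the walk. As it cancels on paired ends, only the
  leftover end of a group contributes to the difference of its halves; the leftover ends of the two
  groups of a warehouse are paired with each other.\<close>

lemma balanced_halves:
  fixes A B X :: "int set"
  assumes bp: "balanced_pairing N \<kappa>1 \<kappa>2 \<mu> L"
    and X: "\<forall>e\<in>{2..<N}. entered X e \<noteq> entered X (\<mu> e)"
    and fin: "finite A" "finite B"
    and A: "(\<lambda>p. 2 * p) ` A = {e \<in> {2..<N}. \<kappa>1 e = ka}"
    and B: "(\<lambda>p. 2 * p + 1) ` B = {e \<in> {2..<N}. \<kappa>1 e = kb}"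
    and ka: "\<And>e. e \<in> {2..<N} \<Longrightarrow> \<kappa>1 e = ka \<Longrightarrow> \<kappa>2 e = k"
    and kb: "\<And>e. e \<in> {2..<N} \<Longrightarrow> \<kappa>1 e = kb \<Longrightarrow> \<kappa>2 e = k"
  defines "d \<equiv> \<lambda>S. int (card (S \<inter> X)) - int (card (S - X))"
  shows "(d A, d B) \<in> {(0, 0), (0, 1), (0, -1), (1, 0), (-1, 0), (1, 1), (-1, -1)}"
proof -
  let ?E = "{2..<N}"
  define \<sigma> :: "int \<Rightarrow> int" where "\<sigma> e = (if entered X e then 1 else -1)" for e
  have LE: "L \<subseteq> ?E" using bp unfolding balanced_pairing_def by blast
  have nL: "\<kappa>1 (\<mu> e) = \<kappa>1 e \<and> \<mu> e \<notin> L \<and> \<mu> e \<in> ?E \<and> \<mu> (\<mu> e) = e" if "e \<in> ?E" "e \<notin> L" for e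
    using bp that unfolding balanced_pairing_def total_pairing_def by blast
  have L1: "e = f" if "e \<in> L" "f \<in> L" "\<kappa>1 e = \<kappa>1 f" for e f
    using bp that unfolding balanced_pairing_def by blast
  have L2: "\<mu> e = f" if "e \<in> L" "f \<in> L" "\<kappa>2 e = \<kappa>2 f" "e \<noteq> f" for e f
    using bp that unfolding balanced_pairing_def by blast
  have group: "(\<Sum>e | e \<in> ?E \<and> \<kappa>1 e = c. \<sigma> e) = (\<Sum>e | e \<in> L \<and> \<kappa>1 e = c. \<sigma> e)" for c
  proof -
    have U: "{e. e \<in> ?E \<and> \<kappa>1 e = c} = {e \<in> ?E - L. \<kappa>1 e = c} \<union> {e. e \<in> L \<and> \<kappa>1 e = c}"
      using LE by blast
    have Z: "sum \<sigma> {e \<in> ?E - L. \<kappa>1 e = c} = 0"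
    proof (rule sum_involution_zero[where \<mu> = \<mu>])
      fix e assume "e \<in> {e \<in> ?E - L. \<kappa>1 e = c}"
      then have e: "e \<in> ?E" "e \<notin> L" "\<kappa>1 e = c" by auto
      have "\<mu> e \<in> {e \<in> ?E - L. \<kappa>1 e = c}" using nL[OF e(1,2)] e(3) by blast
      moreover have "\<sigma> (\<mu> e) = - \<sigma> e" using bspec[OF X e(1)] by (simp add: \<sigma>_def)
      ultimately show "\<mu> e \<in> {e \<in> ?E - L. \<kappa>1 e = c} \<and> \<mu> (\<mu> e) = e \<and> \<sigma> (\<mu> e) = - \<sigma> e"
        using nL[OF e(1,2)] by blast
    qed
    have F: "finite {e. e \<in> L \<and> \<kappa>1 e = c}"
      by (rule finite_subset[of _ ?E]) (use LE in auto)
    have "finite {e \<in> ?E - L. \<kappa>1 e = c}" by (rule finite_subset[of _ ?E]) auto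
    then show ?thesis
      unfolding U by (subst sum.union_disjoint) (use F Z in auto)
  qed
  have split: "(\<Sum>p\<in>S. if p \<in> X then 1 else -1) = d S" if "finite S" for S
    using that unfolding d_def by (simp add: sum.If_cases Diff_eq Collect_mem_eq)
  have "(\<Sum>e | e \<in> ?E \<and> \<kappa>1 e = ka. \<sigma> e) = (\<Sum>p\<in>A. \<sigma> (2 * p))"
    unfolding A[symmetric] by (rule sum.reindex_cong[where l = "\<lambda>p. 2 * p"]) (auto simp: inj_on_def)
  then have dA: "d A = (\<Sum>e | e \<in> L \<and> \<kappa>1 e = ka. \<sigma> e)"
    using split[OF fin(1)] group[of ka] by (simp add: \<sigma>_def entered_def)
  have "(\<Sum>e | e \<in> ?E \<and> \<kappa>1 e = kb. \<sigma> e) = (\<Sum>p\<in>B. \<sigma> (2 * p + 1))"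
    unfolding B[symmetric] by (rule sum.reindex_cong[where l = "\<lambda>p. 2 * p + 1"]) (auto simp: inj_on_def)
  \<comment> \<open>A sink end is entered iff its product is traversed backwards, hence the change
    of sign.\<close>
  also have "\<dots> = - (\<Sum>p\<in>B. if p \<in> X then 1 else -1)"
    unfolding sum_negf[symmetric] by (rule sum.cong) (auto simp: \<sigma>_def entered_def)
  finally have dB: "d B = - (\<Sum>e | e \<in> L \<and> \<kappa>1 e = kb. \<sigma> e)"
    using split[OF fin(2)] group[of kb] by simp
  have single: "{e. e \<in> L \<and> \<kappa>1 e = c} = {} \<or> (\<exists>e\<in>L. \<kappa>1 e = c \<and> {e. e \<in> L \<and> \<kappa>1 e = c} = {e})" for c
    using L1 by blast
  have dis: "e \<noteq> f" if "e \<in> L" "\<kappa>1 e = ka" "f \<in> L" "\<kappa>1 f = kb" for e f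
  proof
    assume "e = f"
    then have "e \<in> (\<lambda>p. 2 * p) ` A" "e \<in> (\<lambda>p. 2 * p + 1) ` B"
      using that LE unfolding A B by blast+
    then obtain a b where "e = 2 * a" "e = 2 * b + 1" by blast
    then show False by presburger
  qed
  show ?thesis
    using single[of ka]
  proof
    assume "{e. e \<in> L \<and> \<kappa>1 e = ka} = {}"
    then have "d A = 0" using dA by (metis sum.empty)
    moreover have "d B \<in> {0, 1, -1}"
      using single[of kb]
    proof
      assume "{e. e \<in> L \<and> \<kappa>1 e = kb} = {}"
      then show ?thesis using dB by (metis sum.empty neg_0_equal_iff_equal insertI1)
    next
      assume "\<exists>f\<in>L. \<kappa>1 f = kb \<and> {e. e \<in> L \<and> \<kappa>1 e = kb} = {f}"
      then obtain f where "{e. e \<in> L \<and> \<kappa>1 e = kb} = {f}" by blast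
      then have "d B = - \<sigma> f" using dB by simp
      then show ?thesis by (simp add: \<sigma>_def)
    qed
    ultimately show ?thesis by auto
  next
    assume "\<exists>e\<in>L. \<kappa>1 e = ka \<and> {e. e \<in> L \<and> \<kappa>1 e = ka} = {e}"
    then obtain e where e: "e \<in> L" "\<kappa>1 e = ka" "{e. e \<in> L \<and> \<kappa>1 e = ka} = {e}" by blast
    then have dA': "d A = \<sigma> e" using dA by simp
    show ?thesis
      using single[of kb]
    proof
      assume "{e. e \<in> L \<and> \<kappa>1 e = kb} = {}"
      then have "d B = 0" using dB by (metis sum.empty neg_0_equal_iff_equal)
      then show ?thesis using dA' by (auto simp: \<sigma>_def)
    next
      assume "\<exists>f\<in>L. \<kappa>1 f = kb \<and> {e. e \<in> L \<and> \<kappa>1 e = kb} = {f}"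
      then obtain f where f: "f \<in> L" "\<kappa>1 f = kb" "{e. e \<in> L \<and> \<kappa>1 e = kb} = {f}" by blast
      then have "d B = - \<sigma> f" using dB by simp
      moreover have EL: "e \<in> ?E" "f \<in> ?E" using e(1) f(1) LE by blast+
      then have "\<kappa>2 e = \<kappa>2 f" using ka kb e f by metis
      \<comment> \<open>Both groups have odd size here. Their leftover ends are mates and have
        opposite signs; together with the change of sign for sinks, both groups are rounded in the
        same direction, which excludes \<open>(1, -1)\<close> and \<open>(-1, 1)\<close>.\<close>
      then have "\<mu> e = f" using dis e(1,2) f(1,2) L2 by metis
      then have "\<sigma> f = - \<sigma> e" using X EL unfolding \<sigma>_def by auto
      ultimately show ?thesis using dA' by (auto simp: \<sigma>_def)
    qed
  qed
qed

section \<open>Classes under repeated halving\<close>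

definition class_of :: "int \<Rightarrow> (int \<Rightarrow> int) \<Rightarrow> (int \<Rightarrow> int) \<Rightarrow> int \<Rightarrow> int \<Rightarrow> int set" where
  "class_of m v cls w c = {p \<in> {1..m}. v p = w \<and> cls p = c}"

definition members :: "int \<Rightarrow> (int \<Rightarrow> int) \<Rightarrow> int \<Rightarrow> int set" where
  "members m v w = {p \<in> {1..m}. v p = w}"

lemma finite_class_of [simp]: "finite (class_of m v cls w c)"
  by (rule finite_subset[of _ "{1..m}"]) (auto simp: class_of_def)

lemma finite_members [simp]: "finite (members m v w)"
  by (rule finite_subset[of _ "{1..m}"]) (auto simp: members_def)

text \<open>The classes are numbered from \<open>R\<close> to \<open>2 * R - 1\<close>, so that the classes of different levels have
  different numbers.\<close>

definition good_classes :: "int \<Rightarrow> (int \<Rightarrow> int) \<Rightarrow> (int \<Rightarrow> int) \<Rightarrow> int \<Rightarrow> (int \<Rightarrow> int) \<Rightarrow> bool" where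
  "good_classes m u v R cls \<longleftrightarrow> (\<forall>p\<in>{1..m}. R \<le> cls p \<and> cls p < 2 * R) \<and>
     (\<forall>w c. (card (members m v w) \<le> card (members m u w) \<longrightarrow>
              card (class_of m v cls w c) \<le> card (class_of m u cls w c)) \<and>
            (card (members m u w) \<le> card (members m v w) \<longrightarrow>
              card (class_of m u cls w c) \<le> card (class_of m v cls w c)) \<and>
            (\<forall>x. int (card (members m u w)) \<le> x * R \<longrightarrow> int (card (class_of m u cls w c)) \<le> x))"

lemma good_classes_start: "good_classes m u v 1 (\<lambda>_. 1)"
proof -
  have "class_of m x (\<lambda>_. 1) w c = (if c = 1 then members m x w else {})" for x w c
    by (auto simp: class_of_def members_def)
  then show ?thesis by (auto simp: good_classes_def)
qed

lemma good_classes_cong: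
  assumes "good_classes m u v R cls" "\<And>p. p \<in> {1..m} \<Longrightarrow> cls' p = cls p"
  shows "good_classes m u v R cls'"
proof -
  have "class_of m x cls' w c = class_of m x cls w c" for x w c
    using assms(2) by (auto simp: class_of_def)
  then show ?thesis using assms by (simp add: good_classes_def)
qed

text \<open>Class \<open>c\<close> is split into \<open>2 * c\<close> and \<open>2 * c + 1\<close>.
  A comparison \<open>b \<le> a\<close> of two sizes passes to the halves: for \<open>b < a\<close>
  even the larger part of \<open>b\<close> is at most the smaller part of \<open>a\<close>, and for
  \<open>b = a\<close> the common direction of rounding is decisive.\<close>

lemma good_classes_split:
  assumes good: "good_classes m u v R cls"
    and cls': "\<forall>p\<in>{1..m}. cls' p = 2 * cls p + (if p \<in> X then 0 else 1)"
    and halves: "\<And>w c. R \<le> c \<Longrightarrow> c < 2 * R \<Longrightarrow>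
      (int (card (class_of m u cls w c \<inter> X)) - int (card (class_of m u cls w c - X)),
       int (card (class_of m v cls w c \<inter> X)) - int (card (class_of m v cls w c - X)))
      \<in> {(0, 0), (0, 1), (0, -1), (1, 0), (-1, 0), (1, 1), (-1, -1)}"
  shows "good_classes m u v (2 * R) cls'"
  unfolding good_classes_def
proof (intro conjI ballI allI)
  fix p assume p: "p \<in> {1..m}"
  have "R \<le> cls p" "cls p < 2 * R" using good p unfolding good_classes_def by blast+
  moreover have "cls' p = 2 * cls p + (if p \<in> X then 0 else 1)" using cls' p by blast
  ultimately show "2 * R \<le> cls' p" "cls' p < 2 * (2 * R)" by auto
next
  fix w c :: int
  define c0 where "c0 = c div 2"
  let ?u = "class_of m u cls w c0" and ?v = "class_of m v cls w c0"
  have half: "class_of m x cls' w c = (if even c then class_of m x cls w c0 \<inter> X else class_of m x cls w c0 - X)" for x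
  proof -
    have *: "cls' p = c \<longleftrightarrow> cls p = c0 \<and> (p \<in> X \<longleftrightarrow> even c)" if "p \<in> {1..m}" for p
    proof -
      have "cls' p = 2 * cls p + (if p \<in> X then 0 else 1)" using cls' that by blast
      then show ?thesis unfolding c0_def by (cases "p \<in> X") presburger+
    qed
    show ?thesis
    proof (rule set_eqI)
      fix p
      show "p \<in> class_of m x cls' w c \<longleftrightarrow>
        p \<in> (if even c then class_of m x cls w c0 \<inter> X else class_of m x cls w c0 - X)"
        using *[of p] by (cases "p \<in> {1..m}"; cases "even c"; simp add: class_of_def; blast)
    qed
  qed
  have card: "card S = card (S \<inter> X) + card (S - X)" if "finite S" for S :: "int set"
  proof -
    have "card ((S \<inter> X) \<union> (S - X)) = card (S \<inter> X) + card (S - X)"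
      by (rule card_Un_disjoint) (use that in auto)
    then show ?thesis by (simp add: Int_Diff_Un)
  qed
  have cu: "card ?u = card (?u \<inter> X) + card (?u - X)" and cv: "card ?v = card (?v \<inter> X) + card (?v - X)"
    by (rule card; simp)+
  have H: "(int (card (?u \<inter> X)) - int (card (?u - X)), int (card (?v \<inter> X)) - int (card (?v - X)))
      \<in> {(0, 0), (0, 1), (0, -1), (1, 0), (-1, 0), (1, 1), (-1, -1)}"
  proof (cases "R \<le> c0 \<and> c0 < 2 * R")
    case True
    then show ?thesis using halves[of c0 w] by (simp only:)
  next
    case False
    have "class_of m x cls w c0 = {}" for x
    proof (rule ccontr)
      assume "class_of m x cls w c0 \<noteq> {}"
      then obtain p where "p \<in> {1..m}" "cls p = c0" unfolding class_of_def by blast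
      with good False show False unfolding good_classes_def by blast
    qed
    then show ?thesis by simp
  qed
  have G: "card (members m v w) \<le> card (members m u w) \<longrightarrow> card ?v \<le> card ?u"
    "card (members m u w) \<le> card (members m v w) \<longrightarrow> card ?u \<le> card ?v"
    "\<forall>x. int (card (members m u w)) \<le> x * R \<longrightarrow> int (card ?u) \<le> x"
    using good unfolding good_classes_def by blast+
  define a1 a2 b1 b2 where ab: "a1 = card (?u \<inter> X)" "a2 = card (?u - X)" "b1 = card (?v \<inter> X)"
    "b2 = card (?v - X)"
  note G = G[unfolded cu cv, folded ab] and H = H[folded ab]
  have u: "card (class_of m u cls' w c) = (if even c then a1 else a2)"
    and v: "card (class_of m v cls' w c) = (if even c then b1 else b2)"
    unfolding half ab by auto
  show "card (members m v w) \<le> card (members m u w) \<longrightarrow>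
      card (class_of m v cls' w c) \<le> card (class_of m u cls' w c)"
    unfolding u v using G(1) H by auto
  show "card (members m u w) \<le> card (members m v w) \<longrightarrow>
      card (class_of m u cls' w c) \<le> card (class_of m v cls' w c)"
    unfolding u v using G(2) H by auto
  fix x
  show "int (card (members m u w)) \<le> x * (2 * R) \<longrightarrow> int (card (class_of m u cls' w c)) \<le> x"
  proof
    assume "int (card (members m u w)) \<le> x * (2 * R)"
    \<comment> \<open>The bound for the parent class is used with \<open>2 * x\<close>; as its
      halves differ by at most one, neither exceeds \<open>x\<close>. Quantifying over
      \<open>x\<close> avoids rounded quotients.\<close>
    then have "int (card (members m u w)) \<le> (2 * x) * R" by (simp add: mult.assoc mult.left_commute)
    then have "int (a1 + a2) \<le> 2 * x" using G(3) by blast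
    then show "int (card (class_of m u cls' w c)) \<le> x" unfolding u using H by auto
  qed
qed

section \<open>Keys as addresses, and the cost of one level\<close>

lemma stride_unique:
  fixes st :: int
  assumes "st * w + x = st * w' + x'" "0 \<le> x" "x < st" "0 \<le> x'" "x' < st"
  shows "w = w' \<and> x = x'"
proof -
  have "st \<noteq> 0" using assms by linarith
  then have "(st * w + x) div st = w" "(st * w' + x') div st = w'"
    using assms(2-5) by simp_all
  then show ?thesis using assms(1) by simp
qed

definition layout :: "int \<Rightarrow> int \<Rightarrow> (int \<Rightarrow> int) \<Rightarrow> (int \<Rightarrow> int) \<Rightarrow> state \<Rightarrow> bool" where
  "layout m st u v s \<longleftrightarrow> 0 \<le> m \<and> ints s ''products'' 0 = m \<and> ints s ''end'' 0 = 2 * m + 2 \<and>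
     (\<forall>p\<in>{1..m}. ints s ''at'' (2 * p) = st * u p \<and> ints s ''at'' (2 * p + 1) = st * v p)"

text \<open>Level \<open>R\<close> uses, in the block of each warehouse, the offsets from
  \<open>2 * R\<close> to \<open>4 * R - 1\<close> of \<open>p1\<close> and from \<open>R\<close> to
  \<open>2 * R - 1\<close> of \<open>p2\<close>, and moreover the cell \<open>R\<close> of
  \<open>p3\<close>. Leftover ends remain there as garbage, but the ranges of the next level begin
  above it.\<close>

definition fresh :: "int \<Rightarrow> int \<Rightarrow> state \<Rightarrow> bool" where
  "fresh st R s \<longleftrightarrow> (\<forall>w x. 2 * R \<le> x \<longrightarrow> x < st \<longrightarrow> ints s ''p1'' (st * w + x) = 0) \<and>
     (\<forall>w x. R \<le> x \<longrightarrow> x < st \<longrightarrow> ints s ''p2'' (st * w + x) = 0) \<and>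
     (\<forall>x\<ge>R. ints s ''p3'' x = 0)"

abbreviation class_key :: "iexp" where
  "class_key \<equiv>
     (IAdd (ICell ''at'' (IVar ''e'')) (ICell ''cls'' (IHalf (IVar ''e''))))"

abbreviation end_key :: "iexp" where
  "end_key \<equiv>
     (IAdd (IAdd (ICell ''at'' (IVar ''e''))
       (IAdd (ICell ''cls'' (IHalf (IVar ''e''))) (ICell ''cls'' (IHalf (IVar ''e'')))))
       (ISub (IVar ''e'') (IAdd (IHalf (IVar ''e'')) (IHalf (IVar ''e'')))))"

abbreviation clear_mates :: "com" where
  "clear_mates \<equiv>
     range_loop ''e'' (IConst 2) (IVar ''end'') (SetInt ''mate'' (IVar ''e'') (IConst 0))"

definition split_level :: com where
  "split_level =
     clear_mates;;
     pair_pass ''p1'' end_key;;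
     pair_pass ''p2'' class_key;;
     pair_pass ''p3'' (IVar ''R'');;
     ''R'' ::= IAdd (IVar ''R'') (IVar ''R'');;
     walk"

lemma mods_split_level:
  "mods split_level = {''e'', ''k'', ''x'', ''mate'', ''p'', ''q'', ''p1'', ''p2'', ''p3'', ''cls'', ''R''}"
  by (auto simp: split_level_def mods_pair_pass mods_walk)

text \<open>The keys of the first pass number the pairs of a warehouse and a class in which a product has
  its source or sink (told apart by the parity), those of the second pass only the warehouse and the class.\<close>

lemma keys:
  fixes loc cls u v :: "int \<Rightarrow> int"
  assumes loc: "\<forall>p\<in>{1..m}. loc (2 * p) = st * u p \<and> loc (2 * p + 1) = st * v p"
    and cls: "\<forall>p\<in>{1..m}. R \<le> cls p \<and> cls p < 2 * R"
    and st: "4 * R \<le> st" "0 < R"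
  defines "\<kappa>1 \<equiv> \<lambda>e. loc e + (cls (e div 2) + cls (e div 2)) + (e - (e div 2 + e div 2))"
    and "\<kappa>2 \<equiv> \<lambda>e. loc e + cls (e div 2)"
  shows key1_range: "e \<in> {2..<2 * m + 2} \<Longrightarrow> \<exists>w x. \<kappa>1 e = st * w + x \<and> 2 * R \<le> x \<and> x < 4 * R"
    and key2_range: "e \<in> {2..<2 * m + 2} \<Longrightarrow> \<exists>w x. \<kappa>2 e = st * w + x \<and> R \<le> x \<and> x < 2 * R"
    and keys_eq: "e \<in> {2..<2 * m + 2} \<Longrightarrow> f \<in> {2..<2 * m + 2} \<Longrightarrow>
      (\<kappa>1 e = \<kappa>1 f) = (\<kappa>2 e = \<kappa>2 f \<and> (even e \<longleftrightarrow> even f))"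
    and key1_source: "R \<le> c \<Longrightarrow> c < 2 * R \<Longrightarrow>
      (\<lambda>p. 2 * p) ` class_of m u cls w c = {e \<in> {2..<2 * m + 2}. \<kappa>1 e = st * w + 2 * c}"
    and key1_sink: "R \<le> c \<Longrightarrow> c < 2 * R \<Longrightarrow>
      (\<lambda>p. 2 * p + 1) ` class_of m v cls w c = {e \<in> {2..<2 * m + 2}. \<kappa>1 e = st * w + 2 * c + 1}"
    and key2_of_key1: "R \<le> c \<Longrightarrow> c < 2 * R \<Longrightarrow> e \<in> {2..<2 * m + 2} \<Longrightarrow>
      \<kappa>1 e = st * w + 2 * c \<or> \<kappa>1 e = st * w + 2 * c + 1 \<Longrightarrow> \<kappa>2 e = st * w + c"
proof -
  let ?E = "{2..<2 * m + 2}"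
  define W where "W e = (if even e then u (e div 2) else v (e div 2))" for e
  define b :: "int \<Rightarrow> int" where "b e = (if even e then 0 else 1)" for e
  have h: "e div 2 \<in> {1..m}" if "e \<in> ?E" for e using that by auto
  have e_eq: "e = 2 * (e div 2) + b e" for e unfolding b_def by simp
  have loc': "loc e = st * W e" if "e \<in> ?E" for e
    using loc h[OF that] e_eq[of e] unfolding W_def b_def by (metis add_0_right)
  have k1: "\<kappa>1 e = st * W e + (2 * cls (e div 2) + b e)" if "e \<in> ?E" for e
    using loc'[OF that] e_eq[of e] unfolding \<kappa>1_def by simp
  have k2: "\<kappa>2 e = st * W e + cls (e div 2)" if "e \<in> ?E" for e
    using loc'[OF that] unfolding \<kappa>2_def by simp
  have c: "R \<le> cls (e div 2)" "cls (e div 2) < 2 * R" if "e \<in> ?E" for e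
    using cls h[OF that] by blast+
  have b: "b e = 0 \<or> b e = 1" for e unfolding b_def by simp
  \<comment> \<open>Warehouse, class and parity can be read off the key because
    \<open>2 * cls p + 1 < 4 * R \<le> st\<close>.\<close>
  have k1_iff: "\<kappa>1 e = st * w + (2 * c' + b') \<longleftrightarrow> W e = w \<and> cls (e div 2) = c' \<and> b e = b'"
    if "e \<in> ?E" "R \<le> c'" "c' < 2 * R" "b' = 0 \<or> b' = 1" for e w c' b'
  proof
    assume "\<kappa>1 e = st * w + (2 * c' + b')"
    then have "st * W e + (2 * cls (e div 2) + b e) = st * w + (2 * c' + b')" using k1 that(1) by simp
    moreover have "0 \<le> 2 * cls (e div 2) + b e" "2 * cls (e div 2) + b e < st"
      using c[OF that(1)] b[of e] st by auto
    moreover have "0 \<le> 2 * c' + b'" "2 * c' + b' < st" using that st by auto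
    ultimately have "W e = w \<and> 2 * cls (e div 2) + b e = 2 * c' + b'" by (rule stride_unique)
    then show "W e = w \<and> cls (e div 2) = c' \<and> b e = b'" using b[of e] that(4) by presburger
  next
    assume "W e = w \<and> cls (e div 2) = c' \<and> b e = b'"
    then show "\<kappa>1 e = st * w + (2 * c' + b')" using k1 that(1) by simp
  qed
  have k2_iff: "\<kappa>2 e = st * w + c' \<longleftrightarrow> W e = w \<and> cls (e div 2) = c'"
    if "e \<in> ?E" "R \<le> c'" "c' < 2 * R" for e w c'
  proof
    assume "\<kappa>2 e = st * w + c'"
    then have "st * W e + cls (e div 2) = st * w + c'" using k2 that(1) by simp
    moreover have "0 \<le> cls (e div 2)" "cls (e div 2) < st" "0 \<le> c'" "c' < st"
      using c[OF that(1)] that st by auto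
    ultimately show "W e = w \<and> cls (e div 2) = c'" by (rule stride_unique)
  next
    assume "W e = w \<and> cls (e div 2) = c'"
    then show "\<kappa>2 e = st * w + c'" using k2 that(1) by simp
  qed
  have b_iff: "b e = b f \<longleftrightarrow> (even e \<longleftrightarrow> even f)" for e f unfolding b_def by simp
  show "\<exists>w x. \<kappa>1 e = st * w + x \<and> 2 * R \<le> x \<and> x < 4 * R" if "e \<in> ?E"
    using k1[OF that] c[OF that] b[of e] by (intro exI[of _ "W e"] exI[of _ "2 * cls (e div 2) + b e"]) auto
  show "\<exists>w x. \<kappa>2 e = st * w + x \<and> R \<le> x \<and> x < 2 * R" if "e \<in> ?E"
    using k2[OF that] c[OF that] by blast
  show "(\<kappa>1 e = \<kappa>1 f) = (\<kappa>2 e = \<kappa>2 f \<and> (even e \<longleftrightarrow> even f))" if "e \<in> ?E" "f \<in> ?E"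
    unfolding k1[OF that(2)] k2[OF that(2)] k1_iff[OF that(1) c[OF that(2)] b[of f]]
      k2_iff[OF that(1) c[OF that(2)]] b_iff by blast
  show "(\<lambda>p. 2 * p) ` class_of m u cls w c = {e \<in> ?E. \<kappa>1 e = st * w + 2 * c}"
    if "R \<le> c" "c < 2 * R"
  proof (rule set_eqI)
    fix e
    have "e \<in> (\<lambda>p. 2 * p) ` class_of m u cls w c \<longleftrightarrow> even e \<and> e div 2 \<in> class_of m u cls w c"
      by auto
    also have "\<dots> \<longleftrightarrow> e \<in> ?E \<and> W e = w \<and> cls (e div 2) = c \<and> b e = 0"
      unfolding class_of_def W_def b_def by auto
    also have "\<dots> \<longleftrightarrow> e \<in> ?E \<and> \<kappa>1 e = st * w + 2 * c"
      using k1_iff[OF _ that, of e 0 w] by auto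
    finally show "e \<in> (\<lambda>p. 2 * p) ` class_of m u cls w c \<longleftrightarrow> e \<in> {e \<in> ?E. \<kappa>1 e = st * w + 2 * c}"
      by simp
  qed
  show "(\<lambda>p. 2 * p + 1) ` class_of m v cls w c = {e \<in> ?E. \<kappa>1 e = st * w + 2 * c + 1}"
    if "R \<le> c" "c < 2 * R"
  proof (rule set_eqI)
    fix e :: int
    have "e \<in> (\<lambda>p. 2 * p + 1) ` class_of m v cls w c \<longleftrightarrow> odd e \<and> e div 2 \<in> class_of m v cls w c"
      by (auto elim!: oddE)
    also have "\<dots> \<longleftrightarrow> e \<in> ?E \<and> W e = w \<and> cls (e div 2) = c \<and> b e = 1"
      unfolding class_of_def W_def b_def by auto
    also have "\<dots> \<longleftrightarrow> e \<in> ?E \<and> \<kappa>1 e = st * w + 2 * c + 1"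
      using k1_iff[OF _ that, of e 1 w] by (auto simp: add.assoc)
    finally show "e \<in> (\<lambda>p. 2 * p + 1) ` class_of m v cls w c \<longleftrightarrow> e \<in> {e \<in> ?E. \<kappa>1 e = st * w + 2 * c + 1}"
      by simp
  qed
  show "\<kappa>2 e = st * w + c" if "R \<le> c" "c < 2 * R" "e \<in> ?E"
    "\<kappa>1 e = st * w + 2 * c \<or> \<kappa>1 e = st * w + 2 * c + 1"
    using k1_iff[OF that(3,1,2), of 0 w] k1_iff[OF that(3,1,2), of 1 w] k2_iff[OF that(3,1,2), of w] that(4)
    by (auto simp: add.assoc)
qed

text \<open>There are \<open>2 * m\<close> ends. Clearing the mates takes 3 steps for each of them
  and every pass 9, and the walk takes 11 steps per product, which adds up to
  \<open>71 * m\<close>.\<close>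

lemma runs_split_level:
  fixes s :: state
  assumes lay: "layout m st u v s" and fresh: "fresh st R s"
    and good: "good_classes m u v R (ints s ''cls'')"
    and R: "ints s ''R'' 0 = R" "0 < R" "4 * R \<le> st"
  shows "runs split_level (71 * nat m + 11)
    (\<lambda>s'. ints s' ''R'' 0 = 2 * R \<and> good_classes m u v (2 * R) (ints s' ''cls'') \<and> fresh st (2 * R) s') s" (is "runs _ _ ?Q _")
proof -
  define loc cls where "loc = ints s ''at''" and "cls = ints s ''cls''"
  define \<kappa>1 where "\<kappa>1 e = loc e + (cls (e div 2) + cls (e div 2)) + (e - (e div 2 + e div 2))" for e
  define \<kappa>2 where "\<kappa>2 e = loc e + cls (e div 2)" for e
  have m: "0 \<le> m" "ints s ''products'' 0 = m" "ints s ''end'' 0 = 2 * m + 2" using lay unfolding layout_def by auto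
  have loc: "\<forall>p\<in>{1..m}. loc (2 * p) = st * u p \<and> loc (2 * p + 1) = st * v p"
    using lay unfolding layout_def loc_def by blast
  have cls: "\<forall>p\<in>{1..m}. R \<le> cls p \<and> cls p < 2 * R"
    using good unfolding good_classes_def cls_def by blast
  note key = keys[OF loc cls R(3,2), folded \<kappa>1_def \<kappa>2_def]
  let ?N = "2 * m + 2"
  let ?E = "{2..<?N}"
  have nt: "nat (?N - 2) = 2 * nat m" using m(1) by simp
  have clear: "runs (clear_mates)
      ((1 + 2) * nat (?N - 2) + 2) (\<lambda>s'. \<forall>e\<in>{2..<?N}. ints s' ''mate'' e = 0) s"
  proof (rule runs_range_loop)
    fix i and s' :: state assume "2 \<le> i" "i < ?N" "ints s' ''e'' 0 = i" "\<forall>e\<in>{2..<i}. ints s' ''mate'' e = 0"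
    then show "runs (SetInt ''mate'' (IVar ''e'') (IConst 0)) 1
      (\<lambda>s''. \<forall>e\<in>{2..<i + 1}. ints (set_var ''e'' (i + 1) s'') ''mate'' e = 0) s'"
      by (intro runsI) (simp add: wp_simps)
  qed (use m in \<open>auto simp: frame_def\<close>)
  have "ints s ''p1'' (\<kappa>1 e) = 0" if e: "e \<in> ?E" for e
  proof -
    obtain w x where "\<kappa>1 e = st * w + x" "2 * R \<le> x" "x < 4 * R" using key(1)[OF e] by blast
    then show ?thesis using fresh R(3) unfolding fresh_def by simp
  qed
  note zero1 = this
  have "ints s ''p2'' (\<kappa>2 e) = 0" if e: "e \<in> ?E" for e
  proof -
    obtain w x where "\<kappa>2 e = st * w + x" "R \<le> x" "x < 2 * R" using key(2)[OF e] by blast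
    then show ?thesis using fresh R(2,3) unfolding fresh_def by simp
  qed
  note zero2 = this
  show ?thesis
    unfolding split_level_def
  proof (rule runs_SeqI[OF clear])
    fix s1 :: state
    assume mate1: "\<forall>e\<in>{2..<?N}. ints s1 ''mate'' e = 0"
      and fr: "frame (mods (clear_mates)) s s1"
    have eq1: "ints s1 a = ints s a" if "a \<notin> {''e'', ''mate''}" for a
      using frame_ints[OF fr] that by simp
    show "runs (pair_pass ''p1'' end_key;;
       pair_pass ''p2'' class_key;;
       pair_pass ''p3'' (IVar ''R'');;
       ''R'' ::= IAdd (IVar ''R'') (IVar ''R'');; walk) (65 * nat m + 9)
      ?Q s1"
    proof (rule runs_SeqI[OF pair_pass[where N = ?N and \<kappa> = \<kappa>1]])
      fix s' :: state assume "frame {''e'', ''k'', ''x'', ''mate'', ''p1''} s1 s'"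
      then have "ints s' ''at'' = loc" "ints s' ''cls'' = cls"
        using eq1 unfolding frame_def loc_def cls_def by simp_all
      then show "ival end_key s' = \<kappa>1 (ints s' ''e'' 0)"
        by (simp add: \<kappa>1_def)
    next
      show "pairing ?N (ints s1 ''mate'')" using mate1 unfolding pairing_def by blast
    next
      show "\<forall>e\<in>?E. ints s1 ''p1'' (\<kappa>1 e) = 0" using zero1 eq1 by simp
    next
      fix s2 :: state
      assume post1: "pass_post ?N \<kappa>1 (ints s1 ''mate'') (ints s1 ''p1'') (ints s2 ''mate'') (ints s2 ''p1'')"
        and fr: "frame (mods (pair_pass ''p1'' end_key)) s1 s2"
      have eq2: "ints s2 a = ints s a" if "a \<notin> {''e'', ''k'', ''x'', ''mate'', ''p1''}" for a
        using frame_ints[OF fr] eq1 that by (simp add: mods_pair_pass)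
      show "runs (pair_pass ''p2'' class_key;;
         pair_pass ''p3'' (IVar ''R'');;
         ''R'' ::= IAdd (IVar ''R'') (IVar ''R'');; walk) (47 * nat m + 7)
        ?Q s2"
      proof (rule runs_SeqI[OF pair_pass[where N = ?N and \<kappa> = \<kappa>2]])
        fix s' :: state assume "frame {''e'', ''k'', ''x'', ''mate'', ''p2''} s2 s'"
        then have "ints s' ''at'' = loc" "ints s' ''cls'' = cls"
          using eq2 unfolding frame_def loc_def cls_def by simp_all
        then show "ival class_key s' = \<kappa>2 (ints s' ''e'' 0)"
          by (simp add: \<kappa>2_def)
      next
        show "pairing ?N (ints s2 ''mate'')" using post1 unfolding pass_post_def extends_pairing_def by blast
      next
        show "\<forall>e\<in>?E. ints s2 ''p2'' (\<kappa>2 e) = 0" using zero2 eq2 by simp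
      next
        fix s3 :: state
        assume post2: "pass_post ?N \<kappa>2 (ints s2 ''mate'') (ints s2 ''p2'') (ints s3 ''mate'') (ints s3 ''p2'')"
          and fr: "frame (mods (pair_pass ''p2'' class_key)) s2 s3"
        have eq3: "ints s3 a = ints s2 a" if "a \<notin> {''e'', ''k'', ''x'', ''mate'', ''p2''}" for a
          using frame_ints[OF fr] that by (simp add: mods_pair_pass)
        show "runs (pair_pass ''p3'' (IVar ''R'');; ''R'' ::= IAdd (IVar ''R'') (IVar ''R'');; walk) (29 * nat m + 5)
          ?Q s3"
        proof (rule runs_SeqI[OF pair_pass[where N = ?N and \<kappa> = "\<lambda>_. R"]])
          fix s' :: state assume "frame {''e'', ''k'', ''x'', ''mate'', ''p3''} s3 s'"
          then have "ints s' ''R'' = ints s ''R''"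
            using eq2 eq3 unfolding frame_def by simp
          then show "ival (IVar ''R'') s' = R" using R(1) by simp
        next
          show "pairing ?N (ints s3 ''mate'')" using post2 unfolding pass_post_def extends_pairing_def by blast
        next
          show "\<forall>e\<in>?E. ints s3 ''p3'' R = 0" using fresh eq2 eq3 unfolding fresh_def by simp
        next
          fix s4 :: state
          assume post3: "pass_post ?N (\<lambda>_. R) (ints s3 ''mate'') (ints s3 ''p3'') (ints s4 ''mate'') (ints s4 ''p3'')"
            and fr: "frame (mods (pair_pass ''p3'' (IVar ''R''))) s3 s4"
          have eq4: "ints s4 a = ints s3 a" if "a \<notin> {''e'', ''k'', ''x'', ''mate'', ''p3''}" for a
            using frame_ints[OF fr] that by (simp add: mods_pair_pass)
          have "balanced_pairing ?N \<kappa>1 \<kappa>2 (ints s4 ''mate'') {e \<in> ?E. ints s2 ''mate'' e = 0}"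
            by (rule balanced_pairing_passes[OF _ post1 post2 post3]) (use mate1 m key(3) in auto)
          then obtain L where bp: "balanced_pairing ?N \<kappa>1 \<kappa>2 (ints s4 ''mate'') L" by blast
          let ?s5 = "set_var ''R'' (2 * R) s4"
          have R4: "ints s4 ''R'' 0 = R" and cls4: "ints s4 ''cls'' = cls" and m4: "ints s4 ''products'' 0 = m"
            using eq2 eq3 eq4 R(1) m unfolding cls_def by simp_all
          \<comment> \<open>The passes write only to the cells of their keys, which lie below the
            ranges of the next level.\<close>
          have fresh5: "fresh st (2 * R) ?s5"
            unfolding fresh_def
          proof (intro conjI allI impI)
            fix w x assume x: "2 * (2 * R) \<le> x" "x < st"
            have "st * w + x \<notin> \<kappa>1 ` ?E"
            proof
              assume "st * w + x \<in> \<kappa>1 ` ?E"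
              then obtain e where "e \<in> ?E" "st * w + x = \<kappa>1 e" by blast
              with key(1)[OF this(1)] obtain w' x' where "st * w + x = st * w' + x'" "2 * R \<le> x'" "x' < 4 * R"
                by auto
              then show False using stride_unique[of st w x w' x'] x R by auto
            qed
            then have "ints s2 ''p1'' (st * w + x) = ints s1 ''p1'' (st * w + x)"
              using post1 unfolding pass_post_def by blast
            then show "ints ?s5 ''p1'' (st * w + x) = 0"
              using x R(2) fresh eq1 eq3 eq4 unfolding fresh_def by simp
          next
            fix w x assume x: "2 * R \<le> x" "x < st"
            have "st * w + x \<notin> \<kappa>2 ` ?E"
            proof
              assume "st * w + x \<in> \<kappa>2 ` ?E"
              then obtain e where "e \<in> ?E" "st * w + x = \<kappa>2 e" by blast
              with key(2)[OF this(1)] obtain w' x' where "st * w + x = st * w' + x'" "R \<le> x'" "x' < 2 * R"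
                by auto
              then show False using stride_unique[of st w x w' x'] x R by auto
            qed
            then have "ints s3 ''p2'' (st * w + x) = ints s2 ''p2'' (st * w + x)"
              using post2 unfolding pass_post_def by blast
            then show "ints ?s5 ''p2'' (st * w + x) = 0"
              using x R(2) fresh eq2 eq4 unfolding fresh_def by simp
          next
            fix x assume x: "2 * R \<le> x"
            then have "x \<notin> (\<lambda>_. R) ` ?E" using R(2) by auto
            then have "ints s4 ''p3'' x = ints s3 ''p3'' x"
              using post3 unfolding pass_post_def by blast
            then show "ints ?s5 ''p3'' x = 0"
              using x R(2) fresh eq2 eq3 unfolding fresh_def by simp
          qed
          have "runs walk (11 * nat m + 2) (\<lambda>s'. \<exists>X.
              (\<forall>p\<in>{1..m}. ints s' ''cls'' p = 2 * ints ?s5 ''cls'' p + (if p \<in> X then 0 else 1)) \<and>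
              (\<forall>e\<in>{2..<2 * m + 2}. entered X e \<noteq> entered X (ints ?s5 ''mate'' e))) ?s5"
          proof (rule runs_walk)
            show "\<forall>p\<in>{1..m}. ints ?s5 ''cls'' p < ints ?s5 ''R'' 0 \<and> ints ?s5 ''R'' 0 \<le> 2 * ints ?s5 ''cls'' p"
              using cls cls4 by auto
            show "total_pairing ?N (ints ?s5 ''mate'')" using bp unfolding balanced_pairing_def by simp
          qed (use m4 m R in auto)
          then have "runs walk (11 * nat m + 2)
             ?Q ?s5"
          proof (rule runs_mono)
            fix s' :: state
            assume "\<exists>X. (\<forall>p\<in>{1..m}. ints s' ''cls'' p = 2 * ints ?s5 ''cls'' p + (if p \<in> X then 0 else 1)) \<and>
                (\<forall>e\<in>{2..<2 * m + 2}. entered X e \<noteq> entered X (ints ?s5 ''mate'' e))"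
              and fr: "frame (mods walk) ?s5 s'"
            then obtain X where X: "\<forall>p\<in>{1..m}. ints s' ''cls'' p = 2 * cls p + (if p \<in> X then 0 else 1)"
                "\<forall>e\<in>?E. entered X e \<noteq> entered X (ints s4 ''mate'' e)"
              using cls4 by auto
            have "good_classes m u v (2 * R) (ints s' ''cls'')"
            proof (rule good_classes_split[OF good[folded cls_def] X(1)])
              fix w c assume c: "R \<le> c" "c < 2 * R"
              show "(int (card (class_of m u cls w c \<inter> X)) - int (card (class_of m u cls w c - X)),
                 int (card (class_of m v cls w c \<inter> X)) - int (card (class_of m v cls w c - X)))
                \<in> {(0, 0), (0, 1), (0, -1), (1, 0), (-1, 0), (1, 1), (-1, -1)}"
                by (rule balanced_halves[OF bp X(2) finite_class_of finite_class_of key(4)[OF c] key(5)[OF c]])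
                  (use key(6)[OF c] in blast)+
            qed
            moreover have "ints s' ''R'' 0 = 2 * R" "fresh st (2 * R) s'"
              using frame_ints[OF fr] fresh5 unfolding mods_walk fresh_def by simp_all
            ultimately show "ints s' ''R'' 0 = 2 * R \<and> good_classes m u v (2 * R) (ints s' ''cls'') \<and> fresh st (2 * R) s'"
              by blast
          qed simp
          then show "runs (''R'' ::= IAdd (IVar ''R'') (IVar ''R'');; walk) (11 * nat m + 3)
             ?Q s4"
            using R4 by (intro runsI) (auto simp: wp_simps elim!: wp_runs)
        qed (use m eq2 eq3 nt in auto)
      qed (use m eq2 nt in auto)
    qed (use m eq1 nt in auto)
  qed (use nt in auto)
qed

section \<open>Number of levels\<close>

abbreviation check_step :: "com" where
  "check_step \<equiv>
     If (ILess (ICell ''dr'' (IVar ''w'')) (ICell ''deg'' (IVar ''w''))) (''need'' ::= IConst 1) Skip;;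
       SetInt ''dr'' (IVar ''w'') (IAdd (ICell ''dr'' (IVar ''w'')) (ICell ''dr'' (IVar ''w'')))"

definition check_level :: com where
  "check_level = ''need'' ::= IConst 0;;
     range_loop ''w'' (IConst 0) (IVar ''warehouses'')
      (check_step)"

lemma mods_check_level: "mods check_level = {''need'', ''w'', ''dr''}"
  by (auto simp: check_level_def)

text \<open>\<open>dr\<close> is doubled right after its comparison, in anticipation of the next
  doubling of \<open>R\<close>.\<close>

lemma runs_check_level:
  fixes s :: state
  assumes n: "ints s ''warehouses'' 0 = n" "0 \<le> n"
  shows "runs check_level (5 * nat n + 3)
    (\<lambda>s'. (0 < ints s' ''need'' 0 \<longleftrightarrow> (\<exists>w\<in>{0..<n}. ints s ''dr'' w < ints s ''deg'' w)) \<and>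
       (\<forall>w\<in>{0..<n}. ints s' ''dr'' w = 2 * ints s ''dr'' w)) s"
proof -
  define Inv where "Inv i s' \<longleftrightarrow>
     (0 < ints s' ''need'' 0 \<longleftrightarrow> (\<exists>w\<in>{0..<i}. ints s ''dr'' w < ints s ''deg'' w)) \<and>
     (\<forall>w\<in>{0..<i}. ints s' ''dr'' w = 2 * ints s ''dr'' w) \<and>
     (\<forall>w\<in>{i..<n}. ints s' ''dr'' w = ints s ''dr'' w)" for i and s' :: state
  let ?s0 = "set_var ''need'' 0 s"
  let ?body = check_step
  have "runs (range_loop ''w'' (IConst 0) (IVar ''warehouses'') ?body) ((3 + 2) * nat (n - 0) + 2) (Inv n) ?s0"
  proof (rule runs_range_loop)
    show "Inv 0 (set_var ''w'' 0 ?s0)"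
      unfolding Inv_def by simp
  next
    fix i and s' :: state
    assume i: "0 \<le> i" "i < n" "ints s' ''w'' 0 = i" and I: "Inv i s'"
      and fr: "frame (insert ''w'' (mods ?body)) ?s0 s'"
    have deg: "ints s' ''deg'' = ints s ''deg''" using frame_ints[OF fr, of "''deg''"] by simp
    have dr: "ints s' ''dr'' i = ints s ''dr'' i" using I i unfolding Inv_def by auto
    have "{0..<i + 1} = insert i {0..<i}" using i by auto
    then show "runs ?body 3 (\<lambda>s''. Inv (i + 1) (set_var ''w'' (i + 1) s'')) s'"
      using I i deg dr by (intro runsI) (auto simp: wp_simps Inv_def)
  qed (use n in \<open>auto simp: frame_def\<close>)
  then have "wp check_level (\<lambda>s' _. Inv n s') s (5 * nat n + 3)"
    unfolding check_level_def by (auto simp: wp_simps elim!: wp_runs)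
  then show ?thesis
    unfolding Inv_def by (intro runsI) (auto elim: wp_mono)
qed

definition levels :: com where
  "levels = check_level;; While (ILess (IConst 0) (IVar ''need'')) (split_level;; check_level)"

lemma mods_levels: "mods levels = {''need'', ''w'', ''dr'', ''e'', ''k'', ''x'', ''mate'', ''p'', ''q'',
    ''p1'', ''p2'', ''p3'', ''cls'', ''R''}"
  by (auto simp: levels_def mods_check_level mods_split_level)

text \<open>The loop continues only while some warehouse violates
  \<open>deg w \<le> D w * 2 ^ k\<close>. Such a warehouse has \<open>1 \<le> D w\<close> and
  \<open>deg w \<le> m \<le> 2 ^ K\<close>, hence \<open>k < K\<close>, which bounds the number of
  levels. The last disjunction remembers the violation before the final doubling; the bound
  \<open>R \<le> 2 * T\<close> rests on it.\<close>

lemma runs_levels: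
  fixes s :: state and K :: nat
  assumes lay: "layout m (8 * m) u v s" and fresh: "fresh (8 * m) 1 s"
    and good: "good_classes m u v 1 (ints s ''cls'')" and R: "ints s ''R'' 0 = 1"
    and n: "ints s ''warehouses'' 0 = n" "0 \<le> n"
    and dr: "\<forall>w\<in>{0..<n}. ints s ''dr'' w = D w"
    and deg: "\<forall>w\<in>{0..<n}. ints s ''deg'' w = deg w \<and> deg w \<le> m \<and> (0 < deg w \<longrightarrow> 1 \<le> D w) \<and> 0 \<le> D w"
    and K: "m \<le> 2 ^ K"
  shows "runs levels ((71 * nat m + 5 * nat n + 15) * K + 5 * nat n + 5)
    (\<lambda>s'. \<exists>k\<le>K. ints s' ''R'' 0 = 2 ^ k \<and> good_classes m u v (2 ^ k) (ints s' ''cls'') \<and>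
       (\<forall>w\<in>{0..<n}. deg w \<le> D w * 2 ^ k) \<and> (k = 0 \<or> (\<exists>w\<in>{0..<n}. D w * 2 ^ k < 2 * deg w))) s"
proof -
  let ?A = "71 * nat m + 5 * nat n + 15"
  let ?Q = "\<lambda>s'. \<exists>k\<le>K. ints s' ''R'' 0 = 2 ^ k \<and> good_classes m u v (2 ^ k) (ints s' ''cls'') \<and>
       (\<forall>w\<in>{0..<n}. deg w \<le> D w * 2 ^ k) \<and> (k = 0 \<or> (\<exists>w\<in>{0..<n}. D w * 2 ^ k < 2 * deg w))"
  let ?body = "split_level;; check_level"
  define M where "M = mods levels"
  define Inv where "Inv s' c \<longleftrightarrow> (\<exists>k\<le>K. frame M s s' \<and> ints s' ''R'' 0 = 2 ^ k \<and>
     good_classes m u v (2 ^ k) (ints s' ''cls'') \<and> fresh (8 * m) (2 ^ k) s' \<and>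
     (\<forall>w\<in>{0..<n}. ints s' ''dr'' w = 2 * (D w * 2 ^ k)) \<and>
     (0 < ints s' ''need'' 0 \<longleftrightarrow> (\<exists>w\<in>{0..<n}. D w * 2 ^ k < deg w)) \<and>
     (k = 0 \<or> (\<exists>w\<in>{0..<n}. D w * 2 ^ k < 2 * deg w)) \<and> ?A * (K - k) + 1 \<le> c)" for s' and c :: nat
  have eqs: "layout m (8 * m) u v s'" "ints s' ''warehouses'' = ints s ''warehouses''"
     "ints s' ''deg'' = ints s ''deg''" if "frame M s s'" for s'
    using lay frame_ints[OF that] unfolding M_def mods_levels layout_def by simp_all
  have "wp (While (ILess (IConst 0) (IVar ''need'')) ?body) (\<lambda>s' _. ?Q s') s1 (?A * K + 2)"
    if s1: "(0 < ints s1 ''need'' 0 \<longleftrightarrow> (\<exists>w\<in>{0..<n}. ints s ''dr'' w < ints s ''deg'' w)) \<and>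
       (\<forall>w\<in>{0..<n}. ints s1 ''dr'' w = 2 * ints s ''dr'' w)" and fr1: "frame (mods check_level) s s1" for s1
  proof (rule wp_While[where I = Inv])
    have "frame M s s1" by (rule frame_mono[OF fr1]) (auto simp: M_def levels_def)
    moreover have "ints s1 a = ints s a" if "a \<notin> {''need'', ''w'', ''dr''}" for a
      using frame_ints[OF fr1] that by (simp add: mods_check_level)
    ultimately show "Inv s1 (?A * K + 2)"
      unfolding Inv_def
      by (intro exI[of _ "0::nat"]) (use s1 dr deg R good fresh in \<open>auto simp: fresh_def\<close>)
  next
    fix s2 c
    assume I: "Inv s2 c" and b: "bval (ILess (IConst 0) (IVar ''need'')) s2"
    then obtain k where k: "k \<le> K" "frame M s s2" "ints s2 ''R'' 0 = 2 ^ k"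
        "good_classes m u v (2 ^ k) (ints s2 ''cls'')" "fresh (8 * m) (2 ^ k) s2"
        "\<forall>w\<in>{0..<n}. ints s2 ''dr'' w = 2 * (D w * 2 ^ k)" "\<exists>w\<in>{0..<n}. D w * 2 ^ k < deg w"
        "?A * (K - k) + 1 \<le> c"
      unfolding Inv_def by auto
    from k(7) obtain w where w: "w \<in> {0..<n}" "D w * 2 ^ k < deg w" by blast
    have "deg w \<le> m" "0 < deg w \<longrightarrow> 1 \<le> D w" "0 \<le> D w" using deg w(1) by blast+
    moreover have "0 \<le> D w * 2 ^ k" using \<open>0 \<le> D w\<close> by simp
    ultimately have "1 \<le> D w" using w(2) by linarith
    then have "(2::int) ^ k \<le> D w * 2 ^ k" by simp
    then have km: "(2::int) ^ k < m" using w(2) \<open>deg w \<le> m\<close> by linarith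
    have k2: "(2::int) ^ k \<le> 2 * m" using km zero_less_power[of "2::int" k] by linarith
    have "(2::int) ^ k < 2 ^ K" using km K by linarith
    then have "k < K" by simp
    then have "K - k = Suc (K - Suc k)" by simp
    then have c: "?A * (K - Suc k) + ?A + 1 \<le> c" using k(8) by (simp only: mult_Suc_right)
    have "wp split_level (wp check_level Inv) s2 (c - 1)"
    proof (rule wp_runs[OF runs_split_level[OF eqs(1)[OF k(2)] k(5,4,3)]])
      fix s3 c3
      assume s3: "ints s3 ''R'' 0 = 2 * 2 ^ k \<and> good_classes m u v (2 * 2 ^ k) (ints s3 ''cls'') \<and> fresh (8 * m) (2 * 2 ^ k) s3"
        and fr3: "frame (mods split_level) s2 s3" and c3: "c - 1 - (71 * nat m + 11) \<le> c3"
      have "frame (M \<union> mods split_level) s s3" using frame_trans[OF k(2) fr3] .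
      then have F3: "frame M s s3" by (rule frame_mono) (auto simp: M_def levels_def)
      have dr3: "ints s3 ''dr'' = ints s2 ''dr''" using frame_ints[OF fr3] by (simp add: mods_split_level)
      have n3: "ints s3 ''warehouses'' 0 = n" using eqs[OF F3] n by simp
      show "wp check_level Inv s3 c3"
      proof (rule wp_runs[OF runs_check_level[OF n3 n(2)]])
        fix s4 c4
        assume s4: "(0 < ints s4 ''need'' 0 \<longleftrightarrow> (\<exists>w\<in>{0..<n}. ints s3 ''dr'' w < ints s3 ''deg'' w)) \<and>
            (\<forall>w\<in>{0..<n}. ints s4 ''dr'' w = 2 * ints s3 ''dr'' w)"
          and fr4: "frame (mods check_level) s3 s4" and c4: "c3 - (5 * nat n + 3) \<le> c4"
        have "frame (M \<union> mods check_level) s s4" using frame_trans[OF F3 fr4] .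
        then have F4: "frame M s s4" by (rule frame_mono) (auto simp: M_def levels_def)
        have same: "ints s4 a = ints s3 a" if "a \<notin> {''need'', ''w'', ''dr''}" for a
          using frame_ints[OF fr4] that by (simp add: mods_check_level)
        have D3: "ints s3 ''dr'' w = D w * 2 ^ Suc k \<and> ints s3 ''deg'' w = deg w" if "w \<in> {0..<n}" for w
          using k(6) dr3 eqs(3)[OF F3] deg that by simp
        then have ex: "(\<exists>w\<in>{0..<n}. ints s3 ''dr'' w < ints s3 ''deg'' w) \<longleftrightarrow> (\<exists>w\<in>{0..<n}. D w * 2 ^ Suc k < deg w)"
          by auto
        show "Inv s4 c4"
          unfolding Inv_def
        proof (intro exI[of _ "Suc k"] conjI)
          show "ints s4 ''R'' 0 = 2 ^ Suc k" "good_classes m u v (2 ^ Suc k) (ints s4 ''cls'')"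
            "fresh (8 * m) (2 ^ Suc k) s4"
            using s3 same by (simp_all add: fresh_def)
          show "\<forall>w\<in>{0..<n}. ints s4 ''dr'' w = 2 * (D w * 2 ^ Suc k)" using s4 D3 by simp
          show "(0 < ints s4 ''need'' 0) = (\<exists>w\<in>{0..<n}. D w * 2 ^ Suc k < deg w)" using s4 ex by blast
          show "Suc k = 0 \<or> (\<exists>w\<in>{0..<n}. D w * 2 ^ Suc k < 2 * deg w)" using w by (auto intro!: bexI[of _ w])
          show "?A * (K - Suc k) + 1 \<le> c4" using c c3 c4 by linarith
        qed (use \<open>k < K\<close> F4 in auto)
      qed (use c c3 in linarith)
    qed (use k2 c in auto)
    then show "1 \<le> c \<and> wp ?body Inv s2 (c - 1)" using c by (simp add: wp_Seq)
  next
    fix s2 c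
    assume I: "Inv s2 c" and b: "\<not> bval (ILess (IConst 0) (IVar ''need'')) s2"
    then show "1 \<le> c \<and> ?Q s2" unfolding Inv_def by (auto simp: not_less)
  qed
  then show ?thesis
    unfolding levels_def by (intro runs_SeqI[OF runs_check_level[OF n]] runsI) auto
qed

section \<open>Preparation\<close>

text \<open>A negative \<open>c\<close> is the code of an infinite capacity and admits
  everything.\<close>

definition fits :: "real \<Rightarrow> real \<Rightarrow> bool" where
  "fits c x \<longleftrightarrow> \<not> (0 \<le> c \<and> c < x)"

text \<open>For \<open>0 < z\<close> and \<open>0 \<le> c\<close> this is the minimum of
  \<open>j\<close> and \<open>c / z\<close> rounded down. Counting avoids the division, covers size
  \<open>0\<close> and infinite capacities, and can be carried out by adding up sizes.\<close>

definition throughput :: "real \<Rightarrow> real \<Rightarrow> nat \<Rightarrow> nat" where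
  "throughput c z j = card {i \<in> {1..j}. fits c (real i * z)}"

lemma throughput_0: "throughput c z 0 = 0"
  by (simp add: throughput_def)

lemma throughput_Suc: "throughput c z (Suc j) = throughput c z j + (if fits c (real (Suc j) * z) then 1 else 0)"
proof -
  have "{i \<in> {1..Suc j}. fits c (real i * z)} =
     (if fits c (real (Suc j) * z) then insert (Suc j) {i \<in> {1..j}. fits c (real i * z)}
      else {i \<in> {1..j}. fits c (real i * z)})"
    by (auto simp: le_Suc_eq)
  then show ?thesis by (simp add: throughput_def)
qed

text \<open>Each warehouse \<open>w\<close> owns the addresses from its base \<open>st * w\<close> on, where \<open>st = 8 * m\<close>; the array
  \<open>at\<close> holds the base of the warehouse of each end. The arrays \<open>deg\<close>, \<open>dd\<close> and \<open>dr\<close> hold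
  the out-degree, \<open>D w\<close> and (at the tests of \<open>check_level\<close>) \<open>D w * R\<close>.\<close>

abbreviation read_product :: "name \<Rightarrow> name \<Rightarrow> name \<Rightarrow> com" where
  "read_product src snk cap \<equiv>
     ''q'' ::= ICell src (ISub (IVar ''p'') (IConst 1));;
       SetInt ''u'' (IVar ''p'') (IVar ''q'');;
       SetInt ''at'' (IAdd (IVar ''p'') (IVar ''p'')) (ICell ''base'' (IVar ''q''));;
       SetInt ''at'' (IAdd (IAdd (IVar ''p'') (IVar ''p'')) (IConst 1))
         (ICell ''base'' (ICell snk (ISub (IVar ''p'') (IConst 1))));;
       SetInt ''cls'' (IVar ''p'') (IConst 1);;
       SetInt ''deg'' (IVar ''q'') (IAdd (ICell ''deg'' (IVar ''q'')) (IConst 1));;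
       SetReal ''acc'' (IVar ''q'') (RAdd (RCell ''acc'' (IVar ''q'')) (RCell ''size'' (ISub (IVar ''p'') (IConst 1))));;
       If (Not (And (Not (RLess (RCell cap (IVar ''q'')) (RConst 0)))
             (RLess (RCell cap (IVar ''q'')) (RCell ''acc'' (IVar ''q'')))))
        (SetInt ''dd'' (IVar ''q'') (IAdd (ICell ''dd'' (IVar ''q'')) (IConst 1));;
         SetInt ''dr'' (IVar ''q'') (IAdd (ICell ''dr'' (IVar ''q'')) (IConst 1)))
        Skip"

abbreviation bases_step :: "com" where
  "bases_step \<equiv>
     SetInt ''base'' (IVar ''w'') (IVar ''x'');; ''x'' ::= IAdd (IVar ''x'') (IVar ''st'')"

definition prepare :: "name \<Rightarrow> name \<Rightarrow> name \<Rightarrow> com" where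
  "prepare src snk cap =
     ''st'' ::= IAdd (IVar ''products'') (IVar ''products'');;
     ''st'' ::= IAdd (IVar ''st'') (IVar ''st'');;
     ''st'' ::= IAdd (IVar ''st'') (IVar ''st'');;
     ''end'' ::= IAdd (IAdd (IVar ''products'') (IVar ''products'')) (IConst 2);;
     ''R'' ::= IConst 1;;
     ''x'' ::= IConst 0;;
     range_loop ''w'' (IConst 0) (IVar ''warehouses'')
      (bases_step);;
     range_loop ''p'' (IConst 1) (IAdd (IVar ''products'') (IConst 1))
      (read_product src snk cap)"

lemma mods_prepare: "mods (prepare src snk cap) =
    {''st'', ''end'', ''R'', ''x'', ''w'', ''base'', ''p'', ''q'', ''u'', ''at'', ''cls'', ''deg'', ''acc'', ''dd'', ''dr''}"
  by (auto simp: prepare_def)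

text \<open>In the absence of multiplication, the bases arise by repeated addition and the stride
  \<open>8 * m\<close> by three doublings. \<open>acc\<close> sums up the sizes read so far at a
  warehouse, so its \<open>i\<close>-th product triggers the test whether \<open>i * z\<close> fits,
  which is one step of the recursion \<open>throughput_Suc\<close>.\<close>

lemma runs_prepare:
  fixes s :: state
  assumes names: "src \<in> {''source'', ''sink''}" "snk \<in> {''source'', ''sink''}" "cap \<in> {''carry_out'', ''carry_in''}"
    and m: "ints s ''products'' 0 = m" "0 \<le> m" and n: "ints s ''warehouses'' 0 = n" "0 \<le> n"
    and u: "\<forall>p\<in>{1..m}. ints s src (p - 1) = u p \<and> u p \<in> {0..<n}"
    and v: "\<forall>p\<in>{1..m}. ints s snk (p - 1) = v p \<and> v p \<in> {0..<n}"
    and z: "\<forall>p\<in>{1..m}. reals s ''size'' (p - 1) = z"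
    and zero: "ints s ''deg'' = (\<lambda>_. 0)" "ints s ''dd'' = (\<lambda>_. 0)" "ints s ''dr'' = (\<lambda>_. 0)"
      "reals s ''acc'' = (\<lambda>_. 0)"
  shows "runs (prepare src snk cap) (4 * nat n + 12 * nat m + 10)
    (\<lambda>s'. layout m (8 * m) u v s' \<and> ints s' ''R'' 0 = 1 \<and>
       (\<forall>p\<in>{1..m}. ints s' ''cls'' p = 1 \<and> ints s' ''u'' p = u p) \<and>
       (\<forall>w\<in>{0..<n}. ints s' ''deg'' w = card (members m u w) \<and>
          ints s' ''dd'' w = throughput (reals s cap w) z (card (members m u w)) \<and>
          ints s' ''dr'' w = throughput (reals s cap w) z (card (members m u w)))) s"
proof -
  let ?base = bases_step
  let ?body = "read_product src snk cap"
  have ne: "src \<notin> {''st'', ''end'', ''R'', ''x'', ''w'', ''base'', ''p'', ''q'', ''u'', ''at'', ''cls'', ''deg'', ''acc'', ''dd'', ''dr''}"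
    "snk \<notin> {''st'', ''end'', ''R'', ''x'', ''w'', ''base'', ''p'', ''q'', ''u'', ''at'', ''cls'', ''deg'', ''acc'', ''dd'', ''dr''}"
    "cap \<notin> {''st'', ''end'', ''R'', ''x'', ''w'', ''base'', ''p'', ''q'', ''u'', ''at'', ''cls'', ''deg'', ''acc'', ''dd'', ''dr''}"
    using names by auto
  define initial where "initial s1 \<longleftrightarrow> ints s1 ''st'' 0 = 8 * m \<and> ints s1 ''end'' 0 = 2 * m + 2 \<and>
     ints s1 ''R'' 0 = 1" for s1 :: state
  have A: "runs (range_loop ''w'' (IConst 0) (IVar ''warehouses'') ?base) (4 * nat n + 2)
     (\<lambda>s2. initial s2 \<and> (\<forall>w\<in>{0..<n}. ints s2 ''base'' w = 8 * m * w)) s1"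
    if s1: "initial s1" "ints s1 ''x'' 0 = 0" "ints s1 ''warehouses'' 0 = n" for s1
  proof -
    define Inv where "Inv i s2 \<longleftrightarrow> ints s2 ''x'' 0 = 8 * m * i \<and>
      (\<forall>w\<in>{0..<i}. ints s2 ''base'' w = 8 * m * w)" for i and s2 :: state
    have "runs (range_loop ''w'' (IConst 0) (IVar ''warehouses'') ?base) ((2 + 2) * nat (n - 0) + 2) (Inv n) s1"
    proof (rule runs_range_loop)
      fix i and s2 :: state
      assume i: "0 \<le> i" "i < n" "ints s2 ''w'' 0 = i" and I: "Inv i s2"
        and fr: "frame (insert ''w'' (mods ?base)) s1 s2"
      have "ints s2 ''st'' 0 = 8 * m" using frame_ints[OF fr, of "''st''"] s1 unfolding initial_def by simp
      then show "runs ?base 2 (\<lambda>s3. Inv (i + 1) (set_var ''w'' (i + 1) s3)) s2"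
        using I i by (intro runsI) (auto simp: wp_simps Inv_def algebra_simps)
    qed (use s1 n in \<open>auto simp: frame_def Inv_def\<close>)
    then show ?thesis
    proof (rule runs_mono)
      fix s2 assume I: "Inv n s2" and fr: "frame (mods (range_loop ''w'' (IConst 0) (IVar ''warehouses'') ?base)) s1 s2"
      then show "initial s2 \<and> (\<forall>w\<in>{0..<n}. ints s2 ''base'' w = 8 * m * w)"
        using s1 frame_ints[OF fr] unfolding initial_def Inv_def by simp
    qed simp
  qed
  define c where "c i w = card {q \<in> {1..<i}. u q = w}" for i w
  define Inv where "Inv i s' \<longleftrightarrow>
     (\<forall>p\<in>{1..<i}. ints s' ''u'' p = u p \<and> ints s' ''at'' (2 * p) = 8 * m * u p \<and>
        ints s' ''at'' (2 * p + 1) = 8 * m * v p \<and> ints s' ''cls'' p = 1) \<and>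
     (\<forall>w\<in>{0..<n}. ints s' ''deg'' w = c i w \<and> reals s' ''acc'' w = real (c i w) * z \<and>
        ints s' ''dd'' w = throughput (reals s cap w) z (c i w) \<and>
        ints s' ''dr'' w = throughput (reals s cap w) z (c i w))" for i and s' :: state
  have c_Suc: "c (i + 1) w = (if u i = w then Suc (c i w) else c i w)" if "1 \<le> i" for i w
  proof -
    have "{q \<in> {1..<i + 1}. u q = w} = (if u i = w then insert i {q \<in> {1..<i}. u q = w} else {q \<in> {1..<i}. u q = w})"
    proof -
      have "{1..<i + 1} = insert i {1..<i}" using that by auto
      then show ?thesis by auto
    qed
    moreover have "finite {q \<in> {1..<i}. u q = w}" by (rule finite_subset[of _ "{1..<i}"]) auto
    ultimately show ?thesis unfolding c_def by auto
  qed
  have c_end: "c (m + 1) w = card (members m u w)" for w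
    unfolding c_def members_def by (rule arg_cong[where f = card]) auto
  have B: "runs (range_loop ''p'' (IConst 1) (IAdd (IVar ''products'') (IConst 1)) ?body)
      ((10 + 2) * nat (m + 1 - 1) + 2) (Inv (m + 1)) s2"
    if base: "\<forall>w\<in>{0..<n}. ints s2 ''base'' w = 8 * m * w"
      and fr2: "frame {''st'', ''end'', ''R'', ''x'', ''w'', ''base''} s s2" for s2
  proof (rule runs_range_loop)
    have "ints s2 ''deg'' = (\<lambda>_. 0)" "ints s2 ''dd'' = (\<lambda>_. 0)" "ints s2 ''dr'' = (\<lambda>_. 0)"
      "reals s2 ''acc'' = (\<lambda>_. 0)"
      using frame_ints[OF fr2] frame_reals[OF fr2] zero by simp_all
    then show "Inv 1 (set_var ''p'' 1 s2)"
      unfolding Inv_def c_def by (simp add: throughput_0)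
  next
    fix i and s' :: state
    assume i: "1 \<le> i" "i < m + 1" "ints s' ''p'' 0 = i" and I: "Inv i s'"
      and fr: "frame (insert ''p'' (mods ?body)) s2 s'"
    have eq: "ints s' src (i - 1) = u i" "ints s' snk (i - 1) = v i" "reals s' cap = reals s cap"
      "reals s' ''size'' (i - 1) = z" "ints s' ''base'' = ints s2 ''base''"
      using frame_ints[OF fr] frame_ints[OF fr2] frame_reals[OF fr] frame_reals[OF fr2] ne u v z i by auto
    have ui: "u i \<in> {0..<n}" "v i \<in> {0..<n}" using u v i by auto
    then have base: "ints s2 ''base'' (u i) = 8 * m * u i" "ints s2 ''base'' (v i) = 8 * m * v i"
      using base by blast+
    have acc: "reals s' ''acc'' (u i) = real (c i (u i)) * z" using I ui unfolding Inv_def by blast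
    define b where "b \<longleftrightarrow> fits (reals s cap (u i)) (real (Suc (c i (u i))) * z)"
    have test: "(reals s cap (u i) < 0 \<or> \<not> reals s cap (u i) < reals s' ''acc'' (u i) + z) \<longleftrightarrow> b"
      unfolding fits_def b_def acc by (auto simp: algebra_simps)
    have step: "Inv (i + 1) s3"
      if s3: "ints s3 ''u'' = (ints s' ''u'')(i := u i)"
        "ints s3 ''at'' = (ints s' ''at'')(2 * i := 8 * m * u i, 2 * i + 1 := 8 * m * v i)"
        "ints s3 ''cls'' = (ints s' ''cls'')(i := 1)"
        "ints s3 ''deg'' = (ints s' ''deg'')(u i := ints s' ''deg'' (u i) + 1)"
        "reals s3 ''acc'' = (reals s' ''acc'')(u i := reals s' ''acc'' (u i) + z)"
        "ints s3 ''dd'' = (ints s' ''dd'')(u i := ints s' ''dd'' (u i) + (if b then 1 else 0))"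
        "ints s3 ''dr'' = (ints s' ''dr'')(u i := ints s' ''dr'' (u i) + (if b then 1 else 0))" for s3 :: state
      unfolding Inv_def
    proof (intro conjI ballI)
      fix p assume p: "p \<in> {1..<i + 1}"
      show "ints s3 ''u'' p = u p" "ints s3 ''at'' (2 * p) = 8 * m * u p"
        "ints s3 ''at'' (2 * p + 1) = 8 * m * v p" "ints s3 ''cls'' p = 1"
        using I p unfolding s3 Inv_def by (auto; presburger)+
    next
      fix w assume w: "w \<in> {0..<n}"
      have I': "ints s' ''deg'' w = c i w" "reals s' ''acc'' w = real (c i w) * z"
        "ints s' ''dd'' w = throughput (reals s cap w) z (c i w)"
        "ints s' ''dr'' w = throughput (reals s cap w) z (c i w)"
        using I w unfolding Inv_def by blast+
      show "ints s3 ''deg'' w = c (i + 1) w" "reals s3 ''acc'' w = real (c (i + 1) w) * z"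
        "ints s3 ''dd'' w = throughput (reals s cap w) z (c (i + 1) w)"
        "ints s3 ''dr'' w = throughput (reals s cap w) z (c (i + 1) w)"
        unfolding s3 c_Suc[OF i(1)]
        by (cases "w = u i"; use I' in \<open>simp add: throughput_Suc b_def algebra_simps\<close>)+
    qed
    have "wp ?body (\<lambda>s'' _. Inv (i + 1) (set_var ''p'' (i + 1) s'')) s' 10"
      using ne by (auto simp: wp_simps eq base i(3) test intro!: step)
    then show "runs ?body 10 (\<lambda>s''. Inv (i + 1) (set_var ''p'' (i + 1) s'')) s'"
      by (rule runsI)
  qed (use m frame_ints[OF fr2] in \<open>auto simp: frame_def\<close>)
  let ?tail = "range_loop ''w'' (IConst 0) (IVar ''warehouses'') ?base;;
    range_loop ''p'' (IConst 1) (IAdd (IVar ''products'') (IConst 1)) ?body"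
  let ?Q = "\<lambda>s'. layout m (8 * m) u v s' \<and> ints s' ''R'' 0 = 1 \<and>
       (\<forall>p\<in>{1..m}. ints s' ''cls'' p = 1 \<and> ints s' ''u'' p = u p) \<and>
       (\<forall>w\<in>{0..<n}. ints s' ''deg'' w = card (members m u w) \<and>
          ints s' ''dd'' w = throughput (reals s cap w) z (card (members m u w)) \<and>
          ints s' ''dr'' w = throughput (reals s cap w) z (card (members m u w)))"
  have tail: "runs ?tail (4 * nat n + 12 * nat m + 4) ?Q s1"
    if s1: "initial s1" "ints s1 ''x'' 0 = 0" and fr1: "frame {''st'', ''end'', ''R'', ''x''} s s1" for s1
  proof (rule runs_SeqI[OF A[OF s1]])
    show "ints s1 ''warehouses'' 0 = n" using frame_ints[OF fr1] n by simp
  next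
    fix s2 assume s2: "initial s2 \<and> (\<forall>w\<in>{0..<n}. ints s2 ''base'' w = 8 * m * w)"
      and fr: "frame (mods (range_loop ''w'' (IConst 0) (IVar ''warehouses'') ?base)) s1 s2"
    have fr2: "frame {''st'', ''end'', ''R'', ''x'', ''w'', ''base''} s s2"
      by (rule frame_mono[OF frame_trans[OF fr1 fr]]) auto
    show "runs (range_loop ''p'' (IConst 1) (IAdd (IVar ''products'') (IConst 1)) ?body) (12 * nat m + 2) ?Q s2"
    proof (rule runs_mono[OF B[OF _ fr2]])
      fix s3 assume I: "Inv (m + 1) s3"
        and fr3: "frame (mods (range_loop ''p'' (IConst 1) (IAdd (IVar ''products'') (IConst 1)) ?body)) s2 s3"
      show "?Q s3"
        using I s2 m frame_ints[OF fr3] frame_ints[OF fr2]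
        unfolding Inv_def initial_def layout_def c_end by auto
    qed (use s2 in auto)
  qed auto
  have "wp (prepare src snk cap) (\<lambda>s' _. ?Q s') s (4 * nat n + 12 * nat m + 10)"
    unfolding prepare_def
    by (simp add: wp_Seq[of "SetInt _ _ _"] wp_SetInt m)
      (rule wp_runs[OF tail], auto simp: initial_def frame_def)
  then show ?thesis by (rule runsI)
qed

section \<open>The segment tree of full slots\<close>

text \<open>The leaves of the tree are the nodes \<open>2 ^ k\<close> to \<open>2 * 2 ^ k - 1\<close>; the node \<open>i\<close> of height \<open>h\<close>
  has the leaves from \<open>i * 2 ^ h\<close> to \<open>(i + 1) * 2 ^ h - 1\<close> below it.\<close>

definition node :: "nat \<Rightarrow> nat \<Rightarrow> int \<Rightarrow> bool" where
  "node k h i \<longleftrightarrow> h \<le> k \<and> 2 ^ (k - h) \<le> i \<and> i < 2 * 2 ^ (k - h)"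

definition full :: "(int \<Rightarrow> bool) \<Rightarrow> nat \<Rightarrow> int \<Rightarrow> bool" where
  "full F h i \<longleftrightarrow> (\<forall>t. i * 2 ^ h \<le> t \<longrightarrow> t < (i + 1) * 2 ^ h \<longrightarrow> F t)"

text \<open>The cell \<open>0\<close> is a sentinel: halving leads from the root \<open>1\<close> to
  \<open>0\<close>, whose would-be children are \<open>0\<close> and \<open>1\<close>, and the
  upward loop of \<open>mark_full\<close> stops there because the flag of \<open>0\<close> is never
  set.\<close>

definition tree :: "nat \<Rightarrow> (int \<Rightarrow> int) \<Rightarrow> (int \<Rightarrow> bool) \<Rightarrow> bool" where
  "tree k g F \<longleftrightarrow> (\<forall>h i. node k h i \<longrightarrow> (0 < g i \<longleftrightarrow> full F h i)) \<and> g 0 \<le> 0"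

lemma treeD: "tree k g F \<Longrightarrow> node k h i \<Longrightarrow> 0 < g i \<longleftrightarrow> full F h i"
  unfolding tree_def by blast

lemma full_Suc: "full F (Suc h) i \<longleftrightarrow> full F h (2 * i) \<and> full F h (2 * i + 1)"
proof -
  define a b c where "a = 2 * i * 2 ^ h" and "b = (2 * i + 1) * 2 ^ h" and "c = (2 * i + 1 + 1) * 2 ^ h"
  have "i * 2 ^ Suc h = a" "(i + 1) * 2 ^ Suc h = c"
    unfolding a_def c_def by (simp_all add: algebra_simps)
  moreover have "a \<le> b" "b \<le> c" unfolding a_def b_def c_def by (simp_all add: mult_right_mono)
  ultimately show ?thesis
    unfolding full_def a_def[symmetric] b_def[symmetric] c_def[symmetric]
    by (auto simp: not_le[symmetric])
qed

lemma full_0: "full F 0 i \<longleftrightarrow> F i"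
  unfolding full_def by (auto simp: zless_add1_eq)

lemma node_child:
  assumes "node k (Suc h) i"
  shows "node k h (2 * i)" "node k h (2 * i + 1)"
proof -
  have "Suc h \<le> k" using assms unfolding node_def by blast
  then have "k - h = Suc (k - Suc h)" by arith
  then show "node k h (2 * i)" "node k h (2 * i + 1)"
    using assms unfolding node_def by auto
qed

lemma node_parent:
  assumes "node k h i" "h < k"
  shows "node k (Suc h) (i div 2)"
proof -
  have "k - h = Suc (k - Suc h)" using assms by simp
  then show ?thesis using assms unfolding node_def by auto
qed

lemma node_positive: "node k h i \<Longrightarrow> 0 < i"
  unfolding node_def using zero_less_power[of "2::int" "k - h"] by linarith

lemma node_unique:
  assumes "node k h i" "node k h' i"
  shows "h = h'"
proof -
  have False if "node k a i" "node k b i" "a < b" for a b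
  proof -
    have "k - a = (k - b) + (b - a)" "1 \<le> b - a" using that unfolding node_def by auto
    then have "(2::int) * 2 ^ (k - b) \<le> 2 ^ (k - a)"
      by (metis power_Suc power_increasing Suc_leI one_le_numeral add_le_mono1 add.commute plus_1_eq_Suc)
    then show False using that unfolding node_def by linarith
  qed
  then show ?thesis using assms by (meson linorder_neqE_nat)
qed

section \<open>Search for the first slot that is not full\<close>

abbreviation climb :: "com" where
  "climb \<equiv>
     While (ILess (IConst 0) (ICell ''tf'' (IAdd (IVar ''b'') (IVar ''i''))))
      (''i'' ::= IHalf (IAdd (IVar ''i'') (IConst 1)))"

abbreviation descend_node :: "com" where
  "descend_node \<equiv>
     (''i'' ::= IAdd (IVar ''i'') (IVar ''i'');;
       If (ILess (IConst 0) (ICell ''tf'' (IAdd (IVar ''b'') (IVar ''i''))))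
        (''i'' ::= IAdd (IVar ''i'') (IConst 1)) Skip)"

definition find_slot :: com where
  "find_slot =
     climb;;
     While (ILess (IVar ''i'') (IVar ''S''))
      descend_node"

lemma mods_find_slot: "mods find_slot = {''i''}"
  by (simp add: find_slot_def)

definition prefix_full :: "nat \<Rightarrow> (int \<Rightarrow> bool) \<Rightarrow> int \<Rightarrow> nat \<Rightarrow> int \<Rightarrow> bool" where
  "prefix_full k F r h i \<longleftrightarrow> node k h i \<and> r \<le> i * 2 ^ h \<and> (\<forall>t. r \<le> t \<longrightarrow> t < i * 2 ^ h \<longrightarrow> F t)"

text \<open>For even \<open>i\<close> the new node is the parent, which starts at the same leaf; for
  odd \<open>i\<close> it is the right neighbour of the parent, which starts just behind
  \<open>i\<close>. Either way only full slots are skipped. The slot \<open>f\<close> ensures that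
  this neighbour exists and that the root is not full.\<close>

lemma climb_step:
  assumes "tree k g F" and P: "prefix_full k F r h i" and "0 < g i"
    and f: "r \<le> f" "f < 2 * 2 ^ k" "\<not> F f"
  shows "h < k \<and> prefix_full k F r (Suc h) ((i + 1) div 2)"
proof -
  have N: "node k h i" using P unfolding prefix_full_def by blast
  have full: "full F h i" using assms(1,3) N unfolding tree_def by blast
  have pre: "F t" if "r \<le> t" "t < (i + 1) * 2 ^ h" for t
    using P full that unfolding prefix_full_def full_def by (cases "t < i * 2 ^ h") auto
  then have "(i + 1) * 2 ^ h \<le> f" using f by (meson not_le)
  then have "(i + 1) * 2 ^ h < 2 * 2 ^ k" using f by linarith
  also have "(2::int) * 2 ^ k = (2 * 2 ^ (k - h)) * 2 ^ h"
    using N unfolding node_def by (simp add: power_add[symmetric])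
  finally have lt: "i + 1 < 2 * 2 ^ (k - h)" by simp
  have hk: "h < k"
  proof (rule ccontr)
    assume "\<not> h < k"
    then have "k - h = 0" by simp
    then show False using lt N unfolding node_def by simp
  qed
  have q: "k - h = Suc (k - Suc h)" using hk by simp
  have "node k (Suc h) ((i + 1) div 2)" using N lt hk unfolding node_def q by auto
  moreover have "r \<le> (i + 1) div 2 * 2 ^ Suc h \<and> (i + 1) div 2 * 2 ^ Suc h \<le> (i + 1) * 2 ^ h"
  proof -
    have ends: "r \<le> i * 2 ^ h" "i * 2 ^ h \<le> (i + 1) * 2 ^ h"
      using P unfolding prefix_full_def by (auto simp: mult_right_mono)
    have eq: "(i + 1) div 2 * 2 ^ Suc h = 2 * ((i + 1) div 2) * 2 ^ h" by simp
    have "2 * ((i + 1) div 2) = i \<or> 2 * ((i + 1) div 2) = i + 1" by presburger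
    then show ?thesis
    proof
      assume *: "2 * ((i + 1) div 2) = i"
      show ?thesis unfolding eq * using ends by blast
    next
      assume *: "2 * ((i + 1) div 2) = i + 1"
      show ?thesis unfolding eq * using ends by (meson order.trans order.refl)
    qed
  qed
  ultimately show ?thesis
    using hk pre unfolding prefix_full_def by (simp del: power_Suc)
qed

text \<open>A node that is not full has a child that is not full, and the search turns right only
  past a full left child, so the skipped prefix remains full.\<close>

lemma descend_step:
  assumes T: "tree k g F" and P: "prefix_full k F r (Suc h) i" and "g i \<le> 0"
  defines "i' \<equiv> if 0 < g (2 * i) then 2 * i + 1 else 2 * i"
  shows "prefix_full k F r h i' \<and> g i' \<le> 0"
proof -
  have N: "node k (Suc h) i" using P unfolding prefix_full_def by blast
  have E: "i * 2 ^ Suc h = 2 * i * 2 ^ h" "(2 * i + 1) * 2 ^ h = 2 * i * 2 ^ h + 2 ^ h"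
    by (simp_all add: algebra_simps)
  have NF: "\<not> full F (Suc h) i" using T N assms(3) unfolding tree_def by force
  show ?thesis
  proof (cases "0 < g (2 * i)")
    case True
    then have F1: "full F h (2 * i)" using T node_child[OF N] unfolding tree_def by blast
    then have "\<not> full F h (2 * i + 1)" using NF full_Suc by blast
    then have "g i' \<le> 0" using True T node_child[OF N] unfolding tree_def i'_def by force
    moreover have "F t" if "r \<le> t" "t < (2 * i + 1) * 2 ^ h" for t
      using P F1 that unfolding prefix_full_def full_def E(1) by (cases "t < 2 * i * 2 ^ h") auto
    moreover have "r \<le> 2 * i * 2 ^ h" using P unfolding prefix_full_def E(1) by blast
    then have "r \<le> (2 * i + 1) * 2 ^ h" unfolding E(2) using zero_le_power[of "2::int" h] by linarith
    ultimately show ?thesis using True node_child[OF N] unfolding prefix_full_def i'_def by simp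
  next
    case False
    then show ?thesis using P node_child[OF N] unfolding prefix_full_def i'_def E by auto
  qed
qed

text \<open>At most \<open>k\<close> climbing iterations cost 2 steps each and at most
  \<open>k\<close> descending ones 4 steps each; the last two steps are the failing tests.\<close>

lemma runs_find_slot:
  fixes s :: state
  assumes g: "ints s ''b'' 0 = b" "tree k (\<lambda>i. ints s ''tf'' (b + i)) F"
    and S: "ints s ''S'' 0 = 2 ^ k"
    and i: "ints s ''i'' 0 = r" "2 ^ k \<le> r"
    and f: "r \<le> f" "f < 2 * 2 ^ k" "\<not> F f"
  shows "runs find_slot (6 * k + 2) (\<lambda>s'. r \<le> ints s' ''i'' 0 \<and> ints s' ''i'' 0 < 2 * 2 ^ k \<and>
     \<not> F (ints s' ''i'' 0) \<and> (\<forall>t. r \<le> t \<longrightarrow> t < ints s' ''i'' 0 \<longrightarrow> F t)) s"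
proof (rule runsI)
  let ?g = "\<lambda>i. ints s ''tf'' (b + i)"
  define I1 where "I1 s' c \<longleftrightarrow> (\<exists>h. prefix_full k F r h (ints s' ''i'' 0) \<and> frame {''i''} s s' \<and>
     2 * (k - h) + 4 * k + 2 \<le> c)" for s' and c :: nat
  define I2 where "I2 s' c \<longleftrightarrow> (\<exists>h. prefix_full k F r h (ints s' ''i'' 0) \<and> ?g (ints s' ''i'' 0) \<le> 0 \<and>
     frame {''i''} s s' \<and> 4 * h + 1 \<le> c)" for s' and c :: nat
  let ?Q = "\<lambda>s'. r \<le> ints s' ''i'' 0 \<and> ints s' ''i'' 0 < 2 * 2 ^ k \<and>
     \<not> F (ints s' ''i'' 0) \<and> (\<forall>t. r \<le> t \<longrightarrow> t < ints s' ''i'' 0 \<longrightarrow> F t)"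
  have eq: "ints s' ''b'' 0 = b" "ints s' ''tf'' = ints s ''tf''" "ints s' ''S'' 0 = 2 ^ k"
    if "frame {''i''} s s'" for s'
    using frame_ints[OF that] g S by simp_all
  have fr: "frame {''i''} s (s'\<lparr>ints := (ints s')(''i'' := x)\<rparr>) \<longleftrightarrow> frame {''i''} s s'" for s' x
    unfolding frame_def by auto
  have descend: "wp (While (ILess (IVar ''i'') (IVar ''S''))
      descend_node) (\<lambda>s' _. ?Q s') s1 c1" if "I2 s1 c1" for s1 c1
  proof (rule wp_While[where I = I2])
    fix s' c
    assume I: "I2 s' c" and b: "bval (ILess (IVar ''i'') (IVar ''S'')) s'"
    then obtain h where h: "prefix_full k F r h (ints s' ''i'' 0)" "?g (ints s' ''i'' 0) \<le> 0"
      "frame {''i''} s s'" "4 * h + 1 \<le> c"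
      unfolding I2_def by blast
    have "h \<noteq> 0"
    proof
      assume "h = 0"
      then show False using h(1) b eq(3)[OF h(3)] unfolding prefix_full_def node_def by simp
    qed
    then obtain h' where h': "h = Suc h'" by (cases h) auto
    note step = descend_step[OF g(2) h(1)[unfolded h'] h(2)]
    have c: "4 * h' + 5 \<le> c" using h(4) h' by simp
    have I2': "I2 s3 c3" if "ints s3 ''i'' 0 = (if 0 < ?g (2 * ints s' ''i'' 0) then 2 * ints s' ''i'' 0 + 1 else 2 * ints s' ''i'' 0)"
       "frame {''i''} s s3" "4 * h' + 1 \<le> c3" for s3 c3
      unfolding I2_def that(1) using step that by blast
    show "1 \<le> c \<and> wp descend_node I2 s' (c - 1)"
      using c by (auto simp: wp_simps eq[OF h(3)] fr h(3) intro!: I2')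
  next
    fix s' c
    assume I: "I2 s' c" and b: "\<not> bval (ILess (IVar ''i'') (IVar ''S'')) s'"
    then obtain h where h: "prefix_full k F r h (ints s' ''i'' 0)" "?g (ints s' ''i'' 0) \<le> 0"
      "frame {''i''} s s'" "4 * h + 1 \<le> c"
      unfolding I2_def by blast
    have N: "node k h (ints s' ''i'' 0)" using h(1) unfolding prefix_full_def by blast
    have "(2::int) ^ k \<le> ints s' ''i'' 0" using b eq[OF h(3)] by simp
    moreover have "(2::int) ^ (k - h) \<le> 2 ^ k" by (rule power_increasing) auto
    moreover have "ints s' ''i'' 0 < 2 * 2 ^ (k - h)" using N unfolding node_def by blast
    ultimately have "ints s' ''i'' 0 < 2 * 2 ^ k" by linarith
    then have "node k 0 (ints s' ''i'' 0)"
      using \<open>2 ^ k \<le> ints s' ''i'' 0\<close> unfolding node_def by simp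
    then have h0: "h = 0" using N node_unique by blast
    have "\<not> F (ints s' ''i'' 0)"
      using treeD[OF g(2) N] h(2) full_0[of F] unfolding h0 by simp
    then show "1 \<le> c \<and> ?Q s'"
      using h(1,4) \<open>ints s' ''i'' 0 < 2 * 2 ^ k\<close> unfolding h0 prefix_full_def by simp
  qed (use that in auto)
  have climb: "wp (climb) I2 s (6 * k + 2)"
  proof (rule wp_While[where I = I1])
    show "I1 s (6 * k + 2)"
      unfolding I1_def using i f
      by (intro exI[of _ 0]) (auto simp: prefix_full_def node_def frame_refl)
  next
    fix s' c
    assume I: "I1 s' c" and b: "bval (ILess (IConst 0) (ICell ''tf'' (IAdd (IVar ''b'') (IVar ''i'')))) s'"
    then obtain h where h: "prefix_full k F r h (ints s' ''i'' 0)"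
      "frame {''i''} s s'" "2 * (k - h) + 4 * k + 2 \<le> c"
      unfolding I1_def by blast
    have "0 < ?g (ints s' ''i'' 0)" using b eq[OF h(2)] by simp
    from climb_step[OF g(2) h(1) this f] have step: "h < k" "prefix_full k F r (Suc h) ((ints s' ''i'' 0 + 1) div 2)"
      by blast+
    have "2 * (k - Suc h) + 4 * k + 4 \<le> c" using h(3) step(1) by simp
    then show "1 \<le> c \<and> wp (''i'' ::= IHalf (IAdd (IVar ''i'') (IConst 1))) I1 s' (c - 1)"
      using step(2) h(2) by (auto simp: wp_simps I1_def fr intro!: exI[of _ "Suc h"])
  next
    fix s' c
    assume I: "I1 s' c" and b: "\<not> bval (ILess (IConst 0) (ICell ''tf'' (IAdd (IVar ''b'') (IVar ''i'')))) s'"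
    then obtain h where h: "prefix_full k F r h (ints s' ''i'' 0)"
      "frame {''i''} s s'" "2 * (k - h) + 4 * k + 2 \<le> c"
      unfolding I1_def by blast
    moreover have "h \<le> k" using h(1) unfolding prefix_full_def node_def by blast
    ultimately show "1 \<le> c \<and> I2 s' (c - 1)"
      using b eq[OF h(2)] unfolding I2_def by (auto intro!: exI[of _ h])
  qed
  then show "wp find_slot (\<lambda>s' _. ?Q s') s (6 * k + 2)"
    unfolding find_slot_def wp_Seq by (rule wp_mono) (rule descend)
qed

section \<open>Update of the flags\<close>

abbreviation children_full :: "bexp" where
  "children_full \<equiv>
     And (ILess (IConst 0) (ICell ''tf'' (IAdd (IVar ''b'') (IAdd (IVar ''i'') (IVar ''i'')))))
        (ILess (IConst 0) (ICell ''tf'' (IAdd (IVar ''b'') (IAdd (IAdd (IVar ''i'') (IVar ''i'')) (IConst 1)))))"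

definition mark_full :: com where
  "mark_full =
     SetInt ''tf'' (IAdd (IVar ''b'') (IVar ''i'')) (IConst 1);;
     ''i'' ::= IHalf (IVar ''i'');;
     While children_full
      (SetInt ''tf'' (IAdd (IVar ''b'') (IVar ''i'')) (IConst 1);; ''i'' ::= IHalf (IVar ''i''))"

lemma mods_mark_full: "mods mark_full = {''tf'', ''i''}"
  by (auto simp: mark_full_def)

text \<open>The flags of the ancestors of the leaf \<open>l\<close> of height at least \<open>h\<close> still have to be updated.\<close>

definition marking :: "nat \<Rightarrow> (int \<Rightarrow> bool) \<Rightarrow> int \<Rightarrow> nat \<Rightarrow> (int \<Rightarrow> int) \<Rightarrow> bool" where
  "marking k F l h g \<longleftrightarrow> h \<le> Suc k \<and> g 0 \<le> 0 \<and>
     (\<forall>h' j. node k h' j \<longrightarrow> (if h \<le> h' \<and> j = l div 2 ^ h' then g j \<le> 0 else 0 < g j \<longleftrightarrow> full F h' j))"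

lemma range_div: "i * 2 ^ h \<le> t \<and> t < (i + 1) * 2 ^ h \<longleftrightarrow> t div 2 ^ h = i" for i t :: int
proof
  assume "i * 2 ^ h \<le> t \<and> t < (i + 1) * 2 ^ h"
  then show "t div 2 ^ h = i"
    by (intro int_div_pos_eq[where r = "t - i * 2 ^ h"]) (auto simp: algebra_simps)
next
  assume "t div 2 ^ h = i"
  then have "t = 2 ^ h * i + t mod 2 ^ h" by (metis mult_div_mod_eq)
  moreover have "0 \<le> t mod 2 ^ h" "t mod 2 ^ h < 2 ^ h" by simp_all
  moreover have "i * 2 ^ h = 2 ^ h * i" "(i + 1) * 2 ^ h = 2 ^ h * i + 2 ^ h" by (simp_all add: algebra_simps)
  ultimately show "i * 2 ^ h \<le> t \<and> t < (i + 1) * 2 ^ h" by linarith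
qed

lemma node_ancestor:
  assumes "node k 0 l" "h \<le> k"
  shows "node k h (l div 2 ^ h)"
  using assms(2)
proof (induction h)
  case (Suc h)
  then have "node k (Suc h) (l div 2 ^ h div 2)" using node_parent by simp
  then show ?case by (simp add: div_mult2_eq[symmetric] zdiv_zmult2_eq[symmetric] mult.commute)
qed (use assms in simp)

text \<open>As long as the slot \<open>l\<close> is not full, none of its ancestors is, so their
  flags are off, as \<open>marking\<close> demands. The ranges of all other inner nodes do not
  contain \<open>l\<close>.\<close>

lemma marking_start:
  assumes T: "tree k g F" and l: "node k 0 l" "\<not> F l"
  shows "marking k (F(l := True)) l 1 (g(l := 1))"
  unfolding marking_def
proof (intro conjI allI impI)
  have "l \<noteq> 0" using node_positive[OF l(1)] by simp
  then show "(g(l := 1)) 0 \<le> 0" using T unfolding tree_def by simp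
next
  fix h j assume N: "node k h j"
  show "if 1 \<le> h \<and> j = l div 2 ^ h then (g(l := 1)) j \<le> 0
    else (0 < (g(l := 1)) j) = full (F(l := True)) h j"
  proof (cases "h = 0")
    case True
    then show ?thesis using T N unfolding tree_def by (auto simp: full_0)
  next
    case False
    then have h1: "1 \<le> h" and "j \<noteq> l" using node_unique[OF N] l(1) by auto
    moreover have "(0 < g j) = full F h j" using T N unfolding tree_def by blast
    moreover have "\<not> full F h j" if "j = l div 2 ^ h"
      using that l(2) range_div[of j h l] unfolding full_def by blast
    moreover have "full (F(l := True)) h j \<longleftrightarrow> full F h j" if "j \<noteq> l div 2 ^ h"
      using that range_div[of j h l] unfolding full_def by auto
    ultimately show ?thesis using h1 by (auto simp: not_less)
  qed
qed simp

lemma marking_step: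
  assumes M: "marking k F l h g" and l: "node k 0 l" and h: "1 \<le> h"
    and i: "i = l div 2 ^ h" and children: "0 < g (2 * i)" "0 < g (2 * i + 1)"
  shows "h \<le> k \<and> marking k F l (Suc h) (g(i := 1))"
proof -
  have hk: "h \<le> k"
  proof (rule ccontr)
    assume "\<not> h \<le> k"
    then have "h = Suc k" using M unfolding marking_def by simp
    \<comment> \<open>Above the root only the sentinel is left, and its flag is not set.\<close>
    then have "i = 0" using l i unfolding node_def by (auto simp: div_pos_pos_trivial)
    then show False using M children unfolding marking_def by simp
  qed
  have N: "node k h i" using node_ancestor[OF l hk] i by simp
  obtain h0 where h0: "h = Suc h0" using h by (cases h) auto
  have "node k h0 (2 * i)" "node k h0 (2 * i + 1)" using node_child N h0 by auto
  moreover have "\<not> h \<le> h0" using h0 by simp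
  ultimately have "full F h0 (2 * i)" "full F h0 (2 * i + 1)"
    using M children unfolding marking_def by metis+
  then have full: "full F h i" using full_Suc h0 by simp
  have "i \<noteq> 0" using node_positive[OF N] by simp
  then have "marking k F l (Suc h) (g(i := 1))"
    unfolding marking_def
  proof (intro conjI allI impI)
    fix h' j assume N': "node k h' j"
    have eq: "h' = h" if "j = i" using node_unique[OF N] N' that by blast
    have M': "if h \<le> h' \<and> j = l div 2 ^ h' then g j \<le> 0 else 0 < g j \<longleftrightarrow> full F h' j"
      using M N' unfolding marking_def by blast
    show "if Suc h \<le> h' \<and> j = l div 2 ^ h' then (g(i := 1)) j \<le> 0 else (0 < (g(i := 1)) j) = full F h' j"
    proof (cases "j = i")
      case True
      then show ?thesis using eq full by auto
    next
      case False
      then have "\<not> (h' = h \<and> j = l div 2 ^ h')" using i by blast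
      then show ?thesis using M' False by (auto split: if_splits simp: le_eq_less_or_eq)
    qed
  qed (use M hk in \<open>auto simp: marking_def\<close>)
  with hk show ?thesis by blast
qed

lemma marking_end:
  assumes M: "marking k F l h g" and l: "node k 0 l" and h: "1 \<le> h"
    and i: "i = l div 2 ^ h" and children: "\<not> (0 < g (2 * i) \<and> 0 < g (2 * i + 1))"
  shows "tree k g F"
  unfolding tree_def
proof (intro conjI allI impI)
  show "g 0 \<le> 0" using M unfolding marking_def by blast
next
  fix h' j assume N': "node k h' j"
  have M': "if h \<le> h' \<and> j = l div 2 ^ h' then g j \<le> 0 else 0 < g j \<longleftrightarrow> full F h' j"
    using M N' unfolding marking_def by blast
  show "(0 < g j) = full F h' j"
  proof (cases "h \<le> h' \<and> j = l div 2 ^ h'")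
    case True
    then have "h \<le> k" using N' unfolding node_def by simp
    then have N: "node k h i" using node_ancestor[OF l] i by simp
    obtain h0 where h0: "h = Suc h0" using h by (cases h) auto
    have "node k h0 (2 * i)" "node k h0 (2 * i + 1)" using node_child N h0 by auto
    moreover have "\<not> h \<le> h0" using h0 by simp
    ultimately have "\<not> (full F h0 (2 * i) \<and> full F h0 (2 * i + 1))"
      using M children unfolding marking_def by metis
    then have "\<not> full F h i" using full_Suc h0 by simp
    then obtain t where t: "t div 2 ^ h = i" "\<not> F t" unfolding full_def using range_div by blast
    \<comment> \<open>A slot below \<open>i\<close> that is not full also lies below every ancestor
      of \<open>i\<close>, so the flags of the ancestors rightly stay off.\<close>
    have "t div 2 ^ h' = t div 2 ^ h div 2 ^ (h' - h)"
      using True by (simp add: zdiv_zmult2_eq[symmetric] power_add[symmetric])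
    also have "\<dots> = l div 2 ^ h'"
      using True unfolding t(1) i by (simp add: zdiv_zmult2_eq[symmetric] power_add[symmetric])
    finally have "t div 2 ^ h' = j" using True by simp
    then have "\<not> full F h' j" using t(2) range_div[of j h' t] unfolding full_def by blast
    then show ?thesis using M' True by auto
  next
    case False
    then show ?thesis using M' by auto
  qed
qed

text \<open>The leaf takes 2 steps, each marked ancestor 3 and the failing test 1. The second
  conjunct protects the sentinel and the trees of the other warehouses.\<close>

lemma runs_mark_full:
  fixes s :: state
  assumes b: "ints s ''b'' 0 = b" and T: "tree k (\<lambda>i. ints s ''tf'' (b + i)) F"
    and l: "ints s ''i'' 0 = l" "node k 0 l" "\<not> F l"
  shows "runs mark_full (3 * k + 3) (\<lambda>s'. tree k (\<lambda>i. ints s' ''tf'' (b + i)) (F(l := True)) \<and>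
     (\<forall>x. x \<notin> {b + 1..<b + 2 * 2 ^ k} \<longrightarrow> ints s' ''tf'' x = ints s ''tf'' x)) s"
proof (rule runsI)
  let ?test = children_full
  let ?body = "SetInt ''tf'' (IAdd (IVar ''b'') (IVar ''i'')) (IConst 1);; ''i'' ::= IHalf (IVar ''i'')"
  let ?Q = "\<lambda>s'. tree k (\<lambda>i. ints s' ''tf'' (b + i)) (F(l := True)) \<and>
     (\<forall>x. x \<notin> {b + 1..<b + 2 * 2 ^ k} \<longrightarrow> ints s' ''tf'' x = ints s ''tf'' x)"
  define I where "I s' c \<longleftrightarrow> (\<exists>h. 1 \<le> h \<and> marking k (F(l := True)) l h (\<lambda>i. ints s' ''tf'' (b + i)) \<and>
     ints s' ''i'' 0 = l div 2 ^ h \<and> ints s' ''b'' 0 = b \<and>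
     (\<forall>x. x \<notin> {b + 1..<b + 2 * 2 ^ k} \<longrightarrow> ints s' ''tf'' x = ints s ''tf'' x) \<and>
     3 * (Suc k - h) + 1 \<le> c)" for s' :: state and c :: nat
  have upd: "(\<lambda>i. (t(b + j := 1)) (b + i)) = (\<lambda>i. t (b + i))(j := 1)" for t :: "int \<Rightarrow> int" and j
    by auto
  have inside: "b + j \<in> {b + 1..<b + 2 * 2 ^ k}" if "node k h j" for h j
  proof -
    have "(2::int) ^ (k - h) \<le> 2 ^ k" by (rule power_increasing) auto
    moreover have "j < 2 * 2 ^ (k - h)" using that unfolding node_def by blast
    ultimately have "j < 2 * 2 ^ k" by linarith
    then show ?thesis using node_positive[OF that] by auto
  qed
  have loop: "wp (While ?test ?body) (\<lambda>s' _. ?Q s') s1 c1" if "I s1 c1" for s1 c1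
  proof (rule wp_While[where I = I])
    fix s' c
    assume "I s' c" and t: "bval ?test s'"
    then obtain h where h: "1 \<le> h" "marking k (F(l := True)) l h (\<lambda>i. ints s' ''tf'' (b + i))"
      "ints s' ''i'' 0 = l div 2 ^ h" "ints s' ''b'' 0 = b"
      "\<forall>x. x \<notin> {b + 1..<b + 2 * 2 ^ k} \<longrightarrow> ints s' ''tf'' x = ints s ''tf'' x"
      "3 * (Suc k - h) + 1 \<le> c"
      unfolding I_def by blast
    have "0 < ints s' ''tf'' (b + 2 * (l div 2 ^ h))" "0 < ints s' ''tf'' (b + (2 * (l div 2 ^ h) + 1))"
      using t h(3,4) by (simp_all add: mult_2[symmetric] add.assoc)
    from marking_step[OF h(2) l(2) h(1) refl this]
    have step: "h \<le> k" "marking k (F(l := True)) l (Suc h) ((\<lambda>i. ints s' ''tf'' (b + i))(l div 2 ^ h := 1))"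
      by blast+
    have "Suc k - h = Suc (Suc k - Suc h)" using step(1) by simp
    then have c: "3 * (Suc k - Suc h) + 4 \<le> c" using h(6) by simp
    have "l div 2 ^ h div 2 = l div 2 ^ Suc h" by (simp add: zdiv_zmult2_eq[symmetric] mult.commute)
    moreover have "\<forall>x. x \<notin> {b + 1..<b + 2 * 2 ^ k} \<longrightarrow> ((ints s' ''tf'')(b + l div 2 ^ h := 1)) x = ints s ''tf'' x"
      using h(5) inside[OF node_ancestor[OF l(2) step(1)]] by auto
    ultimately have I': "I s3 c3" if "ints s3 ''tf'' = (ints s' ''tf'')(b + l div 2 ^ h := 1)"
      "ints s3 ''i'' 0 = l div 2 ^ h div 2" "ints s3 ''b'' 0 = b" "3 * (Suc k - Suc h) + 1 \<le> c3" for s3 c3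
      unfolding I_def that upd using h(1) step(2) that(4) by (intro exI[of _ "Suc h"] conjI) simp_all
    show "1 \<le> c \<and> wp ?body I s' (c - 1)"
      using c by (auto simp: wp_simps h(3,4) intro!: I')
  next
    fix s' c
    assume "I s' c" and t: "\<not> bval ?test s'"
    then obtain h where h: "1 \<le> h" "marking k (F(l := True)) l h (\<lambda>i. ints s' ''tf'' (b + i))"
      "ints s' ''i'' 0 = l div 2 ^ h" "ints s' ''b'' 0 = b"
      "\<forall>x. x \<notin> {b + 1..<b + 2 * 2 ^ k} \<longrightarrow> ints s' ''tf'' x = ints s ''tf'' x"
      "3 * (Suc k - h) + 1 \<le> c"
      unfolding I_def by blast
    have "\<not> (0 < ints s' ''tf'' (b + 2 * (l div 2 ^ h)) \<and> 0 < ints s' ''tf'' (b + (2 * (l div 2 ^ h) + 1)))"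
      using t h(3,4) by (simp add: mult_2[symmetric] add.assoc)
    from marking_end[OF h(2) l(2) h(1) refl this] show "1 \<le> c \<and> ?Q s'"
      using h by auto
  qed (use that in auto)
  have "marking k (F(l := True)) l 1 ((\<lambda>i. ints s ''tf'' (b + i))(l := 1))"
    by (rule marking_start[OF T l(2,3)])
  moreover have "\<forall>x. x \<notin> {b + 1..<b + 2 * 2 ^ k} \<longrightarrow> ((ints s ''tf'')(b + l := 1)) x = ints s ''tf'' x"
    using inside[OF l(2)] by auto
  ultimately have I': "I s3 c3" if "ints s3 ''tf'' = (ints s ''tf'')(b + l := 1)"
      "ints s3 ''i'' 0 = l div 2" "ints s3 ''b'' 0 = b" "3 * k + 1 \<le> c3" for s3 c3
    unfolding I_def that upd using that(4) by (intro exI[of _ 1] conjI) simp_all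
  show "wp mark_full (\<lambda>s' _. ?Q s') s (3 * k + 3)"
    unfolding mark_full_def 
    by (simp add: wp_Seq[of "SetInt _ _ _"] wp_SetInt b l(1) del: atLeastLessThan_iff)
      (rule loop, rule I', simp_all add: b)
qed

section \<open>Placing the products\<close>

definition load :: "(int \<Rightarrow> int) \<Rightarrow> (int \<Rightarrow> int) \<Rightarrow> int set \<Rightarrow> int \<Rightarrow> int \<Rightarrow> nat" where
  "load u f Q w t = card {q \<in> Q. u q = w \<and> f q = t}"

lemma sum_load:
  assumes "finite Q"
  shows "(\<Sum>t\<in>{a..<b}. load u f Q w t) = card {q \<in> Q. u q = w \<and> a \<le> f q \<and> f q < b}"
proof -
  have "{q \<in> Q. u q = w \<and> a \<le> f q \<and> f q < b} = (\<Union>t\<in>{a..<b}. {q \<in> Q. u q = w \<and> f q = t})"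
    by auto
  then show ?thesis
    unfolding load_def using assms by (simp add: card_UN_disjoint disjoint_iff)
qed

lemma load_ge:
  fixes a b d :: int
  assumes "finite Q" "a \<le> b" "\<And>t. a \<le> t \<Longrightarrow> t < b \<Longrightarrow> d \<le> int (load u f Q w t)"
  shows "d * (b - a) \<le> card {q \<in> Q. u q = w \<and> a \<le> f q \<and> f q < b}"
proof -
  have "(\<Sum>t\<in>{a..<b}. d) \<le> (\<Sum>t\<in>{a..<b}. int (load u f Q w t))"
    by (rule sum_mono) (use assms(3) in auto)
  then show ?thesis
    unfolding sum_load[OF assms(1), symmetric] using assms(2) by (simp add: mult.commute)
qed

lemma load_le:
  fixes a b d :: int
  assumes "finite Q" "a \<le> b" "\<And>t. a \<le> t \<Longrightarrow> t < b \<Longrightarrow> int (load u f Q w t) \<le> d"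
  shows "int (card {q \<in> Q. u q = w \<and> a \<le> f q \<and> f q < b}) \<le> d * (b - a)"
proof -
  have "(\<Sum>t\<in>{a..<b}. int (load u f Q w t)) \<le> (\<Sum>t\<in>{a..<b}. d)"
    by (rule sum_mono) (use assms(3) in auto)
  then show ?thesis
    unfolding sum_load[OF assms(1), symmetric] using assms(2) by (simp add: mult.commute)
qed

locale placement =
  fixes m n R T :: int and u cls D \<tau> :: "int \<Rightarrow> int"
  assumes u: "p \<in> {1..m} \<Longrightarrow> u p \<in> {0..<n}"
    and cls: "p \<in> {1..m} \<Longrightarrow> R \<le> cls p \<and> cls p < 2 * R"
    and \<tau>: "p \<in> {1..m} \<Longrightarrow> 1 \<le> \<tau> p \<and> \<tau> p \<le> T"
    and RT: "R \<le> 2 * T" "0 < R"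
    and degR: "w \<in> {0..<n} \<Longrightarrow> card (members m u w) \<le> D w * R"
    and degT: "w \<in> {0..<n} \<Longrightarrow> card (members m u w) \<le> D w * T"
    and class_load: "w \<in> {0..<n} \<Longrightarrow> card (class_of m u cls w c) \<le> D w"
begin

text \<open>\<open>cls q - R\<close> is the round of \<open>q\<close>, counted from
  \<open>0\<close>. The summand \<open>1\<close> makes the arrival strictly later than the round,
  since a product leaving at \<open>\<theta>\<close> and one arriving at \<open>\<theta>\<close>
  both occupy the warehouse at this time.\<close>

definition release :: "int \<Rightarrow> int" where
  "release q = max 0 (cls q - R + 1 - \<tau> q)"

lemma release_bounds: "q \<in> {1..m} \<Longrightarrow> 0 \<le> release q \<and> release q \<le> cls q - R \<and> release q < R"
  using cls[of q] \<tau>[of q] unfolding release_def by auto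

lemma D_positive:
  assumes "p \<in> {1..m}"
  shows "1 \<le> D (u p)"
proof -
  have "p \<in> members m u (u p)" using assms by (simp add: members_def)
  then have "0 < card (members m u (u p))" by (auto simp: card_gt_0_iff)
  then have "0 < D (u p) * R" using degR[OF u[OF assms]] by linarith
  then show ?thesis using RT(2) by (simp add: zero_less_mult_iff)
qed

definition placed :: "int set \<Rightarrow> (int \<Rightarrow> int) \<Rightarrow> bool" where
  "placed Q f \<longleftrightarrow> Q \<subseteq> {1..m} \<and> (\<forall>w\<in>{0..<n}. \<forall>t. load u f Q w t \<le> D w) \<and>
     (\<forall>q\<in>Q. release q \<le> f q \<and> f q < 2 * R \<and> f q + \<tau> q \<le> 2 * T \<and>
        (\<forall>t. release q \<le> t \<longrightarrow> t < f q \<longrightarrow> D (u q) \<le> load u f Q (u q) t))"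

lemma placed_empty: "(\<And>w. w \<in> {0..<n} \<Longrightarrow> 0 \<le> D w) \<Longrightarrow> placed {} f"
  unfolding placed_def load_def by auto

lemma others:
  assumes "Q \<subseteq> {1..m}" "q \<in> {1..m}" "q \<notin> Q"
  shows "card {q' \<in> Q. u q' = u q} < card (members m u (u q))"
proof (rule psubset_card_mono[OF finite_members])
  have "q \<in> members m u (u q)" "q \<notin> {q' \<in> Q. u q' = u q}" using assms by (auto simp: members_def)
  moreover have "{q' \<in> Q. u q' = u q} \<subseteq> members m u (u q)" using assms(1) by (auto simp: members_def)
  ultimately show "{q' \<in> Q. u q' = u q} \<subset> members m u (u q)" by blast
qed

text \<open>From a release before \<open>R\<close> there are more than \<open>R\<close> slots up to
  \<open>2 * R\<close>; to fill them would take more than \<open>D (u q) * R\<close> products. Hence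
  \<open>2 * R\<close> leaves suffice for the trees.\<close>

lemma free_slot:
  assumes Q: "placed Q f" and q: "q \<in> {1..m}" "q \<notin> Q"
  shows "\<exists>t. release q \<le> t \<and> t < 2 * R \<and> load u f Q (u q) t < D (u q)"
proof (rule ccontr)
  assume "\<not> ?thesis"
  then have full: "D (u q) \<le> load u f Q (u q) t" if "release q \<le> t" "t < 2 * R" for t
    using that by force
  have QS: "Q \<subseteq> {1..m}" using Q unfolding placed_def by blast
  then have fin: "finite Q" by (rule finite_subset) simp
  have rel: "release q < R" using release_bounds q by blast
  have "D (u q) * (2 * R - release q) \<le> card {q' \<in> Q. u q' = u q \<and> release q \<le> f q' \<and> f q' < 2 * R}"
    by (rule load_ge) (use fin rel RT full in auto)
  also have "\<dots> \<le> card {q' \<in> Q. u q' = u q}" using fin by (auto intro: card_mono)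
  also have "\<dots> < card (members m u (u q))" using others[OF QS q] by simp
  also have "\<dots> \<le> D (u q) * R" using degR u q by blast
  finally have "2 * R - release q < R" using D_positive[OF q(1)] by simp
  then show False using rel by simp
qed

text \<open>If \<open>q\<close> were late, the slots from its release to
  \<open>2 * T - \<tau> q\<close> would be full. For release \<open>0\<close> these are more than
  \<open>T\<close> slots, but fewer than \<open>D (u q) * T\<close> products have been placed at
  this source. Otherwise they number \<open>2 * T - (cls q - R)\<close>, while the products placed
  there belong to the rounds from that of \<open>q\<close> on and, together with \<open>q\<close>,
  number at most \<open>D (u q) * (2 * R - cls q)\<close>. This contradicts
  \<open>R \<le> 2 * T\<close>.\<close>

lemma deadline:
  assumes Q: "placed Q f" and q: "q \<in> {1..m}" "q \<notin> Q"
    and order: "\<And>q'. q' \<in> Q \<Longrightarrow> cls q \<le> cls q'"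
    and full: "\<And>t'. release q \<le> t' \<Longrightarrow> t' < t \<Longrightarrow> D (u q) \<le> load u f Q (u q) t'"
  shows "t + \<tau> q \<le> 2 * T"
proof (rule ccontr)
  assume "\<not> ?thesis"
  then have late: "2 * T - \<tau> q + 1 \<le> t" by simp
  have QS: "Q \<subseteq> {1..m}" using Q unfolding placed_def by blast
  then have fin: "finite Q" by (rule finite_subset) simp
  note \<tau>q = \<tau>[OF q(1)] and Dq = D_positive[OF q(1)] and cq = cls[OF q(1)]
  have "D (u q) * (2 * T - \<tau> q + 1 - release q) \<le>
      card {q' \<in> Q. u q' = u q \<and> release q \<le> f q' \<and> f q' < 2 * T - \<tau> q + 1}"
    by (rule load_ge) (use fin full late \<tau>q cq RT in \<open>auto simp: release_def\<close>)
  also have "\<dots> \<le> card {q' \<in> Q. u q' = u q}" using fin by (auto intro: card_mono)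
  finally have le: "D (u q) * (2 * T - \<tau> q + 1 - release q) \<le> card {q' \<in> Q. u q' = u q}" .
  show False
  proof (cases "release q = 0")
    case True
    have "card {q' \<in> Q. u q' = u q} < card (members m u (u q))" by (rule others[OF QS q])
    also have "\<dots> \<le> D (u q) * T" using degT u q by blast
    finally have "D (u q) * (2 * T - \<tau> q + 1) < D (u q) * T" using le True by simp
    then have "2 * T - \<tau> q + 1 < T" using Dq by simp
    then show False using \<tau>q by simp
  next
    case False
    then have rel: "release q = cls q - R + 1 - \<tau> q" unfolding release_def by auto
    have "card {q' \<in> Q. u q' = u q} < card {p \<in> {1..m}. u p = u q \<and> cls q \<le> cls p \<and> cls p < 2 * R}"
    proof (rule psubset_card_mono)
      let ?B = "{p \<in> {1..m}. u p = u q \<and> cls q \<le> cls p \<and> cls p < 2 * R}"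
      show "finite ?B" by (rule finite_subset[of _ "{1..m}"]) auto
      have "q' \<in> ?B" if "q' \<in> Q" "u q' = u q" for q'
      proof -
        have "q' \<in> {1..m}" using QS that by blast
        then show ?thesis using cls[of q'] order[OF that(1)] that(2) by simp
      qed
      moreover have "q \<in> ?B" using q cq by simp
      ultimately show "{q' \<in> Q. u q' = u q} \<subset> ?B" using q(2) by blast
    qed
    also have "\<dots> \<le> D (u q) * (2 * R - cls q)"
    proof (rule load_le)
      fix c
      show "load u cls {1..m} (u q) c \<le> D (u q)"
        using class_load[OF u[OF q(1)]] unfolding load_def class_of_def by simp
    qed (use cq in auto)
    finally have "D (u q) * (2 * T - \<tau> q + 1 - release q) < D (u q) * (2 * R - cls q)" using le by simp
    then have "2 * T - \<tau> q + 1 - release q < 2 * R - cls q" using Dq by simp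
    then show False using rel RT by simp
  qed
qed

lemma load_insert:
  assumes "finite Q" "q \<notin> Q"
  shows "load u (f(q := t)) (insert q Q) w t' = load u f Q w t' + (if u q = w \<and> t' = t then 1 else 0)"
proof -
  have "{q' \<in> insert q Q. u q' = w \<and> (f(q := t)) q' = t'} =
     (if u q = w \<and> t' = t then insert q {q' \<in> Q. u q' = w \<and> f q' = t'} else {q' \<in> Q. u q' = w \<and> f q' = t'})"
    using assms(2) by auto
  then show ?thesis using assms unfolding load_def by simp
qed

text \<open>Loads only grow, so slots once full stay full, and the products placed earlier keep
  their guarantee.\<close>

lemma placed_insert:
  assumes Q: "placed Q f" and q: "q \<in> {1..m}" "q \<notin> Q"
    and order: "\<And>q'. q' \<in> Q \<Longrightarrow> cls q \<le> cls q'"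
    and t: "release q \<le> t" "t < 2 * R" "load u f Q (u q) t < D (u q)"
    and full: "\<And>t'. release q \<le> t' \<Longrightarrow> t' < t \<Longrightarrow> D (u q) \<le> load u f Q (u q) t'"
  shows "placed (insert q Q) (f(q := t))"
proof -
  have QS: "Q \<subseteq> {1..m}" using Q unfolding placed_def by blast
  then have fin: "finite Q" by (rule finite_subset) simp
  note load' = load_insert[OF fin q(2), of f t]
  have "t + \<tau> q \<le> 2 * T" by (rule deadline[OF Q q order full])
  moreover have "load u f Q w t' \<le> load u (f(q := t)) (insert q Q) w t'" for w t'
    unfolding load' by simp
  ultimately show ?thesis
    unfolding placed_def
  proof (intro conjI ballI allI impI)
    fix w t' assume w: "w \<in> {0..<n}"
    then have "load u f Q w t' \<le> D w" using Q unfolding placed_def by blast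
    then show "load u (f(q := t)) (insert q Q) w t' \<le> D w" unfolding load' using t(3) by auto
  next
    fix q' t' assume mono: "\<And>w t'. load u f Q w t' \<le> load u (f(q := t)) (insert q Q) w t'"
      and *: "q' \<in> insert q Q" "release q' \<le> t'" "t' < (f(q := t)) q'"
    have "D (u q') \<le> load u f Q (u q') t'"
    proof (cases "q' = q")
      case True
      then show ?thesis using full * by simp
    next
      case False
      then show ?thesis using Q * unfolding placed_def by simp
    qed
    then show "D (u q') \<le> load u (f(q := t)) (insert q Q) (u q') t'"
      using mono[of "u q'" t'] by linarith
  next
    fix q' assume "t + \<tau> q \<le> 2 * T" "q' \<in> insert q Q"
    then show "release q' \<le> (f(q := t)) q'" "(f(q := t)) q' < 2 * R" "(f(q := t)) q' + \<tau> q' \<le> 2 * T"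
      using Q t unfolding placed_def by (cases "q' = q"; simp)+
  qed (use QS q in auto)
qed

text \<open>The placement never falls behind the classes: after the last slot before \<open>\<theta>\<close> that is not full,
  it works at full rate, and up to this slot nothing that has been released is pending.\<close>

lemma placed_dominates:
  assumes P: "placed {1..m} f" and w: "w \<in> {0..<n}"
  shows "card {p \<in> {1..m}. u p = w \<and> cls p - R < \<theta>} \<le> card {p \<in> {1..m}. u p = w \<and> f p < \<theta>}"
proof (cases "0 \<le> \<theta>")
  case False
  then have "{p \<in> {1..m}. u p = w \<and> cls p - R < \<theta>} = {}" using cls by force
  then show ?thesis by (metis card.empty le0)
next
  case True
  let ?Q = "{1..m}"
  \<comment> \<open>\<open>s\<close> is the last slot before \<open>\<theta>\<close> that is not
    full; \<open>-1\<close> stands for the case that all of them are full.\<close>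
  have "\<exists>s. -1 \<le> s \<and> s < \<theta> \<and> (\<forall>t. s < t \<longrightarrow> t < \<theta> \<longrightarrow> D w \<le> load u f ?Q w t) \<and>
     (0 \<le> s \<longrightarrow> load u f ?Q w s < D w)"
    using True
  proof (induction \<theta> rule: int_ge_induct)
    case base
    show ?case by (rule exI[of _ "-1"]) auto
  next
    case (step \<theta>)
    then obtain s where s: "-1 \<le> s" "s < \<theta>" "\<forall>t. s < t \<longrightarrow> t < \<theta> \<longrightarrow> D w \<le> load u f ?Q w t"
      "0 \<le> s \<longrightarrow> load u f ?Q w s < D w" by blast
    show ?case
    proof (cases "D w \<le> load u f ?Q w \<theta>")
      case True
      have "\<forall>t. s < t \<longrightarrow> t < \<theta> + 1 \<longrightarrow> D w \<le> load u f ?Q w t"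
        using s(3) True by (metis zless_add1_eq)
      then show ?thesis using s by (intro exI[of _ s]) auto
    next
      case False
      then show ?thesis using step(1) by (intro exI[of _ \<theta>]) auto
    qed
  qed
  then obtain s where s: "-1 \<le> s" "s < \<theta>" "\<And>t. s < t \<Longrightarrow> t < \<theta> \<Longrightarrow> D w \<le> load u f ?Q w t"
    "0 \<le> s \<Longrightarrow> load u f ?Q w s < D w" by blast
  have split: "card {p \<in> ?Q. u p = w \<and> g p < \<theta>} =
     card {p \<in> ?Q. u p = w \<and> g p \<le> s} + card {p \<in> ?Q. u p = w \<and> s + 1 \<le> g p \<and> g p < \<theta>}" for g :: "int \<Rightarrow> int"
  proof -
    have "{p \<in> ?Q. u p = w \<and> g p < \<theta>} =
      {p \<in> ?Q. u p = w \<and> g p \<le> s} \<union> {p \<in> ?Q. u p = w \<and> s + 1 \<le> g p \<and> g p < \<theta>}"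
      using s(2) by auto
    moreover have "card ({p \<in> ?Q. u p = w \<and> g p \<le> s} \<union> {p \<in> ?Q. u p = w \<and> s + 1 \<le> g p \<and> g p < \<theta>}) =
      card {p \<in> ?Q. u p = w \<and> g p \<le> s} + card {p \<in> ?Q. u p = w \<and> s + 1 \<le> g p \<and> g p < \<theta>}"
      by (rule card_Un_disjoint) (auto intro: finite_subset[of _ ?Q])
    ultimately show ?thesis by (simp only:)
  qed
  have "{p \<in> ?Q. u p = w \<and> cls p - R \<le> s} \<subseteq> {p \<in> ?Q. u p = w \<and> f p \<le> s}"
  proof
    fix p assume "p \<in> {p \<in> ?Q. u p = w \<and> cls p - R \<le> s}"
    then have p: "p \<in> ?Q" "u p = w" "cls p - R \<le> s" by auto
    then have "release p \<le> s" "0 \<le> s" using release_bounds[OF p(1)] by linarith+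
    \<comment> \<open>Otherwise \<open>s\<close>, lying between the release of \<open>p\<close> and
      its slot, would be full.\<close>
    then have "\<not> s < f p" using P p s(4) unfolding placed_def by force
    then show "p \<in> {p \<in> ?Q. u p = w \<and> f p \<le> s}" using p by auto
  qed
  then have "card {p \<in> ?Q. u p = w \<and> cls p - R \<le> s} \<le> card {p \<in> ?Q. u p = w \<and> f p \<le> s}"
    by (intro card_mono) (auto intro: finite_subset[of _ ?Q])
  moreover have "int (card {p \<in> ?Q. u p = w \<and> s + 1 \<le> cls p - R \<and> cls p - R < \<theta>}) \<le> D w * (\<theta> - (s + 1))"
  proof (rule load_le)
    fix t
    have "load u (\<lambda>p. cls p - R) ?Q w t = card (class_of m u cls w (t + R))"
      unfolding load_def class_of_def by (rule arg_cong[where f = card]) auto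
    then show "int (load u (\<lambda>p. cls p - R) ?Q w t) \<le> D w" using class_load[OF w] by simp
  qed (use s in auto)
  moreover have "D w * (\<theta> - (s + 1)) \<le> int (card {p \<in> ?Q. u p = w \<and> s + 1 \<le> f p \<and> f p < \<theta>})"
    by (rule load_ge) (use s in auto)
  ultimately show ?thesis
    unfolding split[of f] split[of "\<lambda>p. cls p - R"] by linarith
qed

end

section \<open>Implementation of the placement\<close>

primrec linked :: "(int \<Rightarrow> int) \<Rightarrow> int list \<Rightarrow> int \<Rightarrow> bool" where
  "linked nx [] p \<longleftrightarrow> p = 0"
| "linked nx (x # xs) p \<longleftrightarrow> p = x \<and> linked nx xs (nx x)"

lemma linked_update: "x \<notin> set xs \<Longrightarrow> linked (nx(x := y)) xs p \<longleftrightarrow> linked nx xs p"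
  by (induction xs arbitrary: p) auto

definition bucket :: com where
  "bucket = range_loop ''p'' (IConst 1) (IAdd (IVar ''products'') (IConst 1))
     (SetInt ''nx'' (IVar ''p'') (ICell ''hd'' (ICell ''cls'' (IVar ''p'')));;
      SetInt ''hd'' (ICell ''cls'' (IVar ''p'')) (IVar ''p''))"

lemma mods_bucket: "mods bucket = {''p'', ''nx'', ''hd''}"
  by (auto simp: bucket_def)

text \<open>One list per class replaces sorting, so that the decreasing order of the rounds is
  available in linear time. As products are numbered from \<open>1\<close>, the value
  \<open>0\<close> can end a list.\<close>

lemma runs_bucket:
  fixes s :: state
  assumes m: "ints s ''products'' 0 = m" "0 \<le> m" and hd: "ints s ''hd'' = (\<lambda>_. 0)"
  shows "runs bucket (4 * nat m + 2) (\<lambda>s'. \<forall>c. \<exists>xs. linked (ints s' ''nx'') xs (ints s' ''hd'' c) \<and>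
     distinct xs \<and> set xs = {p \<in> {1..m}. ints s ''cls'' p = c}) s"
proof -
  let ?cls = "ints s ''cls''"
  define Inv where "Inv i s' \<longleftrightarrow> (\<forall>c. \<exists>xs. linked (ints s' ''nx'') xs (ints s' ''hd'' c) \<and>
     distinct xs \<and> set xs = {p \<in> {1..<i}. ?cls p = c})" for i and s' :: state
  have "runs bucket ((2 + 2) * nat (m + 1 - 1) + 2) (Inv (m + 1)) s"
    unfolding bucket_def
  proof (rule runs_range_loop)
    show "Inv 1 (set_var ''p'' 1 s)"
      unfolding Inv_def using hd by (auto intro!: exI[of _ "[]"])
  next
    fix i and s' :: state
    let ?body = "SetInt ''nx'' (IVar ''p'') (ICell ''hd'' (ICell ''cls'' (IVar ''p'')));;
      SetInt ''hd'' (ICell ''cls'' (IVar ''p'')) (IVar ''p'')"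
    assume i: "1 \<le> i" "i < m + 1" "ints s' ''p'' 0 = i" and I: "Inv i s'"
      and fr: "frame (insert ''p'' (mods ?body)) s s'"
    have cls: "ints s' ''cls'' = ?cls" using frame_ints[OF fr, of "''cls''"] by simp
    have step: "Inv (i + 1) s3" if "ints s3 ''nx'' = (ints s' ''nx'')(i := ints s' ''hd'' (?cls i))"
      "ints s3 ''hd'' = (ints s' ''hd'')(?cls i := i)" for s3
      unfolding Inv_def that
    proof
      fix c
      obtain xs where xs: "linked (ints s' ''nx'') xs (ints s' ''hd'' c)" "distinct xs"
        "set xs = {p \<in> {1..<i}. ?cls p = c}"
        using I unfolding Inv_def by blast
      have ixs: "i \<notin> set xs" using xs(3) by auto
      have ins: "{1..<i + 1} = insert i {1..<i}" using i by auto
      show "\<exists>xs. linked ((ints s' ''nx'')(i := ints s' ''hd'' (?cls i))) xs (((ints s' ''hd'')(?cls i := i)) c) \<and>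
        distinct xs \<and> set xs = {p \<in> {1..<i + 1}. ?cls p = c}"
      proof (cases "?cls i = c")
        case True
        then show ?thesis
          using xs ixs unfolding ins by (intro exI[of _ "i # xs"]) (auto simp: linked_update)
      next
        case False
        then show ?thesis
          using xs ixs unfolding ins by (intro exI[of _ xs]) (auto simp: linked_update)
      qed
    qed
    show "runs ?body 2 (\<lambda>s''. Inv (i + 1) (set_var ''p'' (i + 1) s'')) s'"
      by (intro runsI) (auto simp: wp_simps i(3) cls intro!: step)
  qed (use m in \<open>auto simp: frame_def\<close>)
  moreover have "{1..<m + 1} = {1..m}" by auto
  ultimately show ?thesis unfolding Inv_def by simp
qed

text \<open>Relative to the base of a warehouse, \<open>tf\<close> contains the flags of its segment tree and \<open>ct\<close> the
  numbers of products in its slots, addressed by the leaves.\<close>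

abbreviation store_product :: "com" where
  "store_product \<equiv>
     SetInt ''f'' (IVar ''p'') (ISub (IVar ''i'') (IVar ''S''));;
     SetInt ''ct'' (IAdd (IVar ''b'') (IVar ''i'')) (IAdd (ICell ''ct'' (IAdd (IVar ''b'') (IVar ''i''))) (IConst 1));;
     If (ILess (ICell ''ct'' (IAdd (IVar ''b'') (IVar ''i''))) (ICell ''dd'' (ICell ''u'' (IVar ''p''))))
       Skip mark_full"

definition place :: com where
  "place =
     ''i'' ::= ISub (IAdd (ISub (IVar ''c'') (IVar ''R'')) (IConst 1)) (ICell ''transit'' (ISub (IVar ''p'') (IConst 1)));;
     If (ILess (IVar ''i'') (IConst 0)) (''i'' ::= IConst 0) Skip;;
     ''i'' ::= IAdd (IVar ''i'') (IVar ''S'');;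
     ''b'' ::= ICell ''at'' (IAdd (IVar ''p'') (IVar ''p''));;
     find_slot;;
     store_product"

lemma mods_place: "mods place = {''i'', ''b'', ''f'', ''ct'', ''tf''}"
  by (auto simp: place_def mods_find_slot mods_mark_full)

lemma tree_cong:
  assumes "tree k g F" "\<And>i. 0 \<le> i \<Longrightarrow> i < 2 * 2 ^ k \<Longrightarrow> g' i = g i"
  shows "tree k g' F"
proof -
  have "0 \<le> i \<and> i < 2 * 2 ^ k" if "node k h i" for h i
  proof -
    have "(2::int) ^ (k - h) \<le> 2 ^ k" by (rule power_increasing) auto
    moreover have "i < 2 * 2 ^ (k - h)" using that unfolding node_def by blast
    ultimately show ?thesis using node_positive[OF that] by linarith
  qed
  then show ?thesis using assms unfolding tree_def by simp
qed

lemma tree_empty: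
  assumes "\<And>t. \<not> F t"
  shows "tree k (\<lambda>_. 0) F"
proof -
  have "i * 2 ^ h < (i + 1) * 2 ^ h" for i :: int and h :: nat by (simp add: algebra_simps)
  then have "\<not> full F h i" for h i using assms unfolding full_def by blast
  then show ?thesis unfolding tree_def by simp
qed

text \<open>A tree with \<open>2 * R\<close> leaves occupies the cells \<open>0\<close> to
  \<open>4 * R - 1\<close> of its block, whence the lower bound for the stride.\<close>

locale placement_store = placement +
  fixes st :: int and k :: nat
  assumes k: "2 * R = 2 ^ k" and st: "4 * R \<le> st"
begin

text \<open>Leaf \<open>t\<close> stands for slot \<open>t - 2 * R\<close>. The trees are restricted
  to \<open>1 \<le> D w\<close>, because for \<open>D w = 0\<close> all slots would count as full
  from the start, although no flag is set; by \<open>D_positive\<close> no product leaves such a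
  warehouse.\<close>

definition store :: "int set \<Rightarrow> state \<Rightarrow> bool" where
  "store Q s \<longleftrightarrow> placed Q (ints s ''f'') \<and>
     (\<forall>w. \<forall>t\<in>{0..<2 * R}. ints s ''ct'' (st * w + (2 * R + t)) = load u (ints s ''f'') Q w t) \<and>
     (\<forall>w\<in>{0..<n}. 1 \<le> D w \<longrightarrow>
        tree k (\<lambda>i. ints s ''tf'' (st * w + i)) (\<lambda>t. D w \<le> load u (ints s ''f'') Q w (t - 2 * R)))"

definition inputs :: "state \<Rightarrow> bool" where
  "inputs s \<longleftrightarrow> ints s ''R'' 0 = R \<and> ints s ''S'' 0 = 2 * R \<and>
     (\<forall>p\<in>{1..m}. ints s ''at'' (2 * p) = st * u p \<and> ints s ''u'' p = u p \<and>
        ints s ''transit'' (p - 1) = \<tau> p) \<and>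
     (\<forall>w\<in>{0..<n}. ints s ''dd'' w = D w)"

text \<open>The search takes \<open>6 * k + 2\<close> steps, the marking, performed only when the
  slot has just become full, \<open>3 * k + 3\<close>, and the other assignments and branches
  8.\<close>

lemma runs_place:
  fixes s :: state
  assumes Q: "store Q s" and inp: "inputs s" and q: "q \<in> {1..m}" "q \<notin> Q"
    and order: "\<And>q'. q' \<in> Q \<Longrightarrow> cls q \<le> cls q'"
    and s: "ints s ''p'' 0 = q" "ints s ''c'' 0 = cls q"
  shows "runs place (9 * k + 13) (store (insert q Q)) s"
proof (rule runsI)
  define w b where "w = u q" and "b = st * w"
  define F where "F t \<longleftrightarrow> D w \<le> load u (ints s ''f'') Q w (t - 2 * R)" for t
  have w: "w \<in> {0..<n}" "1 \<le> D w" unfolding w_def using u q D_positive by blast+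
  have P: "placed Q (ints s ''f'')" using Q unfolding store_def by blast
  have QS: "Q \<subseteq> {1..m}" using P unfolding placed_def by blast
  then have fin: "finite Q" by (rule finite_subset) simp
  have R: "0 < R" using RT by blast
  have inp': "ints s ''R'' 0 = R" "ints s ''S'' 0 = 2 * R" "ints s ''at'' (2 * q) = b" "ints s ''u'' q = w"
    "ints s ''transit'' (q - 1) = \<tau> q" "ints s ''dd'' w = D w"
    using inp q(1) w unfolding inputs_def w_def b_def by blast+
  have T: "tree k (\<lambda>i. ints s ''tf'' (b + i)) F"
    using Q w unfolding store_def F_def b_def by blast
  obtain t0 where t0: "release q \<le> t0" "t0 < 2 * R" "load u (ints s ''f'') Q w t0 < D w"
    using free_slot[OF P q] unfolding w_def by blast
  define r where "r = release q"
  have r: "0 \<le> r" unfolding r_def using release_bounds[OF q(1)] by blast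
  have slot: "placed (insert q Q) ((ints s ''f'')(q := t)) \<and> load u (ints s ''f'') Q w t < D w \<and> 0 \<le> t \<and> t < 2 * R"
    if h: "r + 2 * R \<le> t + 2 * R" "t + 2 * R < 2 * 2 ^ k" "\<not> F (t + 2 * R)"
      "\<forall>t'. r + 2 * R \<le> t' \<longrightarrow> t' < t + 2 * R \<longrightarrow> F t'" for t
  proof -
    have 1: "release q \<le> t" "t < 2 * R" "load u (ints s ''f'') Q (u q) t < D (u q)"
      using h(1-3) k unfolding r_def F_def w_def by auto
    have 2: "D (u q) \<le> load u (ints s ''f'') Q (u q) t'" if t': "release q \<le> t'" "t' < t" for t'
      using spec[OF h(4), of "t' + 2 * R"] t' unfolding F_def r_def w_def by simp
    show ?thesis using placed_insert[OF P q order 1 2] 1 r unfolding w_def r_def by auto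
  qed
  have keep: "store (insert q Q) s'"
    if t: "0 \<le> t" "t < 2 * R" and pl: "placed (insert q Q) ((ints s ''f'')(q := t))"
      and f: "ints s' ''f'' = (ints s ''f'')(q := t)"
      and ct: "ints s' ''ct'' = (ints s ''ct'')(b + (2 * R + t) := ints s ''ct'' (b + (2 * R + t)) + 1)"
      and tf: "tree k (\<lambda>i. ints s' ''tf'' (b + i)) (\<lambda>x. D w \<le> load u ((ints s ''f'')(q := t)) (insert q Q) w (x - 2 * R))"
        "\<forall>x. x \<notin> {b + 1..<b + 2 * 2 ^ k} \<longrightarrow> ints s' ''tf'' x = ints s ''tf'' x" for s' t
    unfolding store_def f
  proof (intro conjI allI ballI impI)
    show "placed (insert q Q) ((ints s ''f'')(q := t))" by (fact pl)
  next
    fix w' t' assume t': "t' \<in> {0..<2 * R}"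
    have "st * w' + (2 * R + t') = b + (2 * R + t) \<longleftrightarrow> w' = w \<and> t' = t"
      using stride_unique[of st w' "2 * R + t'" w "2 * R + t"] t' t st R unfolding b_def by auto
    moreover have "ints s ''ct'' (st * w' + (2 * R + t')) = load u (ints s ''f'') Q w' t'"
      using Q t' unfolding store_def by blast
    ultimately show "ints s' ''ct'' (st * w' + (2 * R + t')) = load u ((ints s ''f'')(q := t)) (insert q Q) w' t'"
      unfolding ct load_insert[OF fin q(2)] by (auto simp: w_def)
  next
    fix w' assume w': "w' \<in> {0..<n}" "1 \<le> D w'"
    show "tree k (\<lambda>i. ints s' ''tf'' (st * w' + i))
       (\<lambda>x. D w' \<le> load u ((ints s ''f'')(q := t)) (insert q Q) w' (x - 2 * R))"
    proof (cases "w' = w")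
      case True
      then show ?thesis using tf(1) unfolding b_def by simp
    next
      case False
      have "tree k (\<lambda>i. ints s ''tf'' (st * w' + i)) (\<lambda>t. D w' \<le> load u (ints s ''f'') Q w' (t - 2 * R))"
        using Q w' unfolding store_def by blast
      then have "tree k (\<lambda>i. ints s' ''tf'' (st * w' + i)) (\<lambda>t. D w' \<le> load u (ints s ''f'') Q w' (t - 2 * R))"
      proof (rule tree_cong)
        fix i :: int assume i: "0 \<le> i" "i < 2 * 2 ^ k"
        have "st * w' + i \<notin> {b + 1..<b + 2 * 2 ^ k}"
        proof
          assume "st * w' + i \<in> {b + 1..<b + 2 * 2 ^ k}"
          then have "st * w' + i = st * w + (st * w' + i - b)" "0 \<le> st * w' + i - b" "st * w' + i - b < st"
            using st unfolding b_def k[symmetric] by auto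
          then show False using stride_unique[of st w' i w "st * w' + i - b"] i False st unfolding k[symmetric] by auto
        qed
        then show "ints s' ''tf'' (st * w' + i) = ints s ''tf'' (st * w' + i)" using tf(2) by blast
      qed
      moreover have "load u ((ints s ''f'')(q := t)) (insert q Q) w' x = load u (ints s ''f'') Q w' x" for x
        unfolding load_insert[OF fin q(2)] using False by (simp add: w_def)
      ultimately show ?thesis by simp
    qed
  qed
  \<comment> \<open>Only slot \<open>t\<close> changes. As its load was below \<open>D w\<close>, it
    becomes full exactly if the new product is the \<open>D w\<close>-th one.\<close>
  have F': "(\<lambda>x. D w \<le> load u ((ints s ''f'')(q := t)) (insert q Q) w (x - 2 * R)) =
      (if int (load u (ints s ''f'') Q w t) + 1 < D w then F else F(t + 2 * R := True))"
    if "load u (ints s ''f'') Q w t < D w" for t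
    using that unfolding load_insert[OF fin q(2)] by (auto simp: F_def w_def fun_eq_iff)
  let ?tail = store_product
  have tail: "wp ?tail (\<lambda>s' _. store (insert q Q) s') s2 c2"
    if fr: "frame {''i'', ''b''} s s2" and b2: "ints s2 ''b'' 0 = b" and c2: "3 * k + 6 \<le> c2"
      and i2: "r + 2 * R \<le> ints s2 ''i'' 0" "ints s2 ''i'' 0 < 2 * 2 ^ k" "\<not> F (ints s2 ''i'' 0)"
        "\<forall>t'. r + 2 * R \<le> t' \<longrightarrow> t' < ints s2 ''i'' 0 \<longrightarrow> F t'" for s2 c2
  proof -
    define t where "t = ints s2 ''i'' 0 - 2 * R"
    have i2t: "ints s2 ''i'' 0 = t + 2 * R" unfolding t_def by simp
    from slot[OF i2[unfolded i2t]] have t: "placed (insert q Q) ((ints s ''f'')(q := t))"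
      "load u (ints s ''f'') Q w t < D w" "0 \<le> t" "t < 2 * R" by blast+
    have eq: "ints s2 a = ints s a" if "a \<notin> {''i'', ''b''}" for a using frame_ints[OF fr that] .
    have ct: "ints s ''ct'' (b + (t + 2 * R)) = load u (ints s ''f'') Q w t"
      using Q t unfolding store_def b_def by (simp add: add.commute)
    have N: "node k 0 (t + 2 * R)" unfolding node_def using t k by simp
    let ?s3 = "s2\<lparr>ints := (ints s2)(''f'' := (ints s2 ''f'')(q := t),
       ''ct'' := (ints s2 ''ct'')(b + (t + 2 * R) := int (load u (ints s ''f'') Q w t) + 1))\<rparr>"
    have mark: "runs mark_full (3 * k + 3) (store (insert q Q)) ?s3"
      if big: "\<not> int (load u (ints s ''f'') Q w t) + 1 < D w"
    proof (rule runs_mono[OF runs_mark_full[where b = b and k = k and F = F and l = "t + 2 * R"]])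
      fix s4 :: state
      assume s4: "tree k (\<lambda>i. ints s4 ''tf'' (b + i)) (F(t + 2 * R := True)) \<and>
           (\<forall>x. x \<notin> {b + 1..<b + 2 * 2 ^ k} \<longrightarrow> ints s4 ''tf'' x = ints ?s3 ''tf'' x)"
        and fr4: "frame (mods mark_full) ?s3 s4"
      show "store (insert q Q) s4"
      proof (rule keep[OF t(3,4,1)])
        show "ints s4 ''f'' = (ints s ''f'')(q := t)"
          using frame_ints[OF fr4, of "''f''"] eq by (simp add: mods_mark_full)
        show "ints s4 ''ct'' = (ints s ''ct'')(b + (2 * R + t) := ints s ''ct'' (b + (2 * R + t)) + 1)"
          using frame_ints[OF fr4, of "''ct''"] eq ct by (simp add: mods_mark_full add.commute)
        show "tree k (\<lambda>i. ints s4 ''tf'' (b + i)) (\<lambda>x. D w \<le> load u ((ints s ''f'')(q := t)) (insert q Q) w (x - 2 * R))"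
          unfolding F'[OF t(2)] using s4 big by simp
        show "\<forall>x. x \<notin> {b + 1..<b + 2 * 2 ^ k} \<longrightarrow> ints s4 ''tf'' x = ints s ''tf'' x"
          using s4 eq by simp
      qed
    qed (use T b2 eq i2 i2t N in auto)
    have nomark: "store (insert q Q) ?s3" if small: "int (load u (ints s ''f'') Q w t) + 1 < D w"
    proof (rule keep[OF t(3,4,1)])
      show "tree k (\<lambda>i. ints ?s3 ''tf'' (b + i)) (\<lambda>x. D w \<le> load u ((ints s ''f'')(q := t)) (insert q Q) w (x - 2 * R))"
        unfolding F'[OF t(2)] using T small eq by simp
    qed (use eq ct in \<open>simp_all add: add.commute\<close>)
    have "wp mark_full (\<lambda>s' _. store (insert q Q) s') ?s3 (c2 - Suc (Suc (Suc 0)))"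
      if "\<not> int (load u (ints s ''f'') Q w t) + 1 < D w"
      by (rule wp_runs[OF mark[OF that]]) (use c2 in auto)
    moreover have "Suc 0 \<le> c2" "Suc 0 \<le> c2 - Suc 0" "Suc 0 \<le> c2 - Suc (Suc 0)" "Suc 0 \<le> c2 - Suc (Suc (Suc 0))"
      using c2 by simp_all
    ultimately show ?thesis
      using nomark by (simp add: wp_simps b2 i2t eq s inp' ct)
  qed
  have find: "wp (find_slot;; ?tail) (\<lambda>s' _. store (insert q Q) s') s1 c1"
    if fr: "frame {''i'', ''b''} s s1" and s1: "ints s1 ''b'' 0 = b" "ints s1 ''i'' 0 = r + 2 * R"
      and c1: "9 * k + 8 \<le> c1" for s1 c1
  proof -
    have eq: "ints s1 a = ints s a" if "a \<notin> {''i'', ''b''}" for a using frame_ints[OF fr that] .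
    show ?thesis
      unfolding wp_Seq[of find_slot]
    proof (rule wp_runs[OF runs_find_slot[where b = b and k = k and F = F and r = "r + 2 * R" and f = "t0 + 2 * R"]])
      fix s2 c2
      assume s2: "r + 2 * R \<le> ints s2 ''i'' 0 \<and> ints s2 ''i'' 0 < 2 * 2 ^ k \<and>
           \<not> F (ints s2 ''i'' 0) \<and> (\<forall>t. r + 2 * R \<le> t \<longrightarrow> t < ints s2 ''i'' 0 \<longrightarrow> F t)"
        and fr2: "frame (mods find_slot) s1 s2" and c2: "c1 - (6 * k + 2) \<le> c2"
      show "wp ?tail (\<lambda>s' _. store (insert q Q) s') s2 c2"
      proof (rule tail)
        show "frame {''i'', ''b''} s s2"
          by (rule frame_mono[OF frame_trans[OF fr fr2]]) (simp add: mods_find_slot)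
        show "ints s2 ''b'' 0 = b" using frame_ints[OF fr2] s1 by (simp add: mods_find_slot)
        show "3 * k + 6 \<le> c2" using c1 c2 by linarith
      qed (use s2 in blast)+
    next
      show "\<not> F (t0 + 2 * R)" using t0 unfolding F_def by simp
    qed (use s1 T eq inp' k t0 r c1 in \<open>auto simp: r_def\<close>)
  qed
  have rel: "r = (if cls q - R + 1 - \<tau> q < 0 then 0 else cls q - R + 1 - \<tau> q)"
    unfolding r_def release_def by auto
  show "wp place (\<lambda>s' _. store (insert q Q) s') s (9 * k + 13)"
    unfolding place_def
    by (simp add: wp_Seq[of "SetInt _ _ _"] wp_Seq[of "If _ _ _"] wp_SetInt wp_If wp_Skip s inp' mult_2[symmetric])
      (auto intro!: find simp: rel frame_def)
qed

end

definition place_all :: com where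
  "place_all =
     ''S'' ::= IAdd (IVar ''R'') (IVar ''R'');;
     ''c'' ::= IVar ''S'';;
     While (ILess (IVar ''R'') (IVar ''c''))
      (''c'' ::= ISub (IVar ''c'') (IConst 1);;
       ''p'' ::= ICell ''hd'' (IVar ''c'');;
       While (ILess (IConst 0) (IVar ''p''))
        (place;; ''p'' ::= ICell ''nx'' (IVar ''p'')))"

lemma mods_place_all: "mods place_all = {''S'', ''c'', ''p'', ''i'', ''b'', ''f'', ''ct'', ''tf''}"
  by (auto simp: place_all_def mods_place)

context placement_store
begin

text \<open>Passing through the class numbers downwards from \<open>2 * R - 1\<close> yields the
  order required by \<open>deadline\<close>. The credit holds a fixed amount for each product not
  placed yet, namely those counted by \<open>lt c\<close> and the rest of the current list, and 4
  steps for each class left, so that empty classes are paid for as well.\<close>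

lemma runs_place_all:
  fixes s :: state
  assumes zero: "ints s ''ct'' = (\<lambda>_. 0)" "ints s ''tf'' = (\<lambda>_. 0)"
    and D: "\<And>w. w \<in> {0..<n} \<Longrightarrow> 0 \<le> D w"
    and sR: "ints s ''R'' 0 = R"
    and prods: "\<forall>p\<in>{1..m}. ints s ''at'' (2 * p) = st * u p \<and> ints s ''u'' p = u p \<and> ints s ''transit'' (p - 1) = \<tau> p"
    and dd: "\<forall>w\<in>{0..<n}. ints s ''dd'' w = D w"
    and lists: "\<forall>c. \<exists>xs. linked (ints s ''nx'') xs (ints s ''hd'' c) \<and> distinct xs \<and> set xs = {p \<in> {1..m}. cls p = c}"
  shows "runs place_all ((9 * k + 15) * nat m + 4 * nat R + 4) (\<lambda>s'. placed {1..m} (ints s' ''f'')) s"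
proof (rule runsI)
  let ?A = "9 * k + 15"
  let ?inner = "place;; ''p'' ::= ICell ''nx'' (IVar ''p'')"
  let ?body = "''c'' ::= ISub (IVar ''c'') (IConst 1);; ''p'' ::= ICell ''hd'' (IVar ''c'');;
       While (ILess (IConst 0) (IVar ''p'')) ?inner"
  define M where "M = {''S'', ''c'', ''p'', ''i'', ''b'', ''f'', ''ct'', ''tf''}"
  define ge where "ge c = {q \<in> {1..m}. c \<le> cls q}" for c
  define lt where "lt c = card {q \<in> {1..m}. cls q < c}" for c
  have R: "0 < R" using RT by blast
  have inp: "inputs s'" if "frame M s s'" "ints s' ''S'' 0 = 2 * R" for s'
    using frame_ints[OF that(1)] that(2) sR prods dd unfolding inputs_def M_def by simp
  have same: "ints s' ''R'' 0 = R" "ints s' ''hd'' = ints s ''hd''" "ints s' ''nx'' = ints s ''nx''" if "frame M s s'" for s'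
    using frame_ints[OF that] sR unfolding M_def by simp_all
  define I1 where "I1 s' a \<longleftrightarrow> (\<exists>c. ints s' ''c'' 0 = c \<and> R \<le> c \<and> c \<le> 2 * R \<and> store (ge c) s' \<and>
     frame M s s' \<and> ints s' ''S'' 0 = 2 * R \<and> ?A * lt c + 4 * nat (c - R) + 1 \<le> a)" for s' and a :: nat
  define I2 where "I2 c s' a \<longleftrightarrow> (\<exists>ys. ints s' ''c'' 0 = c \<and> store (ge c - set ys) s' \<and>
     frame M s s' \<and> ints s' ''S'' 0 = 2 * R \<and> linked (ints s ''nx'') ys (ints s' ''p'' 0) \<and> distinct ys \<and>
     set ys \<subseteq> {q \<in> {1..m}. cls q = c} \<and> ?A * (lt c + length ys) + 4 * nat (c - R) + 2 \<le> a)" for c s' and a :: nat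
  have inner: "wp (While (ILess (IConst 0) (IVar ''p'')) ?inner) I1 s1 a1"
    if "I2 c s1 a1" and c: "R \<le> c" "c \<le> 2 * R" for c s1 a1
  proof (rule wp_While[where I = "I2 c"])
    fix s' a
    assume "I2 c s' a" and b: "bval (ILess (IConst 0) (IVar ''p'')) s'"
    then obtain ys where ys: "ints s' ''c'' 0 = c" "store (ge c - set ys) s'"
       "frame M s s'" "ints s' ''S'' 0 = 2 * R" "linked (ints s ''nx'') ys (ints s' ''p'' 0)" "distinct ys"
       "set ys \<subseteq> {q \<in> {1..m}. cls q = c}" "?A * (lt c + length ys) + 4 * nat (c - R) + 2 \<le> a"
      unfolding I2_def by blast
    have "ys \<noteq> []" using b ys(5) by (cases ys) auto
    then obtain q zs where q: "ys = q # zs" by (cases ys) auto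
    have pq: "ints s' ''p'' 0 = q" "linked (ints s ''nx'') zs (ints s ''nx'' q)" using ys(5) q by auto
    have qm: "q \<in> {1..m}" "cls q = c" using ys(7) q by auto
    have a: "?A * (lt c + length zs) + 4 * nat (c - R) + 2 + ?A \<le> a" using ys(8) q by (simp add: algebra_simps)
    have ins: "insert q (ge c - set ys) = ge c - set zs"
      using qm ys(6) q unfolding ge_def by auto
    have "runs place (9 * k + 13) (store (insert q (ge c - set ys))) s'"
    proof (rule runs_place[OF ys(2) inp[OF ys(3,4)] qm(1)])
      show "q \<notin> ge c - set ys" using q by simp
      show "\<And>q'. q' \<in> ge c - set ys \<Longrightarrow> cls q \<le> cls q'" using qm unfolding ge_def by auto
    qed (use pq ys(1) qm in auto)
    then have "wp place (wp (''p'' ::= ICell ''nx'' (IVar ''p'')) (I2 c)) s' (a - 1)"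
    proof (rule wp_runs)
      fix s2 a2
      assume s2: "store (insert q (ge c - set ys)) s2" and fr: "frame (mods place) s' s2"
        and a2: "a - 1 - (9 * k + 13) \<le> a2"
      have F2: "frame M s s2"
        by (rule frame_mono[OF frame_trans[OF ys(3) fr]]) (auto simp: M_def mods_place)
      have p2: "ints s2 ''p'' 0 = q" "ints s2 ''c'' 0 = c" "ints s2 ''S'' 0 = 2 * R"
        using frame_ints[OF fr] pq ys by (simp_all add: mods_place)
      let ?s3 = "set_var ''p'' (ints s ''nx'' q) s2"
      have "store (ge c - set zs) ?s3" using s2 unfolding ins store_def by simp
      moreover have "frame M s ?s3" using F2 unfolding frame_def M_def by simp
      moreover have "?A * (lt c + length zs) + 4 * nat (c - R) + 2 \<le> a2 - 1" using a a2 by linarith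
      ultimately have "I2 c ?s3 (a2 - 1)"
        unfolding I2_def using p2 pq(2) ys(6,7) q by (intro exI[of _ zs]) simp
      moreover have "1 \<le> a2" using a a2 by linarith
      ultimately show "wp (''p'' ::= ICell ''nx'' (IVar ''p'')) (I2 c) s2 a2"
        using p2 same(3)[OF F2] by (simp add: wp_simps)
    qed (use a in linarith)
    then show "1 \<le> a \<and> wp ?inner (I2 c) s' (a - 1)" using a by (simp add: wp_Seq)
  next
    fix s' a
    assume "I2 c s' a" and b: "\<not> bval (ILess (IConst 0) (IVar ''p'')) s'"
    then obtain ys where ys: "ints s' ''c'' 0 = c" "store (ge c - set ys) s'"
       "frame M s s'" "ints s' ''S'' 0 = 2 * R" "linked (ints s ''nx'') ys (ints s' ''p'' 0)" "distinct ys"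
       "set ys \<subseteq> {q \<in> {1..m}. cls q = c}" "?A * (lt c + length ys) + 4 * nat (c - R) + 2 \<le> a"
      unfolding I2_def by blast
    have "ys = []"
    proof (cases ys)
      case (Cons q zs)
      then have "1 \<le> q" "ints s' ''p'' 0 = q" using ys(5,7) by auto
      then show ?thesis using b by simp
    qed
    then show "1 \<le> a \<and> I1 s' (a - 1)" using ys c unfolding I1_def by simp
  qed (use that in auto)
  have outer: "wp (While (ILess (IVar ''R'') (IVar ''c'')) ?body) (\<lambda>s' _. placed {1..m} (ints s' ''f'')) s1 a1"
    if "I1 s1 a1" for s1 a1
  proof (rule wp_While[where I = I1])
    fix s' a
    assume "I1 s' a" and b: "bval (ILess (IVar ''R'') (IVar ''c'')) s'"
    then obtain c where c: "ints s' ''c'' 0 = c" "R \<le> c" "c \<le> 2 * R" "store (ge c) s'"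
      "frame M s s'" "ints s' ''S'' 0 = 2 * R" "?A * lt c + 4 * nat (c - R) + 1 \<le> a"
      unfolding I1_def by blast
    have Rc: "R < c" using b same(1)[OF c(5)] c(1) by simp
    obtain xs where xs: "linked (ints s ''nx'') xs (ints s ''hd'' (c - 1))" "distinct xs"
      "set xs = {p \<in> {1..m}. cls p = c - 1}" using lists by blast
    let ?s2 = "s'\<lparr>ints := (ints s')(''c'' := (ints s' ''c'')(0 := c - 1), ''p'' := (ints s' ''p'')(0 := ints s ''hd'' (c - 1)))\<rparr>"
    have "ge (c - 1) - set xs = ge c" unfolding ge_def xs(3) by auto
    then have "store (ge (c - 1) - set xs) ?s2" using c(4) unfolding store_def by simp
    moreover have "frame M s ?s2" using c(5) unfolding frame_def M_def by simp
    moreover have "lt c = lt (c - 1) + length xs"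
    proof -
      have "{q \<in> {1..m}. cls q < c} = {q \<in> {1..m}. cls q < c - 1} \<union> set xs" unfolding xs(3) by auto
      moreover have "card ({q \<in> {1..m}. cls q < c - 1} \<union> set xs) = card {q \<in> {1..m}. cls q < c - 1} + card (set xs)"
        by (rule card_Un_disjoint) (auto simp: xs(3) intro: finite_subset[of _ "{1..m}"])
      ultimately show ?thesis unfolding lt_def using distinct_card[OF xs(2)] by simp
    qed
    then have a: "?A * (lt (c - 1) + length xs) + 4 * nat (c - 1 - R) + 2 + 3 \<le> a"
      using c(7) Rc by (simp add: nat_diff_distrib' nat_eq_iff)
    ultimately have "I2 (c - 1) ?s2 (a - 3)"
      unfolding I2_def using xs c(6) by (intro exI[of _ xs]) auto
    then have "wp (While (ILess (IConst 0) (IVar ''p'')) ?inner) I1 ?s2 (a - 3)"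
      by (rule inner) (use Rc c in auto)
    moreover have "Suc 0 \<le> a" "Suc 0 \<le> a - Suc 0" "Suc 0 \<le> a - Suc (Suc 0)" using a by simp_all
    ultimately show "1 \<le> a \<and> wp ?body I1 s' (a - 1)"
      by (simp add: wp_Seq[of "SetInt _ _ _"] wp_SetInt c(1) same[OF c(5)] numeral_3_eq_3)
  next
    fix s' a
    assume "I1 s' a" and b: "\<not> bval (ILess (IVar ''R'') (IVar ''c'')) s'"
    then obtain c where c: "ints s' ''c'' 0 = c" "R \<le> c" "c \<le> 2 * R" "store (ge c) s'"
      "frame M s s'" "ints s' ''S'' 0 = 2 * R" "?A * lt c + 4 * nat (c - R) + 1 \<le> a"
      unfolding I1_def by blast
    have "c = R" using b same(1)[OF c(5)] c(1,2) by simp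
    then have "ge c = {1..m}" unfolding ge_def using cls by auto
    then show "1 \<le> a \<and> placed {1..m} (ints s' ''f'')" using c unfolding store_def by simp
  qed (use that in auto)
  let ?s1 = "s\<lparr>ints := (ints s)(''S'' := (ints s ''S'')(0 := 2 * R), ''c'' := (ints s ''c'')(0 := 2 * R))\<rparr>"
  have ge: "ge (2 * R) = {}" unfolding ge_def using cls by force
  have lt: "lt (2 * R) = nat m"
  proof -
    have "{q \<in> {1..m}. cls q < 2 * R} = {1..m}" using cls by auto
    then show ?thesis unfolding lt_def by simp
  qed
  have "store {} ?s1"
    unfolding store_def
  proof (intro conjI)
    show "placed {} (ints ?s1 ''f'')" by (rule placed_empty[OF D])
    show "\<forall>w. \<forall>t\<in>{0..<2 * R}. ints ?s1 ''ct'' (st * w + (2 * R + t)) = load u (ints ?s1 ''f'') {} w t"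
      using zero by (simp add: load_def)
    show "\<forall>w\<in>{0..<n}. 1 \<le> D w \<longrightarrow>
        tree k (\<lambda>i. ints ?s1 ''tf'' (st * w + i)) (\<lambda>t. D w \<le> load u (ints ?s1 ''f'') {} w (t - 2 * R))"
      using zero tree_empty by (simp add: load_def)
  qed
  moreover have "frame M s ?s1" unfolding frame_def M_def by simp
  ultimately have "I1 ?s1 (?A * nat m + 4 * nat R + 2)"
    unfolding I1_def using R ge lt by (intro exI[of _ "2 * R"]) simp
  from outer[OF this] show "wp place_all (\<lambda>s' _. placed {1..m} (ints s' ''f'')) s (?A * nat m + 4 * nat R + 4)"
    unfolding place_all_def
    by (simp add: wp_Seq[of "SetInt _ _ _"] wp_SetInt sR mult_2[symmetric])
qed

end

section \<open>The complete placement algorithm\<close>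

definition core :: "name \<Rightarrow> name \<Rightarrow> name \<Rightarrow> com" where
  "core src snk cap = prepare src snk cap;; levels;; bucket;; place_all"

lemma mods_core: "''schedule'' \<notin> mods (core src snk cap)" "''products'' \<notin> mods (core src snk cap)"
    "''transit'' \<notin> mods (core src snk cap)"
  by (simp_all add: core_def mods_prepare mods_levels mods_bucket mods_place_all)

definition placement_result :: "int \<Rightarrow> int \<Rightarrow> int \<Rightarrow> (int \<Rightarrow> int) \<Rightarrow> (int \<Rightarrow> int) \<Rightarrow> (int \<Rightarrow> int) \<Rightarrow> (int \<Rightarrow> int) \<Rightarrow> (int \<Rightarrow> int) \<Rightarrow> bool" where
  "placement_result m n T u v D \<tau> f \<longleftrightarrow> (\<exists>R cls. placement m n R T u cls D \<tau> \<and> good_classes m u v R cls \<and>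
     placement.placed m n R T u cls D \<tau> {1..m} f)"

text \<open>Neither \<open>T\<close> nor \<open>K\<close> is known to the program. Any
  \<open>T\<close> that bounds the transit times and satisfies the degree condition may be inserted,
  in particular the optimal completion time.\<close>

lemma runs_core:
  fixes s :: state and K :: nat and m n T :: int and D :: "int \<Rightarrow> nat"
  assumes names: "src \<in> {''source'', ''sink''}" "snk \<in> {''source'', ''sink''}" "cap \<in> {''carry_out'', ''carry_in''}"
    and m: "ints s ''products'' 0 = m" "0 \<le> m" and n: "ints s ''warehouses'' 0 = n" "0 \<le> n"
    and u: "\<forall>p\<in>{1..m}. ints s src (p - 1) = u p \<and> u p \<in> {0..<n}"
    and v: "\<forall>p\<in>{1..m}. ints s snk (p - 1) = v p \<and> v p \<in> {0..<n}"
    and z: "\<forall>p\<in>{1..m}. reals s ''size'' (p - 1) = z"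
    and transit: "\<forall>p\<in>{1..m}. ints s ''transit'' (p - 1) = \<tau> p \<and> 1 \<le> \<tau> p \<and> \<tau> p \<le> T"
    and zero: "\<forall>a\<in>{''deg'', ''dd'', ''dr'', ''p1'', ''p2'', ''p3'', ''hd'', ''ct'', ''tf''}. ints s a = (\<lambda>_. 0)"
      "reals s ''acc'' = (\<lambda>_. 0)"
    and K: "m \<le> 2 ^ K" "2 ^ K \<le> max 1 (2 * m)"
    and D: "\<And>w. D w = throughput (reals s cap w) z (card (members m u w))"
    and D1: "\<And>w. w \<in> {0..<n} \<Longrightarrow> 0 < card (members m u w) \<Longrightarrow> 1 \<le> D w"
    and T: "1 \<le> T" "\<And>w. w \<in> {0..<n} \<Longrightarrow> int (card (members m u w)) \<le> int (D w) * T"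
  shows "runs (core src snk cap) (100 * (nat m + nat n + 1) * (K + 1))
    (\<lambda>s'. placement_result m n T u v (\<lambda>w. int (D w)) \<tau> (ints s' ''f'')) s"
proof -
  let ?Q = "\<lambda>s'. placement_result m n T u v (\<lambda>w. int (D w)) \<tau> (ints s' ''f'')"
  have tail: "runs (levels;; bucket;; place_all) ((71 * nat m + 5 * nat n + 15) * K + 5 * nat n + 5 +
      (4 * nat m + 2 + ((9 * (K + 1) + 15) * nat m + 8 * nat m + 8))) ?Q s1"
    if s1: "layout m (8 * m) u v s1 \<and> ints s1 ''R'' 0 = 1 \<and>
       (\<forall>p\<in>{1..m}. ints s1 ''cls'' p = 1 \<and> ints s1 ''u'' p = u p) \<and>
       (\<forall>w\<in>{0..<n}. ints s1 ''deg'' w = card (members m u w) \<and>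
          ints s1 ''dd'' w = throughput (reals s cap w) z (card (members m u w)) \<and>
          ints s1 ''dr'' w = throughput (reals s cap w) z (card (members m u w)))"
      and fr1: "frame (mods (prepare src snk cap)) s s1" for s1
  proof (rule runs_SeqI[OF runs_levels[where m = m and n = n and u = u and v = v and D = "\<lambda>w. int (D w)" and
        deg = "\<lambda>w. int (card (members m u w))" and K = K]])
    show "fresh (8 * m) 1 s1"
      using frame_ints[OF fr1] zero unfolding fresh_def mods_prepare by simp
    show "good_classes m u v 1 (ints s1 ''cls'')"
      by (rule good_classes_cong[OF good_classes_start]) (use s1 in auto)
    show "ints s1 ''warehouses'' 0 = n" using frame_ints[OF fr1] n unfolding mods_prepare by simp
    have "card (members m u w) \<le> nat m" for w
    proof -
      have "card (members m u w) \<le> card {1..m}" by (rule card_mono) (auto simp: members_def)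
      then show ?thesis by simp
    qed
    then have "int (card (members m u w)) \<le> m" for w using m(2) by (meson nat_le_iff order.trans of_nat_le_iff int_nat_eq le_nat_iff)
    then show "\<forall>w\<in>{0..<n}. ints s1 ''deg'' w = int (card (members m u w)) \<and> int (card (members m u w)) \<le> m \<and>
         (0 < int (card (members m u w)) \<longrightarrow> 1 \<le> int (D w)) \<and> 0 \<le> int (D w)"
      using s1 D1 by force
  next
    fix s2
    assume "\<exists>k\<le>K. ints s2 ''R'' 0 = 2 ^ k \<and> good_classes m u v (2 ^ k) (ints s2 ''cls'') \<and>
       (\<forall>w\<in>{0..<n}. int (card (members m u w)) \<le> int (D w) * 2 ^ k) \<and>
       (k = 0 \<or> (\<exists>w\<in>{0..<n}. int (D w) * 2 ^ k < 2 * int (card (members m u w))))"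
      and fr2: "frame (mods levels) s1 s2"
    then obtain k where lev: "k \<le> K" "ints s2 ''R'' 0 = 2 ^ k" "good_classes m u v (2 ^ k) (ints s2 ''cls'')"
       "\<forall>w\<in>{0..<n}. int (card (members m u w)) \<le> int (D w) * 2 ^ k"
       "k = 0 \<or> (\<exists>w\<in>{0..<n}. int (D w) * 2 ^ k < 2 * int (card (members m u w)))" by blast
    define R :: int where "R = 2 ^ k"
    define cls where "cls = ints s2 ''cls''"
    have eq1: "ints s1 a = ints s a" if "a \<notin> mods (prepare src snk cap)" for a using frame_ints[OF fr1 that] .
    have eq2: "ints s2 a = ints s1 a" if "a \<notin> mods levels" for a using frame_ints[OF fr2 that] .
    note eq = eq1[unfolded mods_prepare] eq2[unfolded mods_levels]
    have R0: "0 < R" unfolding R_def by simp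
    have RT: "R \<le> 2 * T"
    proof (cases "k = 0")
      case True
      then show ?thesis using T(1) unfolding R_def by simp
    next
      case False
      then obtain w where w: "w \<in> {0..<n}" "int (D w) * R < 2 * int (card (members m u w))"
        using lev(5) unfolding R_def by blast
      \<comment> \<open>The last halving was carried out because half of \<open>R\<close> did not
        suffice at \<open>w\<close>, whereas \<open>T\<close> does.\<close>
      then have "int (D w) * R < int (D w) * (2 * T)" using T(2)[OF w(1)] by linarith
      then show ?thesis by (simp add: mult_less_cancel_left)
    qed
    have Rm: "R \<le> max 1 (2 * m)"
    proof -
      have "R \<le> 2 ^ K" unfolding R_def using lev(1) by (simp add: power_increasing)
      then show ?thesis using K(2) by linarith
    qed
    have P: "placement m n R T u cls (\<lambda>w. int (D w)) \<tau>"
    proof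
      fix p assume p: "p \<in> {1..m}"
      show "u p \<in> {0..<n}" using u p by blast
      show "R \<le> cls p \<and> cls p < 2 * R" using lev(3) p unfolding good_classes_def R_def cls_def by blast
      show "1 \<le> \<tau> p \<and> \<tau> p \<le> T" using transit p by blast
    next
      fix w c assume w: "w \<in> {0..<n}"
      show "int (card (members m u w)) \<le> int (D w) * R" using lev(4) w unfolding R_def by blast
      then show "int (card (class_of m u cls w c)) \<le> int (D w)"
        using lev(3) unfolding good_classes_def R_def cls_def by blast
      show "int (card (members m u w)) \<le> int (D w) * T" using T(2) w by simp
    qed (use RT R0 in auto)
    show "runs (bucket;; place_all) (4 * nat m + 2 + ((9 * (K + 1) + 15) * nat m + 8 * nat m + 8)) ?Q s2"
    proof (rule runs_SeqI[OF runs_bucket[where m = m]])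
      show "ints s2 ''products'' 0 = m" "ints s2 ''hd'' = (\<lambda>_. 0)" using eq m zero by simp_all
    next
      fix s3
      assume lists: "\<forall>c. \<exists>xs. linked (ints s3 ''nx'') xs (ints s3 ''hd'' c) \<and>
           distinct xs \<and> set xs = {p \<in> {1..m}. ints s2 ''cls'' p = c}"
        and fr3: "frame (mods bucket) s2 s3"
      have eq3: "ints s3 a = ints s2 a" if "a \<notin> {''p'', ''nx'', ''hd''}" for a
        using frame_ints[OF fr3] that by (simp add: mods_bucket)
      show "runs place_all ((9 * (K + 1) + 15) * nat m + 8 * nat m + 8) ?Q s3"
      proof -
        \<comment> \<open>\<open>R\<close> may reach \<open>2 * m\<close> and a tree has
          \<open>4 * R\<close> cells, hence the factor 8 in the stride. Without products,
          \<open>R = 1\<close> calls for a stride of 4; as soon as there is a product, the maximum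
          is the actual stride \<open>8 * m\<close>.\<close>
        have "4 * R \<le> max 4 (8 * m)" using Rm m(2) by auto
        then interpret placement_store m n R T u cls "\<lambda>w. int (D w)" \<tau> "max 4 (8 * m)" "Suc k"
          using P unfolding placement_store_def placement_store_axioms_def R_def by simp
        have "runs place_all ((9 * Suc k + 15) * nat m + 4 * nat R + 4) (\<lambda>s'. placed {1..m} (ints s' ''f'')) s3"
        proof (rule runs_place_all)
          show "ints s3 ''R'' 0 = R" using eq3 lev(2) unfolding R_def by simp
          show "\<forall>p\<in>{1..m}. ints s3 ''at'' (2 * p) = max 4 (8 * m) * u p \<and> ints s3 ''u'' p = u p \<and> ints s3 ''transit'' (p - 1) = \<tau> p"
            using s1 eq eq3 transit unfolding layout_def by (simp add: max_def)
          show "\<forall>w\<in>{0..<n}. ints s3 ''dd'' w = int (D w)" using s1 eq eq3 D by simp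
          show "\<forall>c. \<exists>xs. linked (ints s3 ''nx'') xs (ints s3 ''hd'' c) \<and> distinct xs \<and> set xs = {p \<in> {1..m}. cls p = c}"
            using lists unfolding cls_def .
        qed (use eq eq3 zero in simp_all)
        then show ?thesis
        proof (rule runs_mono)
          have "4 * nat R \<le> 8 * nat m + 4" using Rm m(2) R0 by linarith
          moreover have "(9 * Suc k + 15) * nat m \<le> (9 * (K + 1) + 15) * nat m" using lev(1) by (intro mult_right_mono) auto
          ultimately show "(9 * Suc k + 15) * nat m + 4 * nat R + 4 \<le> (9 * (K + 1) + 15) * nat m + 8 * nat m + 8"
            by linarith
        next
          fix s4 assume "placed {1..m} (ints s4 ''f'')"
          then show "?Q s4"
            unfolding placement_result_def using P lev(3) unfolding R_def cls_def by blast
        qed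
      qed
    qed (use m in auto)
  qed (use s1 D K n in auto)
  have bound: "4 * nat n + 12 * nat m + 10 + ((71 * nat m + 5 * nat n + 15) * K + 5 * nat n + 5 +
      (4 * nat m + 2 + ((9 * (K + 1) + 15) * nat m + 8 * nat m + 8))) \<le> 100 * (nat m + nat n + 1) * (K + 1)"
    by (simp add: algebra_simps)
  show ?thesis
    unfolding core_def
    by (rule runs_SeqI[OF runs_prepare[OF names m n u v z] tail bound]) (use zero in auto)
qed

section \<open>Feasibility and reversal\<close>

lemma fits_cap_code: "0 \<le> c \<Longrightarrow> fits (cap_code c) x \<longleftrightarrow> ereal x \<le> c"
  by (cases c) (auto simp: fits_def cap_code_def)

text \<open>Among at least \<open>x\<close> fitting multipliers from \<open>1\<close> on, one is at
  least \<open>x\<close>, and a smaller amount fits as well.\<close>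

lemma throughput_fits:
  assumes "0 \<le> c" "0 \<le> z" "x \<le> throughput (cap_code c) z j"
  shows "ereal (real x * z) \<le> c"
proof (cases "x = 0")
  case False
  have "\<exists>i\<ge>x. fits (cap_code c) (real i * z)"
  proof (rule ccontr)
    assume "\<not> ?thesis"
    then have "{i \<in> {1..j}. fits (cap_code c) (real i * z)} \<subseteq> {1..<x}" by (auto simp: not_le)
    then have "throughput (cap_code c) z j \<le> card {1..<x}"
      unfolding throughput_def by (rule card_mono[rotated]) simp
    then show False using assms(3) False by simp
  qed
  then obtain i where "x \<le> i" "ereal (real i * z) \<le> c" using fits_cap_code assms(1) by blast
  moreover have "real x * z \<le> real i * z" using \<open>x \<le> i\<close> assms(2) by (simp add: mult_right_mono)
  ultimately show ?thesis by (meson ereal_less_eq(3) order.trans)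
qed (use assms in \<open>simp add: zero_ereal_def[symmetric]\<close>)

lemma fits_throughput:
  assumes "0 \<le> c" "0 \<le> z" "ereal (real x * z) \<le> c" "x \<le> j"
  shows "x \<le> throughput (cap_code c) z j"
proof -
  have "fits (cap_code c) (real i * z)" if "i \<le> x" for i
  proof -
    have "real i * z \<le> real x * z" using that assms(2) by (simp add: mult_right_mono)
    then show ?thesis using fits_cap_code[OF assms(1)] assms(3) by (meson ereal_less_eq(3) order.trans)
  qed
  then have "{1..x} \<subseteq> {i \<in> {1..j}. fits (cap_code c) (real i * z)}" using assms(4) by auto
  then have "card {1..x} \<le> throughput (cap_code c) z j"
    unfolding throughput_def by (rule card_mono[rotated]) simp
  then show ?thesis by simp
qed

text \<open>Each of the \<open>T\<close> time steps handles at most as many products as the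
  throughput. The start \<open>l\<close> is \<open>0\<close> for departures and \<open>1\<close> for
  arrivals.\<close>

lemma throughput_bound:
  fixes g :: "'a \<Rightarrow> nat"
  assumes "finite X" "0 \<le> c" "0 \<le> z" "\<And>p. p \<in> X \<Longrightarrow> l \<le> g p \<and> g p < l + T"
    and "\<And>\<theta>. ereal (real (card {p \<in> X. g p = \<theta>}) * z) \<le> c"
  shows "card X \<le> throughput (cap_code c) z (card X) * T"
proof -
  have "X = (\<Union>\<theta>\<in>{l..<l + T}. {p \<in> X. g p = \<theta>})" using assms(4) by force
  then have "card X \<le> (\<Sum>\<theta>\<in>{l..<l + T}. card {p \<in> X. g p = \<theta>})"
    using card_UN_le[of "{l..<l + T}" "\<lambda>\<theta>. {p \<in> X. g p = \<theta>}"] by simp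
  also have "\<dots> \<le> (\<Sum>\<theta>\<in>{l..<l + T}. throughput (cap_code c) z (card X))"
    by (intro sum_mono fits_throughput assms card_mono) auto
  finally show ?thesis by (simp add: mult.commute)
qed

section \<open>Time reversal\<close>

definition reverse :: "('w, 'p) reallocation \<Rightarrow> ('w, 'p) reallocation" where
  "reverse I = I\<lparr>source := sink I, sink := source I, carry_out := carry_in I, carry_in := carry_out I\<rparr>"

lemma reverse_products: "out_products (reverse I) w = in_products I w"
  "in_products (reverse I) w = out_products I w"
  by (auto simp: reverse_def out_products_def in_products_def)

lemma reverse_instance: "reallocation_instance I \<Longrightarrow> reallocation_instance (reverse I)"
  unfolding reallocation_instance_def reverse_products by (auto simp: reverse_def)

text \<open>Reflecting time at \<open>X\<close> exchanges departures and arrivals, and the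
  conditions at \<open>\<theta>\<close> become those of the reversed instance at
  \<open>X - \<theta>\<close>. Times beyond \<open>X\<close> have no counterpart: nothing is left to
  be sent and everything has arrived, which the standing assumption on incoming products
  permits.\<close>

lemma feasible_reverse:
  assumes I: "reallocation_instance I" and F: "feasible (reverse I) \<phi>"
    and X: "\<And>p. p \<in> products I \<Longrightarrow> \<phi> p + transit I p \<le> X"
  shows "feasible I (\<lambda>p. X - \<phi> p - transit I p)"
  unfolding feasible_def
proof (intro allI ballI conjI)
  fix \<theta> w assume w: "w \<in> warehouses I"
  have F': "ereal (\<Sum>p \<in> {p \<in> in_products I w. \<phi> p = \<theta>'}. psize I p) \<le> carry_in I w"
    "ereal (\<Sum>p \<in> {p \<in> out_products I w. \<phi> p + transit I p = \<theta>'}. psize I p) \<le> carry_out I w"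
    "ereal ((\<Sum>p \<in> {p \<in> in_products I w. \<phi> p \<ge> \<theta>'}. psize I p) +
       (\<Sum>p \<in> {p \<in> out_products I w. \<phi> p + transit I p \<le> \<theta>'}. psize I p)) \<le> capacity I w" for \<theta>'
    using F w unfolding feasible_def reverse_products by (auto simp: reverse_def)
  have I': "0 \<le> carry_out I w" "0 \<le> carry_in I w" "ereal (\<Sum>p \<in> in_products I w. psize I p) \<le> capacity I w"
    using I w unfolding reallocation_instance_def by auto
  have out: "p \<in> products I" if "p \<in> out_products I w" for p using that by (simp add: out_products_def)
  have inp: "p \<in> products I" if "p \<in> in_products I w" for p using that by (simp add: in_products_def)
  show "ereal (\<Sum>p \<in> {p \<in> out_products I w. X - \<phi> p - transit I p = \<theta>}. psize I p) \<le> carry_out I w"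
  proof (cases "\<theta> \<le> X")
    case True
    have "{p \<in> out_products I w. X - \<phi> p - transit I p = \<theta>} = {p \<in> out_products I w. \<phi> p + transit I p = X - \<theta>}"
      using X out True by force
    then show ?thesis using F'(2) by metis
  next
    case False
    then have "{p \<in> out_products I w. X - \<phi> p - transit I p = \<theta>} = {}" by auto
    then show ?thesis using I'(1) by (simp only: sum.empty zero_ereal_def[symmetric])
  qed
  show "ereal (\<Sum>p \<in> {p \<in> in_products I w. X - \<phi> p - transit I p + transit I p = \<theta>}. psize I p) \<le> carry_in I w"
  proof (cases "\<theta> \<le> X")
    case True
    have "{p \<in> in_products I w. X - \<phi> p - transit I p + transit I p = \<theta>} = {p \<in> in_products I w. \<phi> p = X - \<theta>}"
      using X inp True by force
    then show ?thesis using F'(1) by metis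
  next
    case False
    then have "{p \<in> in_products I w. X - \<phi> p - transit I p + transit I p = \<theta>} = {}" using X inp by force
    then show ?thesis using I'(2) by (simp only: sum.empty zero_ereal_def[symmetric])
  qed
  show "ereal ((\<Sum>p \<in> {p \<in> out_products I w. \<theta> \<le> X - \<phi> p - transit I p}. psize I p) +
      (\<Sum>p \<in> {p \<in> in_products I w. X - \<phi> p - transit I p + transit I p \<le> \<theta>}. psize I p)) \<le> capacity I w"
  proof (cases "\<theta> \<le> X")
    case True
    have "{p \<in> out_products I w. \<theta> \<le> X - \<phi> p - transit I p} = {p \<in> out_products I w. \<phi> p + transit I p \<le> X - \<theta>}"
      using X out True by force
    moreover have "{p \<in> in_products I w. X - \<phi> p - transit I p + transit I p \<le> \<theta>} = {p \<in> in_products I w. \<phi> p \<ge> X - \<theta>}"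
      using X inp True by force
    ultimately show ?thesis using F'(3)[of "X - \<theta>"] by (simp only: add.commute)
  next
    case False
    then have "{p \<in> out_products I w. \<theta> \<le> X - \<phi> p - transit I p} = {}" by auto
    moreover have "{p \<in> in_products I w. X - \<phi> p - transit I p + transit I p \<le> \<theta>} = in_products I w"
      using X inp False by force
    ultimately show ?thesis using I'(3) by (simp only: sum.empty add_0_left)
  qed
qed

section \<open>From placements to feasible schedules\<close>

lemma card_shift: "card {q \<in> {1..int N}. P (nat (q - 1))} = card {p \<in> {..<N}. P p}"
proof -
  have "bij_betw (\<lambda>p. int p + 1) {p \<in> {..<N}. P p} {q \<in> {1..int N}. P (nat (q - 1))}"
    by (rule bij_betw_byWitness[where f' = "\<lambda>q. nat (q - 1)"]) auto
  then show ?thesis by (rule bij_betw_same_card[symmetric])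
qed

text \<open>For the warehouse capacity the schedule is compared with the rounds. By
  \<open>placed_dominates\<close> at most as many products are unsent as in the rounds, and by the
  definition of \<open>release\<close> a product that has arrived by \<open>\<theta>\<close> belongs
  to a round before \<open>\<theta>\<close>. For the rounds themselves, the bound by the larger
  degree follows by summation over the classes.\<close>

lemma feasible_of_placement:
  fixes J :: "(nat, nat) reallocation" and T :: int
  defines "m \<equiv> int (card (products J))" and "n \<equiv> int (card (warehouses J))"
  defines "u \<equiv> \<lambda>p. int (source J (nat (p - 1)))" and "v \<equiv> \<lambda>p. int (sink J (nat (p - 1)))"
    and "\<tau> \<equiv> \<lambda>p. int (transit J (nat (p - 1)))"
  assumes J: "reallocation_instance J" "numbered J"
    and z: "\<forall>p\<in>products J. psize J p = z" "0 \<le> z" and inf: "\<forall>w\<in>warehouses J. carry_in J w = \<infinity>"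
    and D: "\<forall>w\<in>warehouses J. D (int w) = throughput (cap_code (carry_out J w)) z (card (members m u (int w)))"
    and P: "placement_result m n T u v (\<lambda>w. int (D w)) \<tau> f"
  defines "\<phi> \<equiv> \<lambda>p. nat (f (int p + 1))"
  shows "feasible J \<phi>" and "\<forall>p\<in>products J. f (int p + 1) = int (\<phi> p) \<and> int (\<phi> p + transit J p) \<le> 2 * T"
proof -
  obtain R cls where "placement m n R T u cls (\<lambda>w. int (D w)) \<tau>" and good: "good_classes m u v R cls"
    and placed: "placement.placed m n R T u cls (\<lambda>w. int (D w)) \<tau> {1..m} f"
    using P unfolding placement_result_def by blast
  then interpret placement m n R T u cls "\<lambda>w. int (D w)" \<tau> by blast
  obtain N where prods: "products J = {..<N}" and mN: "m = int N"
    using J(2) unfolding numbered_def m_def by blast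
  have f: "release q \<le> f q" "f q + \<tau> q \<le> 2 * T" "0 \<le> f q" "cls q - R + 1 \<le> f q + \<tau> q" if "q \<in> {1..m}" for q
  proof -
    show "release q \<le> f q" "f q + \<tau> q \<le> 2 * T" using placed that unfolding placed_def by blast+
    then show "0 \<le> f q" "cls q - R + 1 \<le> f q + \<tau> q" unfolding release_def by auto
  qed
  have pq: "int p + 1 \<in> {1..m}" if "p \<in> products J" for p
    using that unfolding prods mN by auto
  show "\<forall>p\<in>products J. f (int p + 1) = int (\<phi> p) \<and> int (\<phi> p + transit J p) \<le> 2 * T"
  proof
    fix p assume "p \<in> products J"
    from f[OF pq[OF this]] show "f (int p + 1) = int (\<phi> p) \<and> int (\<phi> p + transit J p) \<le> 2 * T"
      unfolding \<phi>_def \<tau>_def by simp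
  qed
  have out: "card {p \<in> out_products J w. Q (f (int p + 1)) (int (transit J p))} =
      card {q \<in> {1..m}. u q = int w \<and> Q (f q) (\<tau> q)}" for w Q
  proof -
    have "{q \<in> {1..m}. u q = int w \<and> Q (f q) (\<tau> q)} =
       {q \<in> {1..m}. source J (nat (q - 1)) = w \<and> Q (f (int (nat (q - 1)) + 1)) (int (transit J (nat (q - 1))))}"
      unfolding u_def \<tau>_def by auto
    moreover have "{p \<in> out_products J w. Q (f (int p + 1)) (int (transit J p))} =
       {p \<in> {..<N}. source J p = w \<and> Q (f (int p + 1)) (int (transit J p))}"
      using prods unfolding out_products_def by auto
    ultimately show ?thesis
      unfolding mN using card_shift[of N "\<lambda>p. source J p = w \<and> Q (f (int p + 1)) (int (transit J p))"]
      by simp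
  qed
  have inn: "card {p \<in> in_products J w. Q (f (int p + 1)) (int (transit J p))} =
      card {q \<in> {1..m}. v q = int w \<and> Q (f q) (\<tau> q)}" for w Q
  proof -
    have "{q \<in> {1..m}. v q = int w \<and> Q (f q) (\<tau> q)} =
       {q \<in> {1..m}. sink J (nat (q - 1)) = w \<and> Q (f (int (nat (q - 1)) + 1)) (int (transit J (nat (q - 1))))}"
      unfolding v_def \<tau>_def by auto
    moreover have "{p \<in> in_products J w. Q (f (int p + 1)) (int (transit J p))} =
       {p \<in> {..<N}. sink J p = w \<and> Q (f (int p + 1)) (int (transit J p))}"
      using prods unfolding in_products_def by auto
    ultimately show ?thesis
      unfolding mN using card_shift[of N "\<lambda>p. sink J p = w \<and> Q (f (int p + 1)) (int (transit J p))"]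
      by simp
  qed
  have size: "(\<Sum>p\<in>S. psize J p) = real (card S) * z" if "S \<subseteq> products J" for S
    using z(1) that by (simp add: subset_iff)
  have sub: "{p \<in> out_products J w. Q p} \<subseteq> products J" "{p \<in> in_products J w. Q p} \<subseteq> products J"
    "out_products J w \<subseteq> products J" "in_products J w \<subseteq> products J" for w Q
    by (auto simp: out_products_def in_products_def)
  have \<phi>: "int (\<phi> p) = f (int p + 1)" if "p \<in> products J" for p
    using f(3)[OF pq[OF that]] unfolding \<phi>_def by simp
  show "feasible J \<phi>"
    unfolding feasible_def
  proof (intro allI ballI conjI)
    fix \<theta> w assume w: "w \<in> warehouses J"
    have "w \<in> {..<card (warehouses J)}" using w J(2) unfolding numbered_def by blast
    then have wn: "int w \<in> {0..<n}" unfolding n_def by simp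
    have c: "0 \<le> carry_out J w" "ereal (\<Sum>p \<in> out_products J w. psize J p) \<le> capacity J w"
      "ereal (\<Sum>p \<in> in_products J w. psize J p) \<le> capacity J w"
      using J(1) w unfolding reallocation_instance_def by blast+
    show "ereal (\<Sum>p \<in> {p \<in> out_products J w. \<phi> p = \<theta>}. psize J p) \<le> carry_out J w"
    proof -
      have "{p \<in> out_products J w. \<phi> p = \<theta>} = {p \<in> out_products J w. f (int p + 1) = int \<theta>}"
        using \<phi> sub(3) by force
      then have "card {p \<in> out_products J w. \<phi> p = \<theta>} = load u f {1..m} (int w) (int \<theta>)"
        using out[of w "\<lambda>x _. x = int \<theta>"] unfolding load_def by simp
      also have "\<dots> \<le> D (int w)" using placed wn unfolding placed_def by force
      finally show ?thesis
        unfolding size[OF sub(1)] using throughput_fits[OF c(1) z(2)] D w by metis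
    qed
    show "ereal (\<Sum>p \<in> {p \<in> in_products J w. \<phi> p + transit J p = \<theta>}. psize J p) \<le> carry_in J w"
      using inf w by simp
    define a where "a = card (members m u (int w))"
    define b where "b = card (members m v (int w))"
    have a: "card (out_products J w) = a"
      using out[of w "\<lambda>_ _. True"] unfolding a_def members_def by simp
    have b: "card (in_products J w) = b"
      using inn[of w "\<lambda>_ _. True"] unfolding b_def members_def by simp
    define below where "below x g = card {q \<in> {1..m}. x q = int w \<and> g q < int \<theta>}" for x g :: "int \<Rightarrow> int"
    define above where "above x g = card {q \<in> {1..m}. x q = int w \<and> int \<theta> \<le> g q}" for x g :: "int \<Rightarrow> int"
    have split: "card (members m x (int w)) = below x g + above x g" for x g
    proof -
      have "members m x (int w) = {q \<in> {1..m}. x q = int w \<and> g q < int \<theta>} \<union> {q \<in> {1..m}. x q = int w \<and> int \<theta> \<le> g q}"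
        unfolding members_def by auto
      moreover have "card ({q \<in> {1..m}. x q = int w \<and> g q < int \<theta>} \<union> {q \<in> {1..m}. x q = int w \<and> int \<theta> \<le> g q}) =
        below x g + above x g"
        unfolding below_def above_def by (rule card_Un_disjoint) (auto intro: finite_subset[of _ "{1..m}"])
      ultimately show ?thesis by simp
    qed
    let ?\<kappa> = "\<lambda>q. cls q - R"
    have class_sum: "(\<Sum>c\<in>{c0..<c1}. card (class_of m x cls (int w) c)) = card {q \<in> {1..m}. x q = int w \<and> c0 \<le> cls q \<and> cls q < c1}"
      for x c0 c1
    proof -
      have "load x cls {1..m} (int w) c = card (class_of m x cls (int w) c)" for c
        unfolding load_def class_of_def by simp
      then show ?thesis using sum_load[of "{1..m}" x cls "int w" c0 c1] by simp
    qed
    have below_sum: "below x ?\<kappa> = (\<Sum>c\<in>{R..<R + int \<theta>}. card (class_of m x cls (int w) c))" for x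
      unfolding class_sum below_def by (rule arg_cong[where f = card]) (use cls in auto)
    have above_sum: "above x ?\<kappa> = (\<Sum>c\<in>{R + int \<theta>..<2 * R}. card (class_of m x cls (int w) c))" for x
      unfolding class_sum above_def by (rule arg_cong[where f = card]) (use cls in auto)
    have "below u ?\<kappa> \<le> below u f"
      unfolding below_def by (rule placed_dominates[OF placed wn])
    then have "above u f \<le> above u ?\<kappa>" using split[of u f] split[of u ?\<kappa>] by linarith
    \<comment> \<open>If \<open>b \<le> a\<close>, every round receives at most what it sends, so
      the received products are offset by products already sent, and the total is at most
      \<open>a\<close>. Otherwise the pending departures are offset by the pending arrivals.\<close>
    moreover have "above u ?\<kappa> + below v ?\<kappa> \<le> max a b"
    proof (cases "b \<le> a")
      case True
      then have "below v ?\<kappa> \<le> below u ?\<kappa>"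
        unfolding below_sum using good unfolding good_classes_def a_def b_def by (intro sum_mono) blast
      then show ?thesis using split[of u ?\<kappa>] unfolding a_def by simp
    next
      case False
      then have "a \<le> b" by simp
      then have "above u ?\<kappa> \<le> above v ?\<kappa>"
        unfolding above_sum using good unfolding good_classes_def a_def b_def by (intro sum_mono) blast
      then show ?thesis using split[of v ?\<kappa>] unfolding b_def by simp
    qed
    moreover have "card {q \<in> {1..m}. v q = int w \<and> f q + \<tau> q \<le> int \<theta>} \<le> below v ?\<kappa>"
      unfolding below_def
    proof (rule card_mono)
      show "finite {q \<in> {1..m}. v q = int w \<and> ?\<kappa> q < int \<theta>}" by (rule finite_subset[of _ "{1..m}"]) auto
      show "{q \<in> {1..m}. v q = int w \<and> f q + \<tau> q \<le> int \<theta>} \<subseteq> {q \<in> {1..m}. v q = int w \<and> ?\<kappa> q < int \<theta>}"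
        using f(4) by force
    qed
    moreover have "card {p \<in> out_products J w. \<theta> \<le> \<phi> p} = above u f"
    proof -
      have "{p \<in> out_products J w. \<theta> \<le> \<phi> p} = {p \<in> out_products J w. int \<theta> \<le> f (int p + 1)}"
        using \<phi> sub(3)[of w] by force
      then show ?thesis using out[of w "\<lambda>x _. int \<theta> \<le> x"] unfolding above_def by simp
    qed
    moreover have "card {p \<in> in_products J w. \<phi> p + transit J p \<le> \<theta>} = card {q \<in> {1..m}. v q = int w \<and> f q + \<tau> q \<le> int \<theta>}"
    proof -
      have "{p \<in> in_products J w. \<phi> p + transit J p \<le> \<theta>} = {p \<in> in_products J w. f (int p + 1) + int (transit J p) \<le> int \<theta>}"
        using \<phi> sub(4)[of w] by force
      then show ?thesis using inn[of w "\<lambda>x t. x + t \<le> int \<theta>"] by simp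
    qed
    ultimately have "card {p \<in> out_products J w. \<theta> \<le> \<phi> p} + card {p \<in> in_products J w. \<phi> p + transit J p \<le> \<theta>} \<le> max a b"
      by linarith
    then have "real (card {p \<in> out_products J w. \<theta> \<le> \<phi> p} + card {p \<in> in_products J w. \<phi> p + transit J p \<le> \<theta>}) * z
        \<le> real (max a b) * z"
      using z(2) by (intro mult_right_mono) simp_all
    moreover have "ereal (real (max a b) * z) \<le> capacity J w"
      using c(2,3) unfolding size[OF sub(3)] size[OF sub(4)] a b by (simp add: max_def)
    ultimately show "ereal ((\<Sum>p \<in> {p \<in> out_products J w. \<theta> \<le> \<phi> p}. psize J p) +
       (\<Sum>p \<in> {p \<in> in_products J w. \<phi> p + transit J p \<le> \<theta>}. psize J p)) \<le> capacity J w"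
      unfolding size[OF sub(1)] size[OF sub(2)] distrib_right[symmetric] of_nat_add[symmetric]
      using ereal_less_eq(3) order.trans by blast
  qed
qed

section \<open>The approximation algorithm\<close>

lemma completion_time_ge:
  assumes "reallocation_instance I" "p \<in> products I"
  shows "\<phi> p + transit I p \<le> completion_time I \<phi>"
  using assms unfolding completion_time_def reallocation_instance_def by (intro Max_ge) auto

lemma completion_time_le:
  assumes "reallocation_instance I" "\<And>p. p \<in> products I \<Longrightarrow> \<phi> p + transit I p \<le> X"
  shows "completion_time I \<phi> \<le> X"
  using assms unfolding completion_time_def reallocation_instance_def by (subst Max_le_iff) auto

text \<open>The completion time of any schedule is a possible value of the parameter \<open>T\<close> of the placement.\<close>

definition time_bound :: "('w, 'p) reallocation \<Rightarrow> real \<Rightarrow> nat \<Rightarrow> bool" where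
  "time_bound J z T \<longleftrightarrow> 1 \<le> T \<and> (\<forall>p\<in>products J. transit J p \<le> T) \<and>
     (\<forall>w\<in>warehouses J. card (out_products J w) \<le>
        throughput (cap_code (carry_out J w)) z (card (out_products J w)) * T)"

lemma finite_out_in:
  assumes "reallocation_instance I"
  shows "finite (out_products I w)" "finite (in_products I w)"
  using assms unfolding reallocation_instance_def out_products_def in_products_def by auto

lemma throughput_positive:
  assumes J: "reallocation_instance J" and z: "\<forall>p\<in>products J. psize J p = z" "0 \<le> z"
    and w: "w \<in> warehouses J" "0 < card (out_products J w)"
  shows "1 \<le> throughput (cap_code (carry_out J w)) z (card (out_products J w))"
proof -
  obtain p where p: "p \<in> out_products J w" using w(2) by (metis card.empty ex_in_conv less_irrefl)
  then have "psize J p = z" using z(1) by (simp add: out_products_def)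
  moreover have "0 \<le> carry_out J w" "ereal (psize J p) \<le> carry_out J w"
    using J w(1) p unfolding reallocation_instance_def by blast+
  ultimately show ?thesis
    using fits_throughput[of "carry_out J w" z 1 "card (out_products J w)"] z(2) w(2) by simp
qed

text \<open>A crude value makes the algorithm produce some feasible schedule, so that the minimum
  completion time is attained at all. Where products leave, the throughput is positive because each
  single product respects the carry-out capacity.\<close>

lemma time_bound_exists:
  assumes J: "reallocation_instance J" and z: "\<forall>p\<in>products J. psize J p = z" "0 \<le> z"
  shows "\<exists>T. time_bound J z T"
proof -
  define T where "T = 1 + card (products J) + (\<Sum>p\<in>products J. transit J p)"
  have fin: "finite (products J)" using J unfolding reallocation_instance_def by blast
  have "transit J p \<le> T" if "p \<in> products J" for p
    using member_le_sum[of p "products J" "transit J"] that fin unfolding T_def by simp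
  moreover have "card (out_products J w) \<le> throughput (cap_code (carry_out J w)) z (card (out_products J w)) * T"
    if w: "w \<in> warehouses J" for w
  proof (cases "card (out_products J w) = 0")
    case False
    then have "1 \<le> throughput (cap_code (carry_out J w)) z (card (out_products J w))"
      using throughput_positive[OF J z w] by simp
    then have "1 * T \<le> throughput (cap_code (carry_out J w)) z (card (out_products J w)) * T"
      by (rule mult_right_mono) simp
    moreover have "card (out_products J w) \<le> card (products J)"
      using fin by (intro card_mono) (auto simp: out_products_def)
    moreover have "card (products J) \<le> T" unfolding T_def by simp
    ultimately show ?thesis by linarith
  qed simp
  ultimately show ?thesis unfolding time_bound_def by (intro exI[of _ T]) (auto simp: T_def)
qed

lemma time_bound_out:
  assumes I: "reallocation_instance I" and z: "\<forall>p\<in>products I. psize I p = z" "0 \<le> z"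
    and \<psi>: "feasible I \<psi>" and T: "completion_time I \<psi> \<le> T" "1 \<le> T"
  shows "time_bound I z T"
  unfolding time_bound_def
proof (intro conjI ballI)
  have le: "\<psi> p + transit I p \<le> T" if "p \<in> products I" for p
    using completion_time_ge[OF I that, of \<psi>] T(1) by linarith
  show "transit I p \<le> T" if "p \<in> products I" for p using le[OF that] by simp
  fix w assume w: "w \<in> warehouses I"
  show "card (out_products I w) \<le> throughput (cap_code (carry_out I w)) z (card (out_products I w)) * T"
  proof (rule throughput_bound[where l = 0 and g = \<psi>])
    show "0 \<le> carry_out I w" using I w unfolding reallocation_instance_def by blast
    show "0 \<le> \<psi> p \<and> \<psi> p < 0 + T" if "p \<in> out_products I w" for p
    proof -
      have p: "p \<in> products I" using that by (simp add: out_products_def)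
      then have "0 < transit I p" using I unfolding reallocation_instance_def by blast
      then show ?thesis using le[OF p] by simp
    qed
    fix \<theta>
    have "ereal (\<Sum>p \<in> {p \<in> out_products I w. \<psi> p = \<theta>}. psize I p) \<le> carry_out I w"
      using \<psi> w unfolding feasible_def by blast
    then show "ereal (real (card {p \<in> out_products I w. \<psi> p = \<theta>}) * z) \<le> carry_out I w"
      using z(1) by (simp add: out_products_def)
  qed (use finite_out_in[OF I] z in auto)
qed (rule T(2))

text \<open>A schedule of \<open>I\<close> itself provides the bound: its arrivals at
  \<open>w\<close> respect \<open>carry_in\<close>, which is the carry-out capacity of the reversed
  instance.\<close>

lemma time_bound_in:
  assumes I: "reallocation_instance I" and z: "\<forall>p\<in>products I. psize I p = z" "0 \<le> z"
    and \<psi>: "feasible I \<psi>" and T: "completion_time I \<psi> \<le> T" "1 \<le> T"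
  shows "time_bound (reverse I) z T"
  unfolding time_bound_def reverse_products
proof (intro conjI ballI)
  have le: "\<psi> p + transit I p \<le> T" if "p \<in> products I" for p
    using completion_time_ge[OF I that, of \<psi>] T(1) by linarith
  show "transit (reverse I) p \<le> T" if "p \<in> products (reverse I)" for p
    using le[of p] that by (simp add: reverse_def)
  fix w assume "w \<in> warehouses (reverse I)"
  then have w: "w \<in> warehouses I" by (simp add: reverse_def)
  have "card (in_products I w) \<le> throughput (cap_code (carry_in I w)) z (card (in_products I w)) * T"
  proof (rule throughput_bound[where l = 1 and g = "\<lambda>p. \<psi> p + transit I p"])
    show "0 \<le> carry_in I w" using I w unfolding reallocation_instance_def by blast
    show "1 \<le> \<psi> p + transit I p \<and> \<psi> p + transit I p < 1 + T" if "p \<in> in_products I w" for p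
    proof -
      have p: "p \<in> products I" using that by (simp add: in_products_def)
      then have "0 < transit I p" using I unfolding reallocation_instance_def by blast
      then show ?thesis using le[OF p] by simp
    qed
    fix \<theta>
    have "ereal (\<Sum>p \<in> {p \<in> in_products I w. \<psi> p + transit I p = \<theta>}. psize I p) \<le> carry_in I w"
      using \<psi> w unfolding feasible_def by blast
    then show "ereal (real (card {p \<in> in_products I w. \<psi> p + transit I p = \<theta>}) * z) \<le> carry_in I w"
      using z(1) by (simp add: in_products_def)
  qed (use finite_out_in[OF I] z in auto)
  then show "card (in_products I w) \<le>
      throughput (cap_code (carry_out (reverse I) w)) z (card (in_products I w)) * T"
    by (simp add: reverse_def)
qed (rule T(2))

text \<open>The names of the arrays are parameters, so that the reversed instance need not be
  written to memory: it is read off the same state with the roles of the arrays exchanged.\<close>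

definition represents :: "(nat, nat) reallocation \<Rightarrow> name \<Rightarrow> name \<Rightarrow> name \<Rightarrow> state \<Rightarrow> bool" where
  "represents J src snk cap s \<longleftrightarrow>
     src \<in> {''source'', ''sink''} \<and> snk \<in> {''source'', ''sink''} \<and> cap \<in> {''carry_out'', ''carry_in''} \<and>
     ints s ''products'' 0 = int (card (products J)) \<and> ints s ''warehouses'' 0 = int (card (warehouses J)) \<and>
     (\<forall>p\<in>products J. ints s src (int p) = int (source J p) \<and> ints s snk (int p) = int (sink J p) \<and>
        ints s ''transit'' (int p) = int (transit J p) \<and> reals s ''size'' (int p) = psize J p) \<and>
     (\<forall>w\<in>warehouses J. reals s cap (int w) = cap_code (carry_out J w)) \<and>
     (\<forall>a\<in>{''deg'', ''dd'', ''dr'', ''p1'', ''p2'', ''p3'', ''hd'', ''ct'', ''tf''}. ints s a = (\<lambda>_. 0)) \<and>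
     reals s ''acc'' = (\<lambda>_. 0)"

lemma represents_forward:
  assumes "numbered I"
  shows "represents I ''source'' ''sink'' ''carry_out'' (initial_state I)"
  using assms unfolding represents_def initial_state_def by (auto simp: table_def)

lemma represents_reverse:
  assumes "numbered I"
  shows "represents (reverse I) ''sink'' ''source'' ''carry_in'' (initial_state I)"
  using assms unfolding represents_def initial_state_def by (auto simp: table_def reverse_def)

lemma runs_core_instance:
  fixes J :: "(nat, nat) reallocation"
  assumes J: "reallocation_instance J" "numbered J" and z: "\<forall>p\<in>products J. psize J p = z" "0 \<le> z"
    and inf: "\<forall>w\<in>warehouses J. carry_in J w = \<infinity>"
    and s: "represents J src snk cap s" and T: "time_bound J z T"
    and K: "int (card (products J)) \<le> 2 ^ K" "2 ^ K \<le> max 1 (2 * int (card (products J)))"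
  shows "runs (core src snk cap) (100 * (card (products J) + card (warehouses J) + 1) * (K + 1))
    (\<lambda>s'. \<exists>\<phi>. feasible J \<phi> \<and>
       (\<forall>p\<in>products J. ints s' ''f'' (int p + 1) = int (\<phi> p) \<and> \<phi> p + transit J p \<le> 2 * T)) s"
proof -
  define m n where "m = int (card (products J))" and "n = int (card (warehouses J))"
  define u v \<tau> where "u p = int (source J (nat (p - 1)))" and "v p = int (sink J (nat (p - 1)))"
    and "\<tau> p = int (transit J (nat (p - 1)))" for p
  define D where "D w = throughput (reals s cap w) z (card (members m u w))" for w
  obtain N where prods: "products J = {..<N}" and mN: "m = int N"
    using J(2) unfolding numbered_def m_def by blast
  obtain N' where whs: "warehouses J = {..<N'}" and nN: "n = int N'"
    using J(2) unfolding numbered_def n_def by blast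
  have members: "card (members m u (int w)) = card (out_products J w)" for w
  proof -
    have "members m u (int w) = {q \<in> {1..int N}. source J (nat (q - 1)) = w}"
      unfolding members_def u_def mN by auto
    moreover have "out_products J w = {p \<in> {..<N}. source J p = w}"
      unfolding out_products_def prods by auto
    ultimately show ?thesis using card_shift[of N "\<lambda>p. source J p = w"] by simp
  qed
  have Dw: "D (int w) = throughput (cap_code (carry_out J w)) z (card (out_products J w))" if "w \<in> warehouses J" for w
    using s that unfolding D_def members represents_def by simp
  have prod: "nat (p - 1) \<in> products J" "int (nat (p - 1)) = p - 1" if "p \<in> {1..m}" for p
    using that unfolding prods mN by auto
  have wh: "\<exists>w'\<in>warehouses J. w = int w'" if "w \<in> {0..<n}" for w
    using that unfolding whs nN by (intro bexI[of _ "nat w"]) auto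
  have wh': "int w \<in> {0..<n}" if "w \<in> warehouses J" for w
    using that unfolding whs nN by auto
  have names: "src \<in> {''source'', ''sink''}" "snk \<in> {''source'', ''sink''}" "cap \<in> {''carry_out'', ''carry_in''}"
    using s unfolding represents_def by blast+
  have read: "ints s src (p - 1) = u p" "ints s snk (p - 1) = v p" "reals s ''size'' (p - 1) = z"
    "ints s ''transit'' (p - 1) = \<tau> p" "u p \<in> {0..<n}" "v p \<in> {0..<n}" "1 \<le> \<tau> p" "\<tau> p \<le> int T" if p: "p \<in> {1..m}" for p
  proof -
    define q where "q = nat (p - 1)"
    have q: "q \<in> products J" "int q = p - 1" unfolding q_def using prod[OF p] by blast+
    have "ints s src (int q) = int (source J q)" "ints s snk (int q) = int (sink J q)"
      "ints s ''transit'' (int q) = int (transit J q)" "reals s ''size'' (int q) = psize J q"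
      using s q(1) unfolding represents_def by blast+
    then show "ints s src (p - 1) = u p" "ints s snk (p - 1) = v p" "reals s ''size'' (p - 1) = z"
      "ints s ''transit'' (p - 1) = \<tau> p"
      using z(1) q unfolding q(2) u_def v_def \<tau>_def q_def[symmetric] by auto
    have "source J q \<in> warehouses J" "sink J q \<in> warehouses J" "0 < transit J q"
      using J(1) q(1) unfolding reallocation_instance_def by blast+
    moreover have "transit J q \<le> T" using T q(1) unfolding time_bound_def by blast
    ultimately show "u p \<in> {0..<n}" "v p \<in> {0..<n}" "1 \<le> \<tau> p" "\<tau> p \<le> int T"
      using wh' unfolding u_def v_def \<tau>_def q_def[symmetric] by auto
  qed
  have "runs (core src snk cap) (100 * (nat m + nat n + 1) * (K + 1))
    (\<lambda>s'. placement_result m n (int T) u v (\<lambda>w. int (D w)) \<tau> (ints s' ''f'')) s"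
  proof (rule runs_core[OF names])
    show "ints s ''products'' 0 = m"
      using s unfolding represents_def m_def n_def by (elim conjE)
    show "ints s ''warehouses'' 0 = n"
      using s unfolding represents_def m_def n_def by (elim conjE)
    show "reals s ''acc'' = (\<lambda>_. 0)"
      using s unfolding represents_def m_def n_def by (elim conjE)
    show "\<forall>a\<in>{''deg'', ''dd'', ''dr'', ''p1'', ''p2'', ''p3'', ''hd'', ''ct'', ''tf''}. ints s a = (\<lambda>_. 0)"
      using s unfolding represents_def m_def n_def by (elim conjE)
    show "D w = throughput (reals s cap w) z (card (members m u w))" for w by (rule D_def)
    show "1 \<le> D w" if w: "w \<in> {0..<n}" and "0 < card (members m u w)" for w
    proof -
      obtain w' where w': "w' \<in> warehouses J" "w = int w'" using wh[OF w] by blast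
      then show ?thesis using throughput_positive[OF J(1) z w'(1)] that(2) Dw[OF w'(1)] members by simp
    qed
    show "int (card (members m u w)) \<le> int (D w) * int T" if w: "w \<in> {0..<n}" for w
    proof -
      obtain w' where w': "w' \<in> warehouses J" "w = int w'" using wh[OF w] by blast
      then have "card (out_products J w') \<le> D w * T"
        using T Dw[OF w'(1)] unfolding time_bound_def by simp
      then have "int (card (members m u w)) \<le> int (D w * T)"
        unfolding w'(2) members by (simp only: of_nat_le_iff)
      then show ?thesis by simp
    qed
    show "1 \<le> int T" using T unfolding time_bound_def by simp
  qed (use read K in \<open>auto simp: m_def n_def\<close>)
  then show ?thesis
  proof (rule runs_mono)
    show "100 * (nat m + nat n + 1) * (K + 1) \<le> 100 * (card (products J) + card (warehouses J) + 1) * (K + 1)"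
      unfolding m_def n_def by simp
    fix s'
    assume P: "placement_result m n (int T) u v (\<lambda>w. int (D w)) \<tau> (ints s' ''f'')"
    have D: "\<forall>w\<in>warehouses J. D (int w) = throughput (cap_code (carry_out J w)) z (card (members m u (int w)))"
      using Dw members by simp
    note F = feasible_of_placement[OF J z inf, of D T "ints s' ''f''", folded m_def n_def, folded u_def v_def \<tau>_def, OF D P]
    show "\<exists>\<phi>. feasible J \<phi> \<and>
       (\<forall>p\<in>products J. ints s' ''f'' (int p + 1) = int (\<phi> p) \<and> \<phi> p + transit J p \<le> 2 * T)"
    proof (intro exI[of _ "\<lambda>p. nat (ints s' ''f'' (int p + 1))"] conjI ballI)
      show "feasible J (\<lambda>p. nat (ints s' ''f'' (int p + 1)))" by (fact F(1))
      fix p assume "p \<in> products J"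
      note p = bspec[OF F(2) this]
      then show "ints s' ''f'' (int p + 1) = int (nat (ints s' ''f'' (int p + 1)))" by blast
      have "int (nat (ints s' ''f'' (int p + 1)) + transit J p) \<le> int (2 * T)" using p by simp
      then show "nat (ints s' ''f'' (int p + 1)) + transit J p \<le> 2 * T" by (simp only: of_nat_le_iff)
    qed
  qed
qed

section \<open>Output of the schedule\<close>

definition write_forward :: com where
  "write_forward = range_loop ''p'' (IConst 1) (IAdd (IVar ''products'') (IConst 1))
     (SetInt ''schedule'' (ISub (IVar ''p'') (IConst 1)) (ICell ''f'' (IVar ''p'')))"

lemma runs_write_forward:
  fixes s :: state
  assumes m: "ints s ''products'' 0 = int m"
  shows "runs write_forward (3 * m + 2) (\<lambda>s'. \<forall>p<m. ints s' ''schedule'' (int p) = ints s ''f'' (int p + 1)) s"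
proof -
  define Inv where "Inv i s' \<longleftrightarrow> (\<forall>p. int p + 1 < i \<longrightarrow> ints s' ''schedule'' (int p) = ints s ''f'' (int p + 1))"
    for i :: int and s' :: state
  have "runs write_forward ((1 + 2) * nat (int m + 1 - 1) + 2) (Inv (int m + 1)) s"
    unfolding write_forward_def
  proof (rule runs_range_loop)
    fix i s'
    assume i: "1 \<le> i" "i < int m + 1" "ints s' ''p'' 0 = i" and I: "Inv i s'"
      and fr: "frame (insert ''p'' (mods (SetInt ''schedule'' (ISub (IVar ''p'') (IConst 1)) (ICell ''f'' (IVar ''p''))))) s s'"
    have f: "ints s' ''f'' = ints s ''f''" using frame_ints[OF fr, of "''f''"] by simp
    show "runs (SetInt ''schedule'' (ISub (IVar ''p'') (IConst 1)) (ICell ''f'' (IVar ''p''))) 1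
      (\<lambda>s''. Inv (i + 1) (set_var ''p'' (i + 1) s'')) s'"
      using I i f unfolding Inv_def by (intro runsI) (auto simp: wp_simps)
  qed (use m in \<open>auto simp: frame_def Inv_def\<close>)
  then show ?thesis unfolding Inv_def by (rule runs_mono) auto
qed

abbreviation update_max :: "com" where
  "update_max \<equiv>
     If (ILess (IVar ''T'') (IAdd (ICell ''f'' (IVar ''p'')) (ICell ''transit'' (ISub (IVar ''p'') (IConst 1)))))
        (''T'' ::= IAdd (ICell ''f'' (IVar ''p'')) (ICell ''transit'' (ISub (IVar ''p'') (IConst 1)))) Skip"

abbreviation reflect :: "com" where
  "reflect \<equiv>
     SetInt ''schedule'' (ISub (IVar ''p'') (IConst 1))
        (ISub (ISub (IVar ''T'') (ICell ''f'' (IVar ''p''))) (ICell ''transit'' (ISub (IVar ''p'') (IConst 1))))"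

definition write_reversed :: com where
  "write_reversed =
     ''T'' ::= IConst 0;;
     range_loop ''p'' (IConst 1) (IAdd (IVar ''products'') (IConst 1))
      update_max;;
     range_loop ''p'' (IConst 1) (IAdd (IVar ''products'') (IConst 1))
      reflect"

text \<open>As \<open>T\<close> is unknown to the program, time is reflected at the latest arrival.
  That this maximum is attained by a product carries the bound \<open>2 * T\<close> over to
  \<open>X\<close>.\<close>

lemma runs_write_reversed:
  fixes s :: state
  assumes m: "ints s ''products'' 0 = int m"
  defines "g \<equiv> \<lambda>p. ints s ''f'' (int p + 1) + ints s ''transit'' (int p)"
  shows "runs write_reversed (7 * m + 5) (\<lambda>s'. \<exists>X\<ge>0. (\<forall>p<m. g p \<le> X \<and> ints s' ''schedule'' (int p) = X - g p) \<and>
     (X = 0 \<or> (\<exists>p<m. X = g p))) s"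
proof -
  let ?max = update_max
  let ?out = reflect
  let ?loop1 = "range_loop ''p'' (IConst 1) (IAdd (IVar ''products'') (IConst 1)) ?max"
  let ?loop2 = "range_loop ''p'' (IConst 1) (IAdd (IVar ''products'') (IConst 1)) ?out"
  define Inv1 where "Inv1 i s' \<longleftrightarrow> 0 \<le> ints s' ''T'' 0 \<and> (\<forall>p. int p + 1 < i \<longrightarrow> g p \<le> ints s' ''T'' 0) \<and>
     (ints s' ''T'' 0 = 0 \<or> (\<exists>p. int p + 1 < i \<and> ints s' ''T'' 0 = g p))" for i :: int and s' :: state
  define Inv2 where "Inv2 X i s' \<longleftrightarrow> (\<forall>p. int p + 1 < i \<longrightarrow> ints s' ''schedule'' (int p) = X - g p)"
    for i X :: int and s' :: state
  have less: "int p + 1 < int m + 1 \<longleftrightarrow> p < m" for p by linarith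
  let ?s0 = "set_var ''T'' 0 s"
  have one: "runs ?loop1 ((2 + 2) * nat (int m + 1 - 1) + 2) (Inv1 (int m + 1)) ?s0"
  proof (rule runs_range_loop)
    fix i s'
    assume i: "1 \<le> i" "i < int m + 1" "ints s' ''p'' 0 = i" and I: "Inv1 i s'"
      and fr: "frame (insert ''p'' (mods ?max)) ?s0 s'"
    have f: "ints s' ''f'' = ints s ''f''" "ints s' ''transit'' = ints s ''transit''"
      using frame_ints[OF fr, of "''f''"] frame_ints[OF fr, of "''transit''"] by simp_all
    obtain q where q: "i = int q + 1" using i(1) by (metis add.commute le_iff_add nonneg_int_cases zle_iff_zadd)
    have g: "ints s ''f'' (int q + 1) + ints s ''transit'' (int q) = g q" unfolding g_def by simp
    have less_i: "int p + 1 < i + 1 \<longleftrightarrow> int p + 1 < i \<or> p = q" for p using q by auto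
    show "runs ?max 2 (\<lambda>s''. Inv1 (i + 1) (set_var ''p'' (i + 1) s'')) s'"
    proof (cases "ints s' ''T'' 0 < g q")
      case True
      then have "Inv1 (i + 1) s3" if "ints s3 ''T'' 0 = g q" for s3
        using I unfolding Inv1_def that less_i by force
      then show ?thesis using True by (intro runsI) (simp add: wp_simps i(3) q f g)
    next
      case False
      then have "Inv1 (i + 1) s3" if "ints s3 ''T'' = ints s' ''T''" for s3
        using I unfolding Inv1_def that less_i by force
      then show ?thesis using False by (intro runsI) (simp add: wp_simps i(3) q f g)
    qed
  qed (use m in \<open>auto simp: frame_def Inv1_def\<close>)
  have two: "runs ?loop2 ((1 + 2) * nat (int m + 1 - 1) + 2) (Inv2 (ints s1 ''T'' 0) (int m + 1)) s1"
    if fr1: "frame (mods ?loop1) ?s0 s1" for s1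
  proof (rule runs_range_loop)
    have eq1: "ints s1 a = ints s a" if "a \<notin> {''p'', ''T''}" for a
      using frame_ints[OF fr1, of a] that by simp
    show "ival (IAdd (IVar ''products'') (IConst 1)) s' = int m + 1" if "frame (insert ''p'' (mods ?out)) s1 s'" for s'
      using frame_ints[OF that, of "''products''"] eq1 m by simp
    fix i s'
    assume i: "1 \<le> i" "i < int m + 1" "ints s' ''p'' 0 = i" and I: "Inv2 (ints s1 ''T'' 0) i s'"
      and fr: "frame (insert ''p'' (mods ?out)) s1 s'"
    have f: "ints s' ''f'' = ints s ''f''" "ints s' ''transit'' = ints s ''transit''" "ints s' ''T'' = ints s1 ''T''"
      using frame_ints[OF fr, of "''f''"] frame_ints[OF fr, of "''transit''"] frame_ints[OF fr, of "''T''"] eq1 by simp_all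
    show "runs ?out 1 (\<lambda>s''. Inv2 (ints s1 ''T'' 0) (i + 1) (set_var ''p'' (i + 1) s'')) s'"
      using I i(3) f unfolding Inv2_def by (intro runsI) (auto simp: wp_simps g_def)
  qed (use m in \<open>auto simp: Inv2_def\<close>)
  have loops: "runs (?loop1;; ?loop2) (7 * m + 4) (\<lambda>s'. \<exists>X\<ge>0. (\<forall>p<m. g p \<le> X \<and> ints s' ''schedule'' (int p) = X - g p) \<and>
     (X = 0 \<or> (\<exists>p<m. X = g p))) ?s0"
  proof (rule runs_SeqI[OF one])
    fix s1 assume I1: "Inv1 (int m + 1) s1" and fr1: "frame (mods ?loop1) ?s0 s1"
    show "runs ?loop2 (3 * m + 2) (\<lambda>s'. \<exists>X\<ge>0. (\<forall>p<m. g p \<le> X \<and> ints s' ''schedule'' (int p) = X - g p) \<and>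
     (X = 0 \<or> (\<exists>p<m. X = g p))) s1"
    proof (rule runs_mono[OF two[OF fr1]])
      fix s2 assume "Inv2 (ints s1 ''T'' 0) (int m + 1) s2"
      then show "\<exists>X\<ge>0. (\<forall>p<m. g p \<le> X \<and> ints s2 ''schedule'' (int p) = X - g p) \<and> (X = 0 \<or> (\<exists>p<m. X = g p))"
        using I1 unfolding Inv1_def Inv2_def less by blast
    qed simp
  qed simp
  have "runs (''T'' ::= IConst 0) 1 (\<lambda>s'. s' = ?s0) s"
    by (intro runsI) (simp add: wp_simps)
  then show ?thesis
    unfolding write_reversed_def by (rule runs_SeqI) (use loops in auto)
qed

text \<open>\<open>m \<le> 2 ^ K\<close> bounds the number of levels, and
  \<open>2 ^ K \<le> 2 * m\<close> bounds \<open>R\<close> and hence the size of the trees.\<close>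

lemma log_exponent:
  fixes m :: nat
  obtains K where "int m \<le> 2 ^ K" "2 ^ K \<le> max 1 (2 * int m)" "m \<ge> 2 \<longrightarrow> real K \<le> log 2 (real m) + 1"
proof (cases "m = 0")
  case True
  then show ?thesis using that[of 0] by simp
next
  case False
  then obtain k where k: "2 ^ k \<le> m" "m < 2 ^ (k + 1)" using ex_power_ivl1[of 2 m] by auto
  then have "m \<le> 2 ^ Suc k" "2 ^ Suc k \<le> 2 * m" by simp_all
  then have "int m \<le> int (2 ^ Suc k)" "int (2 ^ Suc k) \<le> int (2 * m)" by (simp_all only: of_nat_le_iff)
  then have "int m \<le> 2 ^ Suc k" "2 ^ Suc k \<le> 2 * int m" by simp_all
  moreover have "real k \<le> log 2 (real m)"
  proof -
    have "real (2 ^ k) \<le> real m" using k(1) by (simp only: of_nat_le_iff)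
    then have "2 powr real k \<le> real m" by (simp add: powr_realpow)
    then show ?thesis using False by (simp add: le_log_iff)
  qed
  ultimately show ?thesis by (intro that[of "Suc k"]) (simp_all del: power_Suc)
qed

text \<open>The constant is \<open>200 * 2 * 3\<close>, by
  \<open>m + n + 1 \<le> 2 * (m * n)\<close> and \<open>K + 1 \<le> 3 * log 2 m\<close>.\<close>

lemma running_time:
  fixes m n K t :: nat
  assumes "2 \<le> m" "1 \<le> n" "real K \<le> log 2 (real m) + 1" "t \<le> 200 * (m + n + 1) * (K + 1)"
  shows "real t \<le> 1200 * (real m * real n * log 2 (real m))"
proof -
  have L: "1 \<le> log 2 (real m)" using assms(1) by simp
  have "m + n + 1 \<le> 2 * (m * n)"
  proof -
    obtain a b where "m = 2 + a" "n = 1 + b" using assms(1,2) by (auto simp: le_iff_add)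
    then show ?thesis by (simp add: algebra_simps)
  qed
  then have "real (m + n + 1) \<le> real (2 * (m * n))" by (simp only: of_nat_le_iff)
  then have 1: "real (m + n + 1) \<le> 2 * (real m * real n)" by simp
  have 2: "real (K + 1) \<le> 3 * log 2 (real m)" using assms(3) L by simp
  have "real t \<le> real (200 * (m + n + 1) * (K + 1))" using assms(4) by (simp only: of_nat_le_iff)
  also have "\<dots> = 200 * real (m + n + 1) * real (K + 1)" by (simp only: of_nat_mult of_nat_numeral)
  also have "\<dots> \<le> 200 * (2 * (real m * real n)) * (3 * log 2 (real m))"
    by (intro mult_mono 1 2 mult_left_mono) auto
  finally show ?thesis by (simp add: algebra_simps)
qed

lemma uniform_value:
  assumes "reallocation_instance I" "uniform_size I"
  obtains z where "\<forall>p\<in>products I. psize I p = z" "0 \<le> z"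
proof (cases "products I = {}")
  case True
  then show ?thesis using that[of 0] by simp
next
  case False
  then obtain q where "q \<in> products I" by blast
  then show ?thesis using assms that[of "psize I q"] unfolding reallocation_instance_def uniform_size_def by blast
qed

lemma min_completion_time_attained:
  assumes "feasible I \<phi>"
  obtains \<psi> where "feasible I \<psi>" "completion_time I \<psi> = min_completion_time I"
proof -
  have "\<exists>\<psi>. feasible I \<psi> \<and> completion_time I \<psi> = min_completion_time I"
    unfolding min_completion_time_def by (rule LeastI_ex) (use assms in blast)
  then show ?thesis using that by blast
qed

lemma warehouses_positive:
  assumes "reallocation_instance I" "0 < card (products I)"
  shows "1 \<le> card (warehouses I)"
proof -
  obtain p where "p \<in> products I" using assms(2) by (metis card.empty ex_in_conv less_irrefl)
  then have "source I p \<in> warehouses I" "finite (warehouses I)"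
    using assms(1) unfolding reallocation_instance_def by blast+
  then show ?thesis by (metis Suc_leI card_gt_0_iff empty_iff One_nat_def)
qed

lemma min_positive:
  assumes "reallocation_instance I" "feasible I \<psi>" "completion_time I \<psi> = min_completion_time I" "p \<in> products I"
  shows "1 \<le> min_completion_time I"
proof -
  have "0 < transit I p" using assms(1,4) unfolding reallocation_instance_def by blast
  then show ?thesis using completion_time_ge[OF assms(1,4), of \<psi>] assms(3) by simp
qed

lemma forward_algorithm:
  fixes I :: "(nat, nat) reallocation"
  assumes I: "reallocation_instance I" "numbered I" "uniform_size I" and inf: "\<forall>w\<in>warehouses I. carry_in I w = \<infinity>"
  shows "\<exists>t \<phi>. outputs_schedule (core ''source'' ''sink'' ''carry_out'';; write_forward) I t \<phi> \<and>
    (card (products I) \<ge> 2 \<longrightarrow> real t \<le> 1200 * (real (card (products I)) * real (card (warehouses I)) * log 2 (real (card (products I))))) \<and>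
    feasible I \<phi> \<and> completion_time I \<phi> \<le> 2 * min_completion_time I"
proof -
  let ?m = "card (products I)" and ?n = "card (warehouses I)"
  obtain z where z: "\<forall>p\<in>products I. psize I p = z" "0 \<le> z" using uniform_value[OF I(1,3)] .
  obtain K where K: "int ?m \<le> 2 ^ K" "2 ^ K \<le> max 1 (2 * int ?m)" "?m \<ge> 2 \<longrightarrow> real K \<le> log 2 (real ?m) + 1"
    by (rule log_exponent[of ?m])
  note run = runs_core_instance[OF I(1,2) z inf represents_forward[OF I(2)] _ K(1,2)]
  \<comment> \<open>The analysis with a crude bound only shows that feasible schedules exist; an
    optimal one then supplies the bound for the guarantee.\<close>
  obtain T0 where "time_bound I z T0" using time_bound_exists[OF I(1) z] by blast
  from run[OF this] obtain \<phi>0 where "feasible I \<phi>0" unfolding runs_def by blast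
  then obtain \<psi> where \<psi>: "feasible I \<psi>" "completion_time I \<psi> = min_completion_time I"
    using min_completion_time_attained by blast
  \<comment> \<open>Without products the minimum is \<open>0\<close>, whereas
    \<open>time_bound\<close> asks for a positive value.\<close>
  let ?T = "max 1 (min_completion_time I)"
  have T: "time_bound I z ?T" by (rule time_bound_out[OF I(1) z \<psi>(1)]) (use \<psi>(2) in auto)
  from run[OF T] obtain t s \<phi> where core: "exec (core ''source'' ''sink'' ''carry_out'') (initial_state I) t s"
    "t \<le> 100 * (?m + ?n + 1) * (K + 1)" and \<phi>: "feasible I \<phi>"
    "\<forall>p\<in>products I. ints s ''f'' (int p + 1) = int (\<phi> p) \<and> \<phi> p + transit I p \<le> 2 * ?T"
    unfolding runs_def by blast
  have "ints s ''products'' 0 = int ?m"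
    using frame_ints[OF exec_frame[OF core(1)] mods_core(2)] represents_forward[OF I(2)] unfolding represents_def by simp
  from runs_write_forward[OF this] obtain t' s' where emit: "exec write_forward s t' s'" "t' \<le> 3 * ?m + 2"
    "\<forall>p<?m. ints s' ''schedule'' (int p) = ints s ''f'' (int p + 1)"
    unfolding runs_def by blast
  have prods: "p < ?m" if "p \<in> products I" for p
  proof -
    have "p \<in> {..<?m}" using I(2) that unfolding numbered_def by blast
    then show ?thesis by simp
  qed
  show ?thesis
  proof (intro exI[of _ "t + t'"] exI[of _ \<phi>] conjI impI)
    show "outputs_schedule (core ''source'' ''sink'' ''carry_out'';; write_forward) I (t + t') \<phi>"
      unfolding outputs_schedule_def
    proof (intro exI[of _ s'] conjI ballI)
      show "exec (core ''source'' ''sink'' ''carry_out'';; write_forward) (initial_state I) (t + t') s'"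
        by (rule exec.Seq[OF core(1) emit(1)])
      fix p assume p: "p \<in> products I"
      show "ints s' ''schedule'' (int p) = int (\<phi> p)" using emit(3) prods[OF p] \<phi>(2) p by simp
    qed
    have "3 * ?m + 2 \<le> 100 * (?m + ?n + 1) * (K + 1)" by (simp add: algebra_simps)
    then have "t + t' \<le> 200 * (?m + ?n + 1) * (K + 1)" using core(2) emit(2) by (simp add: algebra_simps)
    moreover have "1 \<le> ?n" if "2 \<le> ?m" using warehouses_positive[OF I(1)] that by simp
    ultimately show "real (t + t') \<le> 1200 * (real ?m * real ?n * log 2 (real ?m))" if "2 \<le> ?m"
      using running_time[OF that _ K(3)[rule_format, OF that]] that by blast
    show "feasible I \<phi>" by (fact \<phi>(1))
    show "completion_time I \<phi> \<le> 2 * min_completion_time I"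
    proof (rule completion_time_le[OF I(1)])
      fix p assume p: "p \<in> products I"
      then show "\<phi> p + transit I p \<le> 2 * min_completion_time I"
        using \<phi>(2) min_positive[OF I(1) \<psi> p] by (simp add: max_def)
    qed
  qed
qed

lemma reverse_algorithm:
  fixes I :: "(nat, nat) reallocation"
  assumes I: "reallocation_instance I" "numbered I" "uniform_size I" and inf: "\<forall>w\<in>warehouses I. carry_out I w = \<infinity>"
  shows "\<exists>t \<phi>. outputs_schedule (core ''sink'' ''source'' ''carry_in'';; write_reversed) I t \<phi> \<and>
    (card (products I) \<ge> 2 \<longrightarrow> real t \<le> 1200 * (real (card (products I)) * real (card (warehouses I)) * log 2 (real (card (products I))))) \<and>
    feasible I \<phi> \<and> completion_time I \<phi> \<le> 2 * min_completion_time I"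
proof -
  let ?m = "card (products I)" and ?n = "card (warehouses I)"
  let ?J = "reverse I"
  have same: "products ?J = products I" "warehouses ?J = warehouses I" "transit ?J = transit I" "psize ?J = psize I"
    by (simp_all add: reverse_def)
  obtain z where z: "\<forall>p\<in>products I. psize I p = z" "0 \<le> z" using uniform_value[OF I(1,3)] .
  obtain K where K: "int ?m \<le> 2 ^ K" "2 ^ K \<le> max 1 (2 * int ?m)" "?m \<ge> 2 \<longrightarrow> real K \<le> log 2 (real ?m) + 1"
    by (rule log_exponent[of ?m])
  have J: "reallocation_instance ?J" "numbered ?J" "\<forall>w\<in>warehouses ?J. carry_in ?J w = \<infinity>"
    using reverse_instance[OF I(1)] I(2) inf unfolding numbered_def by (simp_all add: reverse_def)
  note run = runs_core_instance[OF J(1,2) z[folded same(1,4)] J(3) represents_reverse[OF I(2)], unfolded same, OF _ K(1,2)]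
  obtain T0 where "time_bound ?J z T0" using time_bound_exists[OF J(1) z[folded same(1,4)]] by blast
  from run[OF this] obtain \<phi>0 where \<phi>0: "feasible ?J \<phi>0" "\<forall>p\<in>products I. \<phi>0 p + transit I p \<le> 2 * T0"
    unfolding runs_def by blast
  \<comment> \<open>Reflecting a schedule of the reversed instance shows that \<open>I\<close> has a
    feasible one.\<close>
  have "feasible I (\<lambda>p. 2 * T0 - \<phi>0 p - transit I p)"
    by (rule feasible_reverse[OF I(1) \<phi>0(1)]) (use \<phi>0(2) in blast)
  then obtain \<psi> where \<psi>: "feasible I \<psi>" "completion_time I \<psi> = min_completion_time I"
    using min_completion_time_attained by blast
  let ?T = "max 1 (min_completion_time I)"
  have T: "time_bound ?J z ?T" by (rule time_bound_in[OF I(1) z \<psi>(1)]) (use \<psi>(2) in auto)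
  from run[OF T] obtain t s \<phi> where core: "exec (core ''sink'' ''source'' ''carry_in'') (initial_state I) t s"
    "t \<le> 100 * (?m + ?n + 1) * (K + 1)" and \<phi>: "feasible ?J \<phi>"
    "\<forall>p\<in>products I. ints s ''f'' (int p + 1) = int (\<phi> p) \<and> \<phi> p + transit I p \<le> 2 * ?T"
    unfolding runs_def by blast
  have fr: "ints s ''products'' 0 = int ?m" "ints s ''transit'' = ints (initial_state I) ''transit''"
    using frame_ints[OF exec_frame[OF core(1)]] mods_core represents_reverse[OF I(2)] unfolding represents_def same by simp_all
  have prods: "p \<in> products I \<longleftrightarrow> p < ?m" for p
  proof -
    have "products I = {..<?m}" using I(2) unfolding numbered_def by blast
    then have "p \<in> products I \<longleftrightarrow> p \<in> {..<?m}" by (rule arg_cong)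
    then show ?thesis by simp
  qed
  define g where "g p = ints s ''f'' (int p + 1) + ints s ''transit'' (int p)" for p
  have g: "g p = int (\<phi> p + transit I p)" if "p \<in> products I" for p
    using \<phi>(2) that represents_reverse[OF I(2)] unfolding g_def fr represents_def same by simp
  from runs_write_reversed[OF fr(1)] obtain t' s' X where emit: "exec write_reversed s t' s'" "t' \<le> 7 * ?m + 5"
    "0 \<le> X" "\<forall>p<?m. g p \<le> X \<and> ints s' ''schedule'' (int p) = X - g p" "X = 0 \<or> (\<exists>p<?m. X = g p)"
    unfolding runs_def g_def by blast
  define Y where "Y = nat X"
  have Y: "int Y = X" unfolding Y_def using emit(3) by simp
  have le: "\<phi> p + transit I p \<le> Y" if "p \<in> products I" for p
    using emit(4) g[OF that] that unfolding prods Y[symmetric] by auto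
  define \<phi>' where "\<phi>' p = Y - \<phi> p - transit I p" for p
  show ?thesis
  proof (intro exI[of _ "t + t'"] exI[of _ \<phi>'] conjI impI)
    show "outputs_schedule (core ''sink'' ''source'' ''carry_in'';; write_reversed) I (t + t') \<phi>'"
      unfolding outputs_schedule_def
    proof (intro exI[of _ s'] conjI ballI)
      show "exec (core ''sink'' ''source'' ''carry_in'';; write_reversed) (initial_state I) (t + t') s'"
        by (rule exec.Seq[OF core(1) emit(1)])
      fix p assume p: "p \<in> products I"
      then have "ints s' ''schedule'' (int p) = X - g p" using emit(4) unfolding prods by blast
      then show "ints s' ''schedule'' (int p) = int (\<phi>' p)"
        unfolding \<phi>'_def g[OF p] Y[symmetric] using le[OF p] by simp
    qed
    have "7 * ?m + 5 \<le> 100 * (?m + ?n + 1) * (K + 1)" by (simp add: algebra_simps)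
    then have "t + t' \<le> 200 * (?m + ?n + 1) * (K + 1)" using core(2) emit(2) by (simp add: algebra_simps)
    moreover have "1 \<le> ?n" if "2 \<le> ?m" using warehouses_positive[OF I(1)] that by simp
    ultimately show "real (t + t') \<le> 1200 * (real ?m * real ?n * log 2 (real ?m))" if "2 \<le> ?m"
      using running_time[OF that _ K(3)[rule_format, OF that]] that by blast
    show "feasible I \<phi>'" unfolding \<phi>'_def by (rule feasible_reverse[OF I(1) \<phi>(1) le])
    show "completion_time I \<phi>' \<le> 2 * min_completion_time I"
    proof (rule completion_time_le[OF I(1)])
      fix p assume p: "p \<in> products I"
      \<comment> \<open>Transit times are positive, so \<open>X\<close> can be \<open>0\<close> only
        if there are no products.\<close>
      have "X \<noteq> 0" using le[OF p] Y I(1) p unfolding reallocation_instance_def by force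
      then obtain q where q: "q \<in> products I" "X = g q" using emit(5) prods by blast
      then have "Y = \<phi> q + transit I q" using g Y by simp
      then have "Y \<le> 2 * ?T" using \<phi>(2) q(1) by simp
      then have "Y \<le> 2 * min_completion_time I" using min_positive[OF I(1) \<psi> p] by (simp add: max_def)
      then show "\<phi>' p + transit I p \<le> 2 * min_completion_time I" unfolding \<phi>'_def using le[OF p] by simp
    qed
  qed
qed

theorem theorem6:
  shows
  "(\<exists>(prog :: com) (C :: real). \<forall>(I :: (nat, nat) reallocation) n m.
      reallocation_instance I \<and> numbered I \<and>
      n = card (warehouses I) \<and> m = card (products I) \<and>
      uniform_size I \<and> (\<forall>w \<in> warehouses I. carry_in I w = \<infinity>) \<longrightarrow>
      (\<exists>t \<phi>. outputs_schedule prog I t \<phi> \<and>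
             (m \<ge> 2 \<longrightarrow> real t \<le> C * (real m * real n * log 2 (real m))) \<and>
             feasible I \<phi> \<and>
             completion_time I \<phi> \<le> 2 * min_completion_time I))
   \<and>
   (\<exists>(prog :: com) (C :: real). \<forall>(I :: (nat, nat) reallocation) n m.
      reallocation_instance I \<and> numbered I \<and>
      n = card (warehouses I) \<and> m = card (products I) \<and>
      uniform_size I \<and> (\<forall>w \<in> warehouses I. carry_out I w = \<infinity>) \<longrightarrow>
      (\<exists>t \<phi>. outputs_schedule prog I t \<phi> \<and>
             (m \<ge> 2 \<longrightarrow> real t \<le> C * (real m * real n * log 2 (real m))) \<and>
             feasible I \<phi> \<and>
             completion_time I \<phi> \<le> 2 * min_completion_time I))"
proof (intro conjI)
  show "\<exists>(prog :: com) (C :: real). \<forall>(I :: (nat, nat) reallocation) n m.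
      reallocation_instance I \<and> numbered I \<and>
      n = card (warehouses I) \<and> m = card (products I) \<and>
      uniform_size I \<and> (\<forall>w \<in> warehouses I. carry_in I w = \<infinity>) \<longrightarrow>
      (\<exists>t \<phi>. outputs_schedule prog I t \<phi> \<and>
             (m \<ge> 2 \<longrightarrow> real t \<le> C * (real m * real n * log 2 (real m))) \<and>
             feasible I \<phi> \<and>
             completion_time I \<phi> \<le> 2 * min_completion_time I)"
    using forward_algorithm by blast
  show "\<exists>(prog :: com) (C :: real). \<forall>(I :: (nat, nat) reallocation) n m.
      reallocation_instance I \<and> numbered I \<and>
      n = card (warehouses I) \<and> m = card (products I) \<and>
      uniform_size I \<and> (\<forall>w \<in> warehouses I. carry_out I w = \<infinity>) \<longrightarrow>
      (\<exists>t \<phi>. outputs_schedule prog I t \<phi> \<and>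
             (m \<ge> 2 \<longrightarrow> real t \<le> C * (real m * real n * log 2 (real m))) \<and>
             feasible I \<phi> \<and>
             completion_time I \<phi> \<le> 2 * min_completion_time I)"
    using reverse_algorithm by blast
qed

end
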